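(* Let $\mathcal H$ be a separable infinite-dimensional complex Hilbert space, and let $\kappa\geq 4$ be a universal constant with the following property: for every $d\geq 1$, every complex $d\times d$ matrix $H$ of trace zero can be written as $H=UV-VU$ with complex $d\times d$ matrices $U,V$ satisfying $\max\{\|U\|,\|V\|\}\leq\sqrt{\kappa\|H\|}$. Then for every compact operator $T$ on $\mathcal H$ there exist compact operators $A,B$ on $\mathcal H$ such that $$T=AB-BA,\qquad \max\{\|A\|,\|B\|\}\leq 50\sqrt{\kappa\|T\|}.$$
   Context: All norms are operator norms (for matrices, with respect to the Euclidean norm on $\mathbb C^d$). A universal constant $\kappa\ge 4$ with the stated property, independent of the matrix size $d$, exists by a known theorem of Shen, Wang and Zhi; it is fixed throughout. *)

theory Defs
  imports "HOL-Analysis.Analysis" "Jordan_Normal_Form.Matrix"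
begin

text \<open>
  A complex inner product space is a real inner product space carrying a compatible complex
  scalar multiplication and a sesquilinear form, linear in the first argument, whose real part is
  the underlying real inner product. The norm is inherited from \<open>real_inner\<close>, so it is the norm
  induced by \<open>cinner\<close> (see \<open>norm_eq_sqrt_cinner\<close> below).
\<close>

class complex_inner = real_inner +
  fixes scaleC :: "complex \<Rightarrow> 'a \<Rightarrow> 'a"
    and cinner :: "'a \<Rightarrow> 'a \<Rightarrow> complex"
  assumes scaleC_add_right: "scaleC a (x + y) = scaleC a x + scaleC a y"
    and scaleC_add_left: "scaleC (a + b) x = scaleC a x + scaleC b x"
    and scaleC_scaleC: "scaleC a (scaleC b x) = scaleC (a * b) x"
    and scaleC_of_real: "scaleC (complex_of_real r) x = scaleR r x"
    and cinner_commute: "cinner x y = cnj (cinner y x)"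
    and cinner_add_left: "cinner (x + y) z = cinner x z + cinner y z"
    and cinner_scaleC_left: "cinner (scaleC a x) y = a * cinner x y"
    and inner_eq_Re_cinner: "inner x y = Re (cinner x y)"

class chilbert_space = complex_inner + complete_space

global_interpretation complex_vector:
  vector_space "scaleC :: complex \<Rightarrow> 'a \<Rightarrow> 'a::complex_inner"
proof
  fix x :: 'a
  show "scaleC 1 x = x"
    using scaleC_of_real [of 1 x] by simp
qed (simp_all add: scaleC_add_right scaleC_add_left scaleC_scaleC)

lemma cinner_self: "cinner x x = complex_of_real ((norm x)\<^sup>2)"
  for x :: "'a::complex_inner"
proof -
  have "Im (cinner x x) = 0"
    using arg_cong [OF cinner_commute [of x x], of Im] by simp
  moreover have "Re (cinner x x) = (norm x)\<^sup>2"
    by (simp add: inner_eq_Re_cinner [symmetric] power2_norm_eq_inner)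
  ultimately show ?thesis
    by (simp add: complex_eq_iff)
qed

lemma norm_eq_sqrt_cinner: "norm x = sqrt (Re (cinner x x))"
  for x :: "'a::complex_inner"
  by (simp add: cinner_self)

definition infinite_cdim :: "'a::complex_inner itself \<Rightarrow> bool" where
  "infinite_cdim _ \<longleftrightarrow> (\<nexists>B :: 'a set. finite B \<and> complex_vector.span B = UNIV)"

text \<open>Boundedness is not a separate requirement, since relatively compact sets are bounded.\<close>

definition compact_operator :: "('a::complex_inner \<Rightarrow> 'b::complex_inner) \<Rightarrow> bool" where
  "compact_operator T \<longleftrightarrow>
     Vector_Spaces.linear scaleC scaleC T \<and> compact (closure (T ` cball 0 1))"

lemma compact_operator_imp_bounded_linear:
  assumes "compact_operator T"
  shows "bounded_linear T"
proof -
  interpret T: Vector_Spaces.linear scaleC scaleC T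
    using assms by (simp add: compact_operator_def)
  have scale: "T (scaleR r x) = scaleR r (T x)" for r x
    using T.scale [of "complex_of_real r" x] by (simp add: scaleC_of_real)
  have "bounded (T ` cball 0 1)"
    using assms closure_subset bounded_subset compact_imp_bounded
    unfolding compact_operator_def by metis
  then obtain K where K: "\<And>x. norm x \<le> 1 \<Longrightarrow> norm (T x) \<le> K"
    unfolding bounded_iff by (metis image_eqI mem_cball_0)
  show ?thesis
  proof (rule bounded_linear_intro [where K = K])
    fix x
    show "norm (T x) \<le> norm x * K"
    proof (cases "x = 0")
      case True
      then show ?thesis
        by (simp add: T.zero)
    next
      case False
      then have "norm (T (scaleR (inverse (norm x)) x)) \<le> K"
        by (intro K) simp
      with False show ?thesis
        by (simp add: scale field_simps)
    qed
  qed (simp_all add: T.add scale)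
qed

definition trace_mat :: "'a::comm_monoid_add mat \<Rightarrow> 'a" where
  "trace_mat A = (\<Sum>i<dim_row A. A $$ (i, i))"

definition euclidean_norm_vec :: "complex Matrix.vec \<Rightarrow> real" where
  "euclidean_norm_vec v = L2_set (\<lambda>i. cmod (vec_index v i)) {..<dim_vec v}"

definition opnorm_mat :: "complex mat \<Rightarrow> real" where
  "opnorm_mat A =
     (SUP v \<in> {v \<in> carrier_vec (dim_col A). euclidean_norm_vec v \<le> 1}.
        euclidean_norm_vec (A *\<^sub>v v))"

end

theory Submission
  imports Defs
begin

text \<open>
  Let \<open>T\<close> be compact. If it vanishes on \<open>R\<close> and its range is orthogonal to \<open>R\<close>, where
  \<open>R\<close> is infinite dimensional, write \<open>T = X W\<close> with \<open>X\<close>, \<open>W\<close> compact and place copies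
  of the space inside \<open>R\<close>, one for each node \<open>(i, l) \<noteq> (0, 0)\<close> of a quarter lattice. Let
  \<open>z\<^sub>1\<close>, \<open>z\<^sub>2\<close> be the commuting coordinate shifts of the lattice, weighted like the Drury--Arveson
  shift times \<open>(n + 2) powr (-1/2)\<close> in degree \<open>n = i + l\<close>, so that
  \<open>z\<^sub>1\<^sup>* z\<^sub>1 + z\<^sub>2\<^sup>* z\<^sub>2 - z\<^sub>1 z\<^sub>1\<^sup>* - z\<^sub>2 z\<^sub>2\<^sup>*\<close> is the projection onto degree \<open>0\<close>. With \<open>X\<close> and
  \<open>W\<close> alternating from degree to degree, \<open>A = z\<^sub>1\<^sup>* X - z\<^sub>2 W\<close> and \<open>B = z\<^sub>1 W + z\<^sub>2\<^sup>* X\<close> are compact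
  with \<open>T = A B - B A\<close>. Moreover \<open>A\<close> is quasinilpotent, with bounds on its powers that depend on
  \<open>\<parallel>T\<parallel>\<close> only.

  A general \<open>T\<close> can be coupled to such an operator by rows and columns through orthonormal vectors
  \<open>h\<^sub>i\<close>, as small as one likes. If the diagonal entries at the \<open>h\<^sub>i\<close> vanish, giving \<open>A\<close> the
  eigenvectors \<open>h\<^sub>i\<close> with distinct eigenvalues \<open>\<mu>\<^sub>i \<rightarrow> 0\<close> makes all these entries commutators,
  by solving Sylvester equations. Both the vanishing of the diagonal entries and that of the remaining
  entries on \<open>R\<close> are achieved by a similarity close to the identity: as soon as \<open>T\<close> has infinite
  rank there are vectors arbitrarily far out whose images are almost orthogonal to them, so a small shear
  along the image can be used to change the diagonal entry.
\<close>

text \<open>Why two variables: a weighted shift in one variable whose self-commutator is the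
  projection onto degree \<open>0\<close> has constant weights, so it is not compact. In the quarter
  lattice the same unit flow out of the origin is shared by the \<open>n + 1\<close> nodes of degree
  \<open>n\<close>, and the weights tend to \<open>0\<close>.

  Why bounds by the norm only: solving for the row and column at \<open>h i\<close> costs the norm
  of the resolvent of the quasinilpotent part at its eigenvalue, but that part can be constructed
  only once the vectors \<open>h i\<close> and the subspace are fixed. Resolvent bounds that depend
  on \<tau> alone break this circle: the required smallness is known in advance.

  Constants: a factorization with both factors at most \<open>2 * sqrt \<tau>\<close> gives
  \<open>4 * sqrt \<tau>\<close> for the lattice operators. The eigenvalues
  \<open>sqrt \<tau> * (1 / 2) ^ i\<close> add \<open>2 * sqrt \<tau>\<close> to \<open>A\<close>,
  and the solutions of the Sylvester equations add less than that to \<open>B\<close>, hence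
  \<open>6 * sqrt \<tau>\<close>. The shears \<open>1 - N\<close> and \<open>1 + N\<close> have norm
  at most \<open>2\<close>, so the sheared operator has norm at most \<open>4 * \<tau>\<close>, and
  undoing the similarity gives
  \<open>2 * 6 * sqrt (4 * \<tau>) * 2 = 48 * sqrt \<tau>\<close>.\<close>

instance chilbert_space < banach ..

notation scaleC (infixr "*\<^sub>C" 75)
notation cinner ("\<langle>_, _\<rangle>")

section \<open>Complex inner products and orthogonal series\<close>

lemma cinner_add_right: "\<langle>x, y + z\<rangle> = \<langle>x, y\<rangle> + \<langle>x, z\<rangle>"
  by (metis cinner_add_left cinner_commute complex_cnj_add)

lemma cinner_scaleC_right: "\<langle>x, c *\<^sub>C y\<rangle> = cnj c * \<langle>x, y\<rangle>"
  by (metis cinner_commute cinner_scaleC_left complex_cnj_mult)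

lemma scaleC_zero_right [simp]: "c *\<^sub>C (0::'a::complex_inner) = 0"
  by (rule complex_vector.scale_zero_right)

lemma scaleC_zero_left [simp]: "0 *\<^sub>C (x::'a::complex_inner) = 0"
  by (rule complex_vector.scale_zero_left)

lemma scaleC_one [simp]: "1 *\<^sub>C (x::'a::complex_inner) = x"
  by (rule complex_vector.scale_one)

lemma scaleC_minus1: "(-1) *\<^sub>C (x::'a::complex_inner) = - x"
  by (metis complex_vector.scale_minus_left scaleC_one)

lemmas scaleC_diff_right = complex_vector.scale_right_diff_distrib
lemmas scaleC_diff_left = complex_vector.scale_left_diff_distrib
lemmas scaleC_minus_right [simp] = complex_vector.scale_minus_right
lemmas scaleC_minus_left [simp] = complex_vector.scale_minus_left

lemma cinner_zero_left [simp]: "\<langle>0, y\<rangle> = 0"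
  using cinner_scaleC_left [of 0 0 y] by simp

lemma cinner_zero_right [simp]: "\<langle>y, 0\<rangle> = 0"
  using cinner_scaleC_right [of y 0 0] by simp

lemma cinner_minus_left [simp]: "\<langle>- x, y\<rangle> = - \<langle>x, y\<rangle>"
  using cinner_scaleC_left [of "-1" x y] by (simp add: scaleC_minus1)

lemma cinner_minus_right [simp]: "\<langle>x, - y\<rangle> = - \<langle>x, y\<rangle>"
  using cinner_scaleC_right [of x "-1" y] by (simp add: scaleC_minus1)

lemma cinner_diff_left: "\<langle>x - y, z\<rangle> = \<langle>x, z\<rangle> - \<langle>y, z\<rangle>"
  using cinner_add_left [of x "- y" z] by simp

lemma cinner_diff_right: "\<langle>x, y - z\<rangle> = \<langle>x, y\<rangle> - \<langle>x, z\<rangle>"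
  using cinner_add_right [of x y "- z"] by simp

lemma cinner_sum_left: "\<langle>sum f A, y\<rangle> = (\<Sum>i\<in>A. \<langle>f i, y\<rangle>)"
  by (induction A rule: infinite_finite_induct) (simp_all add: cinner_add_left)

lemma cinner_sum_right: "\<langle>y, sum f A\<rangle> = (\<Sum>i\<in>A. \<langle>y, f i\<rangle>)"
  by (induction A rule: infinite_finite_induct) (simp_all add: cinner_add_right)

lemmas cinner_simps = cinner_add_left cinner_add_right cinner_diff_left cinner_diff_right
  cinner_scaleC_left cinner_scaleC_right

lemma cinner_eq_0_commute: "\<langle>x, y\<rangle> = 0 \<longleftrightarrow> \<langle>y, x\<rangle> = 0"
  by (metis cinner_commute complex_cnj_zero)

lemma cinner_self_eq_0 [simp]: "\<langle>x, x\<rangle> = 0 \<longleftrightarrow> x = 0"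
  by (simp add: cinner_self)

lemma norm_scaleC [simp]: "norm (c *\<^sub>C x) = cmod c * norm (x::'a::complex_inner)"
proof -
  have "complex_of_real ((norm (c *\<^sub>C x))\<^sup>2) = c * cnj c * complex_of_real ((norm x)\<^sup>2)"
    unfolding cinner_self [symmetric] by (simp add: cinner_simps)
  also have "c * cnj c = complex_of_real ((cmod c)\<^sup>2)"
    by (metis complex_norm_square of_real_power)
  finally have "(norm (c *\<^sub>C x))\<^sup>2 = (cmod c * norm x)\<^sup>2"
    by (metis of_real_eq_iff of_real_mult power_mult_distrib)
  then show ?thesis
    by (metis norm_ge_zero mult_nonneg_nonneg power2_eq_imp_eq)
qed

lemma cmod_cinner_le: "cmod \<langle>x, y\<rangle> \<le> norm x * norm y"
proof (cases "\<langle>x, y\<rangle> = 0")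
  case False
  \<comment> \<open>Rotating \<open>x\<close> by this phase makes the product real and nonnegative,
    so that the real Cauchy--Schwarz inequality applies.\<close>
  define c where "c = cnj (sgn \<langle>x, y\<rangle>)"
  have "cmod c = 1"
    using False by (simp add: c_def norm_sgn)
  have "\<langle>c *\<^sub>C x, y\<rangle> = complex_of_real (cmod \<langle>x, y\<rangle>)"
    using False unfolding cinner_scaleC_left c_def
    by (simp add: sgn_eq complex_norm_square [symmetric] power2_eq_square divide_simps mult.commute)
  then have "cmod \<langle>x, y\<rangle> = inner (c *\<^sub>C x) y"
    by (simp add: inner_eq_Re_cinner)
  also have "\<dots> \<le> norm (c *\<^sub>C x) * norm y"
    by (rule norm_cauchy_schwarz)
  finally show ?thesis
    by (simp add: \<open>cmod c = 1\<close>)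
qed simp

lemma norm_add_orthogonal:
  assumes "\<langle>x, y\<rangle> = 0"
  shows "(norm (x + y))\<^sup>2 = (norm x)\<^sup>2 + (norm y)\<^sup>2"
proof -
  have "complex_of_real ((norm (x + y))\<^sup>2) = complex_of_real ((norm x)\<^sup>2 + (norm y)\<^sup>2)"
    using assms cinner_eq_0_commute [of x y]
    by (simp add: cinner_self [symmetric] cinner_simps del: of_real_power)
  then show ?thesis
    by (metis of_real_eq_iff)
qed

lemma norm_sum_orthogonal:
  assumes "finite A" "\<And>i j. i \<in> A \<Longrightarrow> j \<in> A \<Longrightarrow> i \<noteq> j \<Longrightarrow> \<langle>u i, u j\<rangle> = 0"
  shows "(norm (sum u A))\<^sup>2 = (\<Sum>i\<in>A. (norm (u i))\<^sup>2)"
  using assms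
proof (induction A rule: finite_induct)
  case (insert a A)
  have "\<langle>u a, sum u A\<rangle> = 0"
    using insert by (auto simp: cinner_sum_right intro!: sum.neutral)
  then show ?case
    using insert by (simp add: norm_add_orthogonal)
qed simp

lemma bounded_linear_scaleC_right: "bounded_linear (\<lambda>x::'a::complex_inner. c *\<^sub>C x)"
proof (rule bounded_linear_intro [where K = "cmod c"])
  fix r and x :: 'a
  show "c *\<^sub>C (r *\<^sub>R x) = r *\<^sub>R (c *\<^sub>C x)"
    by (simp add: scaleC_of_real [symmetric] scaleC_scaleC mult.commute)
qed (simp_all add: scaleC_add_right mult.commute)

lemma bounded_linear_scaleC_left: "bounded_linear (\<lambda>c. c *\<^sub>C (x::'a::complex_inner))"
proof (rule bounded_linear_intro [where K = "norm x"])
  fix r and c :: complex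
  show "(r *\<^sub>R c) *\<^sub>C x = r *\<^sub>R (c *\<^sub>C x)"
    by (simp add: scaleC_of_real [symmetric] scaleC_scaleC scaleR_conv_of_real)
qed (simp_all add: scaleC_add_left)

lemma bounded_linear_cinner_left: "bounded_linear (\<lambda>x::'a::complex_inner. \<langle>x, y\<rangle>)"
proof (rule bounded_linear_intro [where K = "norm y"])
  fix r and x :: 'a
  show "\<langle>r *\<^sub>R x, y\<rangle> = r *\<^sub>R \<langle>x, y\<rangle>"
    by (simp add: scaleC_of_real [symmetric] cinner_scaleC_left scaleR_conv_of_real)
qed (simp_all add: cinner_add_left cmod_cinner_le)

lemma bounded_linear_cinner_right: "bounded_linear (\<lambda>y::'a::complex_inner. \<langle>x, y\<rangle>)"
proof (rule bounded_linear_intro [where K = "norm x"])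
  fix r and y :: 'a
  show "\<langle>x, r *\<^sub>R y\<rangle> = r *\<^sub>R \<langle>x, y\<rangle>"
    by (simp add: scaleC_of_real [symmetric] cinner_scaleC_right scaleR_conv_of_real)
qed (simp_all add: cinner_add_right cmod_cinner_le mult.commute [of _ "norm x"])

lemma cinner_suminf_left: "summable u \<Longrightarrow> \<langle>suminf u, y\<rangle> = (\<Sum>n. \<langle>u n, y\<rangle>)"
  using bounded_linear.suminf [OF bounded_linear_cinner_left] by metis

lemma cinner_suminf_right: "summable u \<Longrightarrow> \<langle>y, suminf u\<rangle> = (\<Sum>n. \<langle>y, u n\<rangle>)"
  using bounded_linear.suminf [OF bounded_linear_cinner_right] by metis

lemma scaleC_suminf: "summable u \<Longrightarrow> c *\<^sub>C suminf u = (\<Sum>n. c *\<^sub>C (u n :: 'a::complex_inner))"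
  using bounded_linear.suminf [OF bounded_linear_scaleC_right] by metis

lemma summable_scaleC: "summable u \<Longrightarrow> summable (\<lambda>n. c *\<^sub>C (u n :: 'a::complex_inner))"
  using bounded_linear.summable [OF bounded_linear_scaleC_right] by metis

lemma cinner_ext:
  assumes "\<And>z. \<langle>x, z\<rangle> = \<langle>y, z\<rangle>"
  shows "x = y"
proof -
  have "\<langle>x - y, x - y\<rangle> = 0"
    using assms [of "x - y"] by (simp only: cinner_diff_left) simp
  then show ?thesis by simp
qed

text \<open>By Pythagoras the Cauchy criterion for the squared norms is the Cauchy criterion for the
  vectors.\<close>

lemma orthogonal_summable:
  fixes u :: "nat \<Rightarrow> 'a::chilbert_space"
  assumes orth: "\<And>m n. m \<noteq> n \<Longrightarrow> \<langle>u m, u n\<rangle> = 0"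
    and sq: "summable (\<lambda>n. (norm (u n))\<^sup>2)"
  shows "summable u"
  unfolding summable_Cauchy
proof (intro allI impI)
  fix e :: real
  assume "e > 0"
  then have "e\<^sup>2 > 0" by simp
  then obtain N where N: "\<And>m n. m \<ge> N \<Longrightarrow> norm (\<Sum>i=m..<n. (norm (u i))\<^sup>2) < e\<^sup>2"
    using sq unfolding summable_Cauchy by blast
  have "norm (sum u {m..<n}) < e" if "m \<ge> N" for m n
  proof -
    have "(norm (sum u {m..<n}))\<^sup>2 = (\<Sum>i=m..<n. (norm (u i))\<^sup>2)"
      using orth by (intro norm_sum_orthogonal) auto
    also have "\<dots> < e\<^sup>2"
      using N [OF that, of n] by (simp add: sum_nonneg)
    finally show ?thesis
      using \<open>e > 0\<close> by (metis less_imp_le power2_less_imp_less)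
  qed
  then show "\<exists>N. \<forall>m\<ge>N. \<forall>n. norm (sum u {m..<n}) < e"
    by (intro exI [of _ N]) simp
qed

lemma orthogonal_norm_suminf:
  fixes u :: "nat \<Rightarrow> 'a::chilbert_space"
  assumes orth: "\<And>m n. m \<noteq> n \<Longrightarrow> \<langle>u m, u n\<rangle> = 0"
    and sq: "summable (\<lambda>n. (norm (u n))\<^sup>2)"
  shows "(norm (suminf u))\<^sup>2 = (\<Sum>n. (norm (u n))\<^sup>2)"
proof -
  have "(\<lambda>N. norm (sum u {..<N}) ^ 2) \<longlonglongrightarrow> norm (suminf u) ^ 2"
    by (intro tendsto_power tendsto_norm summable_LIMSEQ orthogonal_summable assms)
  moreover have "norm (sum u {..<N}) ^ 2 = (\<Sum>n<N. (norm (u n))\<^sup>2)" for N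
    using orth by (intro norm_sum_orthogonal) auto
  ultimately show ?thesis
    using summable_LIMSEQ [OF sq] LIMSEQ_unique by auto
qed

lemma summable_of_bounded_partial_sums:
  fixes f :: "nat \<Rightarrow> real"
  assumes "\<And>n. f n \<ge> 0" "\<And>N. sum f {..<N} \<le> K"
  shows "summable f" "suminf f \<le> K"
proof -
  show "summable f"
    using assms by (rule summableI_nonneg_bounded)
  then show "suminf f \<le> K"
    using assms(2) by (rule suminf_le_const)
qed

section \<open>Orthonormal systems\<close>

text \<open>Zero vectors are allowed, so that Gram--Schmidt needs no case distinction.\<close>

definition orthosystem :: "(nat \<Rightarrow> 'a::complex_inner) \<Rightarrow> bool" where
  "orthosystem e \<longleftrightarrow> (\<forall>m n. m \<noteq> n \<longrightarrow> \<langle>e m, e n\<rangle> = 0) \<and> (\<forall>n. e n = 0 \<or> norm (e n) = 1)"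

text \<open>The orthogonal projection onto the closed span of \<open>e\<close>. The condition
  \<open>proj e x = x\<close> for all \<open>x\<close> serves later as the statement that
  \<open>e\<close> is an orthonormal basis.\<close>

definition proj :: "(nat \<Rightarrow> 'a::chilbert_space) \<Rightarrow> 'a \<Rightarrow> 'a" where
  "proj e x = (\<Sum>n. \<langle>x, e n\<rangle> *\<^sub>C e n)"

lemma orthosystem_orth: "orthosystem e \<Longrightarrow> m \<noteq> n \<Longrightarrow> \<langle>e m, e n\<rangle> = 0"
  by (simp add: orthosystem_def)

lemma orthosystem_norm_le: "orthosystem e \<Longrightarrow> norm (e n) \<le> 1"
  by (metis orthosystem_def norm_zero order_refl zero_le_one)

lemma orthosystem_self: "orthosystem e \<Longrightarrow> \<langle>e n, e n\<rangle> *\<^sub>C e n = e n"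
  by (metis cinner_self orthosystem_def of_real_1 one_power2 scaleC_one scaleC_zero_right)

text \<open>True for unit and for zero vectors alike; it stands in for
  \<open>\<langle>e n, e n\<rangle> = 1\<close>.\<close>

lemma cinner_orthosystem_self: "orthosystem e \<Longrightarrow> \<langle>x, e n\<rangle> * \<langle>e n, e n\<rangle> = \<langle>x, e n\<rangle>"
  by (metis cinner_self cinner_zero_right mult.right_neutral mult_zero_left of_real_1
      one_power2 orthosystem_def)

lemma orthosystem_coeff_norm:
  assumes "orthosystem e"
  shows "norm (\<langle>x, e n\<rangle> *\<^sub>C e n) = cmod \<langle>x, e n\<rangle>"
  using assms by (cases "e n = 0") (auto simp: orthosystem_def)

lemma bessel_finite:
  fixes e :: "nat \<Rightarrow> 'a::complex_inner"
  assumes "orthosystem e"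
  shows "(\<Sum>n<N. (cmod \<langle>x, e n\<rangle>)\<^sup>2) \<le> (norm x)\<^sup>2"
proof -
  define p where "p = (\<Sum>n<N. \<langle>x, e n\<rangle> *\<^sub>C e n)"
  have p2: "(norm p)\<^sup>2 = (\<Sum>n<N. (cmod \<langle>x, e n\<rangle>)\<^sup>2)"
    unfolding p_def
    by (subst norm_sum_orthogonal)
      (auto simp: cinner_simps orthosystem_orth [OF assms] orthosystem_coeff_norm [OF assms]
        simp del: norm_scaleC)
  have "\<langle>x - p, e n\<rangle> = 0" if "n < N" for n
  proof -
    have "\<langle>p, e n\<rangle> = (\<Sum>k<N. if k = n then \<langle>x, e n\<rangle> else 0)"
      unfolding p_def cinner_sum_left
      by (intro sum.cong)
        (auto simp: cinner_simps orthosystem_orth [OF assms] cinner_orthosystem_self [OF assms])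
    then show ?thesis
      using that by (simp add: cinner_diff_left)
  qed
  then have "\<langle>x - p, p\<rangle> = 0"
    by (subst (2) p_def) (simp add: cinner_sum_right cinner_scaleC_right)
  then have "(norm x)\<^sup>2 = (norm (x - p))\<^sup>2 + (norm p)\<^sup>2"
    using norm_add_orthogonal [of "x - p" p] by simp
  then show ?thesis
    using p2 by (metis le_add_same_cancel2 zero_le_power2)
qed

lemma bessel_summable:
  assumes "orthosystem e"
  shows "summable (\<lambda>n. (cmod \<langle>x, e n\<rangle>)\<^sup>2)"
  using bessel_finite [OF assms] by (intro summable_of_bounded_partial_sums) auto

lemma orthosystem_series:
  fixes e :: "nat \<Rightarrow> 'a::chilbert_space"
  assumes e: "orthosystem e" and c: "summable (\<lambda>n. (cmod (c n))\<^sup>2)"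
  shows "summable (\<lambda>n. c n *\<^sub>C e n)"
    and "(norm (\<Sum>n. c n *\<^sub>C e n))\<^sup>2 \<le> (\<Sum>n. (cmod (c n))\<^sup>2)"
    and "\<langle>\<Sum>n. c n *\<^sub>C e n, e k\<rangle> = c k * \<langle>e k, e k\<rangle>"
proof -
  have orth: "\<And>m n. m \<noteq> n \<Longrightarrow> \<langle>c m *\<^sub>C e m, c n *\<^sub>C e n\<rangle> = 0"
    by (simp add: cinner_simps orthosystem_orth [OF e])
  have le: "(norm (c n *\<^sub>C e n))\<^sup>2 \<le> (cmod (c n))\<^sup>2" for n
    using mult_left_mono [OF orthosystem_norm_le [OF e, of n], of "cmod (c n)"]
    by (intro power_mono) auto
  have sq: "summable (\<lambda>n. (norm (c n *\<^sub>C e n))\<^sup>2)"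
    using le by (auto intro: summable_comparison_test' [OF c, of 0] simp del: norm_scaleC)
  show s: "summable (\<lambda>n. c n *\<^sub>C e n)"
    using orth sq by (rule orthogonal_summable)
  show "(norm (\<Sum>n. c n *\<^sub>C e n))\<^sup>2 \<le> (\<Sum>n. (cmod (c n))\<^sup>2)"
    by (subst orthogonal_norm_suminf [OF orth sq]) (auto intro!: suminf_le le sq c simp del: norm_scaleC)
  have "\<langle>\<Sum>n. c n *\<^sub>C e n, e k\<rangle> = (\<Sum>n. \<langle>c n *\<^sub>C e n, e k\<rangle>)"
    by (rule cinner_suminf_left [OF s])
  also have "\<dots> = (\<Sum>n\<in>{k}. \<langle>c n *\<^sub>C e n, e k\<rangle>)"
    by (rule suminf_finite) (auto simp: cinner_simps orthosystem_orth [OF e])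
  finally show "\<langle>\<Sum>n. c n *\<^sub>C e n, e k\<rangle> = c k * \<langle>e k, e k\<rangle>"
    by (simp add: cinner_simps)
qed

lemma proj_summable:
  fixes e :: "nat \<Rightarrow> 'a::chilbert_space"
  shows "orthosystem e \<Longrightarrow> summable (\<lambda>n. \<langle>x, e n\<rangle> *\<^sub>C e n)"
  by (intro orthosystem_series bessel_summable)

lemma cinner_proj_basis:
  fixes e :: "nat \<Rightarrow> 'a::chilbert_space"
  shows "orthosystem e \<Longrightarrow> \<langle>proj e x, e k\<rangle> = \<langle>x, e k\<rangle>"
  unfolding proj_def
  by (subst orthosystem_series) (auto simp: bessel_summable cinner_orthosystem_self)

lemma norm_proj_le:
  fixes e :: "nat \<Rightarrow> 'a::chilbert_space"
  assumes "orthosystem e"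
  shows "norm (proj e x) \<le> norm x"
proof -
  have "(norm (proj e x))\<^sup>2 \<le> (\<Sum>n. (cmod \<langle>x, e n\<rangle>)\<^sup>2)"
    unfolding proj_def by (intro orthosystem_series assms bessel_summable)
  also have "\<dots> \<le> (norm x)\<^sup>2"
    using bessel_finite [OF assms] by (intro summable_of_bounded_partial_sums) auto
  finally show ?thesis
    by (rule power2_le_imp_le) simp
qed

lemma proj_eq_0: "(\<And>n. \<langle>x, e n\<rangle> = 0) \<Longrightarrow> proj e x = 0"
  by (simp add: proj_def)

lemma proj_basis:
  fixes e :: "nat \<Rightarrow> 'a::chilbert_space"
  assumes "orthosystem e"
  shows "proj e (e k) = e k"
proof -
  have "proj e (e k) = (\<Sum>n\<in>{k}. \<langle>e k, e n\<rangle> *\<^sub>C e n)"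
    unfolding proj_def by (rule suminf_finite) (auto simp: orthosystem_orth [OF assms])
  then show ?thesis
    by (simp add: orthosystem_self [OF assms])
qed

lemma proj_cinner_orth:
  fixes e :: "nat \<Rightarrow> 'a::chilbert_space"
  assumes "orthosystem e" "\<And>n. \<langle>e n, y\<rangle> = 0"
  shows "\<langle>proj e x, y\<rangle> = 0"
  unfolding proj_def using assms
  by (simp add: cinner_suminf_left [OF proj_summable] cinner_scaleC_left)

lemma norm_diff_proj_le:
  fixes e :: "nat \<Rightarrow> 'a::chilbert_space"
  assumes "orthosystem e"
  shows "norm (x - proj e x) \<le> norm x"
proof -
  have "\<langle>proj e x, x - proj e x\<rangle> = 0"
    by (rule proj_cinner_orth [OF assms], subst cinner_eq_0_commute)
      (simp add: cinner_diff_left cinner_proj_basis [OF assms])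
  then have "(norm x)\<^sup>2 = (norm (proj e x))\<^sup>2 + (norm (x - proj e x))\<^sup>2"
    using norm_add_orthogonal [of "proj e x" "x - proj e x"] by simp
  then show ?thesis
    by (metis le_add_same_cancel2 norm_ge_zero power2_le_imp_le zero_le_power2)
qed

section \<open>Bounded and compact operators\<close>

text \<open>Complex linearity and one admissible norm bound in a single predicate, so that bounds
  can be added and multiplied along with the operators.\<close>

definition op_bound :: "('a::complex_inner \<Rightarrow> 'a) \<Rightarrow> real \<Rightarrow> bool" where
  "op_bound T K \<longleftrightarrow> (\<forall>x y. T (x + y) = T x + T y) \<and> (\<forall>c x. T (c *\<^sub>C x) = c *\<^sub>C T x) \<and>
     (\<forall>x. norm (T x) \<le> K * norm x)"

lemma op_boundI:
  assumes "\<And>x y. T (x + y) = T x + T y" "\<And>c x. T (c *\<^sub>C x) = c *\<^sub>C T x"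
    "\<And>x. norm (T x) \<le> K * norm x"
  shows "op_bound T K"
  using assms by (simp add: op_bound_def)

lemma
  assumes "op_bound T K"
  shows op_add: "T (x + y) = T x + T y"
    and op_scaleC: "T (c *\<^sub>C x) = c *\<^sub>C T x"
    and op_norm: "norm (T x) \<le> K * norm x"
    and op_zero: "T 0 = 0"
    and op_diff: "T (x - y) = T x - T y"
proof -
  show *: "T (x + y) = T x + T y" "T (c *\<^sub>C x) = c *\<^sub>C T x" "norm (T x) \<le> K * norm x" for x y c
    using assms by (auto simp: op_bound_def)
  show "T 0 = 0"
    using *(2) [of 0 0] by simp
  show "T (x - y) = T x - T y"
    using *(1) [of x "- y"] *(2) [of "-1" y] by (simp add: scaleC_minus1)
qed

lemma op_linear:
  assumes "op_bound T K"
  shows "Vector_Spaces.linear scaleC scaleC T"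
proof -
  have "module_hom scaleC scaleC T"
    by unfold_locales (simp_all add: op_add [OF assms] op_scaleC [OF assms] algebra_simps)
  then show ?thesis
    by (simp add: module_hom_iff_linear)
qed

lemma op_bounded_linear:
  assumes "op_bound T K"
  shows "bounded_linear T"
proof (rule bounded_linear_intro [where K = K])
  fix r x
  show "T (r *\<^sub>R x) = r *\<^sub>R T x"
    using op_scaleC [OF assms, of "complex_of_real r" x] by (simp add: scaleC_of_real)
qed (use op_add [OF assms] op_norm [OF assms] in \<open>auto simp: mult.commute\<close>)

lemma op_sum: "op_bound T K \<Longrightarrow> T (sum f A) = (\<Sum>i\<in>A. T (f i))"
  using op_bounded_linear bounded_linear.linear linear_sum by blast

lemma op_suminf: "op_bound T K \<Longrightarrow> summable u \<Longrightarrow> T (suminf u) = (\<Sum>n. T (u n))"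
  using op_bounded_linear bounded_linear.suminf by blast

lemma op_summable: "op_bound T K \<Longrightarrow> summable u \<Longrightarrow> summable (\<lambda>n. T (u n))"
  using op_bounded_linear bounded_linear.summable by blast

lemma op_bound_mono: "op_bound T K \<Longrightarrow> K \<le> L \<Longrightarrow> op_bound T L"
  unfolding op_bound_def by (meson mult_right_mono norm_ge_zero order_trans)

lemma op_bound_onorm: "op_bound T K \<Longrightarrow> 0 \<le> K \<Longrightarrow> onorm T \<le> K"
  by (rule onorm_bound) (auto simp: op_norm)

lemma compact_op_bound:
  assumes "compact_operator (T :: 'a::complex_inner \<Rightarrow> 'a)"
  shows "op_bound T (onorm T)"
proof -
  interpret T: Vector_Spaces.linear scaleC scaleC T
    using assms by (simp add: compact_operator_def)
  show ?thesis
    using onorm [OF compact_operator_imp_bounded_linear [OF assms]]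
    by (intro op_boundI) (simp_all add: T.add T.scale)
qed

lemma op_bound_zero: "op_bound (\<lambda>x. 0) 0"
  by (simp add: op_bound_def)

lemma op_bound_id: "op_bound (\<lambda>x. x) 1"
  by (simp add: op_bound_def)

lemma op_bound_plus: "op_bound S K \<Longrightarrow> op_bound T L \<Longrightarrow> op_bound (\<lambda>x. S x + T x) (K + L)"
  unfolding op_bound_def
  by (auto simp: scaleC_add_right add_ac distrib_right intro: norm_triangle_mono)

lemma op_bound_scaleC: "op_bound T K \<Longrightarrow> op_bound (\<lambda>x. c *\<^sub>C T x) (cmod c * K)"
  unfolding op_bound_def
  by (auto simp: scaleC_add_right scaleC_scaleC mult.assoc mult.commute [of c] intro: mult_left_mono)

lemma op_bound_uminus: "op_bound T K \<Longrightarrow> op_bound (\<lambda>x. - T x) K"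
  unfolding op_bound_def by auto

lemma op_bound_minus: "op_bound S K \<Longrightarrow> op_bound T L \<Longrightarrow> op_bound (\<lambda>x. S x - T x) (K + L)"
  using op_bound_plus [OF _ op_bound_uminus] by fastforce

lemma op_bound_comp:
  assumes "op_bound S K" "op_bound T L" "0 \<le> K"
  shows "op_bound (\<lambda>x. S (T x)) (K * L)"
proof (rule op_boundI)
  fix x
  have "norm (S (T x)) \<le> K * norm (T x)"
    by (rule op_norm [OF assms(1)])
  also have "\<dots> \<le> K * (L * norm x)"
    by (intro mult_left_mono op_norm [OF assms(2)] assms)
  finally show "norm (S (T x)) \<le> K * L * norm x"
    by (simp add: mult_ac)
qed (simp_all add: op_add [OF assms(1)] op_add [OF assms(2)] op_scaleC [OF assms(1)]
    op_scaleC [OF assms(2)])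

lemma op_bound_proj:
  fixes e :: "nat \<Rightarrow> 'a::chilbert_space"
  assumes "orthosystem e"
  shows "op_bound (proj e) 1"
proof (rule op_boundI)
  fix x y c
  show "proj e (x + y) = proj e x + proj e y"
    unfolding proj_def cinner_add_left scaleC_add_left
    by (rule suminf_add [OF proj_summable proj_summable, symmetric]) (rule assms)+
  show "proj e (c *\<^sub>C x) = c *\<^sub>C proj e x"
    unfolding proj_def cinner_scaleC_left scaleC_scaleC [symmetric]
    by (rule scaleC_suminf [OF proj_summable, symmetric]) (rule assms)
  show "norm (proj e x) \<le> 1 * norm x"
    using norm_proj_le [OF assms] by simp
qed

lemma op_bound_suminf:
  fixes S :: "nat \<Rightarrow> 'a::chilbert_space \<Rightarrow> 'a"
  assumes S: "\<And>n. op_bound (S n) (K n)" and K: "summable K"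
  shows "summable (\<lambda>n. S n x)" "op_bound (\<lambda>x. \<Sum>n. S n x) (suminf K)"
proof -
  have s: "summable (\<lambda>n. S n x)" for x
  proof (rule summable_comparison_test')
    show "summable (\<lambda>n. K n * norm x)"
      by (rule summable_mult2 [OF K])
    show "norm (S n x) \<le> K n * norm x" if "n \<ge> 0" for n
      by (rule op_norm [OF S])
  qed
  then show "summable (\<lambda>n. S n x)" .
  have add: "(\<Sum>n. S n (x + y)) = (\<Sum>n. S n x) + (\<Sum>n. S n y)" for x y
    unfolding op_add [OF S] by (rule suminf_add [OF s s, symmetric])
  have scale: "(\<Sum>n. S n (c *\<^sub>C x)) = c *\<^sub>C (\<Sum>n. S n x)" for c x
    unfolding op_scaleC [OF S] by (rule scaleC_suminf [OF s, symmetric])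
  have le: "norm (\<Sum>n. S n x) \<le> suminf K * norm x" for x
  proof -
    have n: "summable (\<lambda>n. norm (S n x))"
      by (rule summable_comparison_test' [OF summable_mult2 [OF K, of "norm x"], of 0])
        (simp add: op_norm [OF S])
    have "norm (\<Sum>n. S n x) \<le> (\<Sum>n. norm (S n x))"
      by (rule summable_norm [OF n])
    also have "\<dots> \<le> (\<Sum>n. K n * norm x)"
      by (rule suminf_le [OF op_norm [OF S] n summable_mult2 [OF K]])
    also have "\<dots> = suminf K * norm x"
      by (rule suminf_mult2 [OF K, symmetric])
    finally show ?thesis .
  qed
  show "op_bound (\<lambda>x. \<Sum>n. S n x) (suminf K)"
    unfolding op_bound_def using add scale le by blast
qed

section \<open>Compactness through finite nets\<close>

lemma compact_operator_net:
  fixes T :: "'a::complex_inner \<Rightarrow> 'a"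
  assumes "compact_operator T" "e > 0"
  obtains F where "finite F" "\<And>x. norm x \<le> 1 \<Longrightarrow> \<exists>y\<in>F. norm (T x - y) < e"
proof -
  have "compact (closure (T ` cball 0 1))"
    using assms by (simp add: compact_operator_def)
  then obtain F where F: "finite F" "closure (T ` cball 0 1) \<subseteq> (\<Union>y\<in>F. ball y e)"
    using assms(2) unfolding compact_eq_totally_bounded by blast
  have "\<exists>y\<in>F. norm (T x - y) < e" if "norm x \<le> 1" for x
  proof -
    have "T x \<in> closure (T ` cball 0 1)"
      using that by (intro subsetD [OF closure_subset]) auto
    then obtain y where "y \<in> F" "T x \<in> ball y e"
      using F(2) by blast
    then show ?thesis
      by (auto simp: dist_norm norm_minus_commute)
  qed
  with F(1) show ?thesis
    by (rule that)
qed

text \<open>In a complete space a closed totally bounded set is compact. A net of mesh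
  \<open>e / 2\<close> for the image of the ball serves its closure as well, because a finite union
  of closed balls is closed.\<close>

lemma compact_operatorI:
  fixes T :: "'a::chilbert_space \<Rightarrow> 'a"
  assumes T: "op_bound T K"
    and net: "\<And>e. e > 0 \<Longrightarrow> \<exists>F. finite F \<and> (\<forall>x. norm x \<le> 1 \<longrightarrow> (\<exists>y\<in>F. norm (T x - y) < e))"
  shows "compact_operator T"
proof -
  have "\<exists>F. finite F \<and> closure (T ` cball 0 1) \<subseteq> (\<Union>y\<in>F. ball y e)" if "e > 0" for e
  proof -
    obtain F where F: "finite F" "\<And>x. norm x \<le> 1 \<Longrightarrow> \<exists>y\<in>F. norm (T x - y) < e / 2"
      using net [OF half_gt_zero [OF \<open>e > 0\<close>]] by blast
    have "T ` cball 0 1 \<subseteq> (\<Union>y\<in>F. cball y (e / 2))"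
    proof
      fix z
      assume "z \<in> T ` cball 0 1"
      then obtain x where x: "z = T x" "norm x \<le> 1"
        by auto
      then obtain y where "y \<in> F" "norm (T x - y) < e / 2"
        using F(2) by blast
      then show "z \<in> (\<Union>y\<in>F. cball y (e / 2))"
        using x by (auto intro!: bexI [of _ y] simp: dist_norm norm_minus_commute)
    qed
    then have "closure (T ` cball 0 1) \<subseteq> (\<Union>y\<in>F. cball y (e / 2))"
      using F(1) by (intro closure_minimal) auto
    also have "\<dots> \<subseteq> (\<Union>y\<in>F. ball y e)"
      using that by (intro UN_mono) auto
    finally show ?thesis
      using F(1) by blast
  qed
  then have "compact (closure (T ` cball 0 1))"
    unfolding compact_eq_totally_bounded by (auto simp: complete_eq_closed)
  then show ?thesis
    by (simp add: compact_operator_def op_linear [OF T])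
qed

lemma compact_operator_limit:
  fixes T :: "'a::chilbert_space \<Rightarrow> 'a"
  assumes T: "op_bound T K"
    and approx: "\<And>e. e > 0 \<Longrightarrow> \<exists>C. compact_operator C \<and> (\<forall>x. norm (T x - C x) \<le> e * norm x)"
  shows "compact_operator T"
proof (rule compact_operatorI [OF T])
  fix e :: real
  assume "e > 0"
  then obtain C where C: "compact_operator C" "\<And>x. norm (T x - C x) \<le> e / 2 * norm x"
    using approx [OF half_gt_zero] by blast
  obtain F where F: "finite F" "\<And>x. norm x \<le> 1 \<Longrightarrow> \<exists>y\<in>F. norm (C x - y) < e / 2"
    using compact_operator_net [OF C(1) half_gt_zero [OF \<open>e > 0\<close>]] by blast
  have "\<exists>y\<in>F. norm (T x - y) < e" if "norm x \<le> 1" for x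
  proof -
    obtain y where y: "y \<in> F" "norm (C x - y) < e / 2"
      using F(2) [OF \<open>norm x \<le> 1\<close>] by blast
    have "norm (T x - y) \<le> norm (T x - C x) + norm (C x - y)"
      using norm_triangle_ineq [of "T x - C x" "C x - y"] by simp
    also have "norm (T x - C x) \<le> e / 2"
      using order_trans [OF C(2) mult_left_mono [OF that, of "e / 2"]] \<open>e > 0\<close> by simp
    finally show ?thesis
      using y by (intro bexI [of _ y]) simp_all
  qed
  with F(1) show "\<exists>F. finite F \<and> (\<forall>x. norm x \<le> 1 \<longrightarrow> (\<exists>y\<in>F. norm (T x - y) < e))"
    by blast
qed

lemma compact_operator_plus:
  fixes S T :: "'a::chilbert_space \<Rightarrow> 'a"
  assumes "compact_operator S" "compact_operator T"
  shows "compact_operator (\<lambda>x. S x + T x)"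
proof (rule compact_operatorI [OF op_bound_plus [OF compact_op_bound compact_op_bound]])
  fix e :: real
  assume "e > 0"
  obtain F where F: "finite F" "\<And>x. norm x \<le> 1 \<Longrightarrow> \<exists>y\<in>F. norm (S x - y) < e / 2"
    using compact_operator_net [OF assms(1) half_gt_zero [OF \<open>e > 0\<close>]] by blast
  obtain G where G: "finite G" "\<And>x. norm x \<le> 1 \<Longrightarrow> \<exists>y\<in>G. norm (T x - y) < e / 2"
    using compact_operator_net [OF assms(2) half_gt_zero [OF \<open>e > 0\<close>]] by blast
  have "\<exists>y\<in>(\<lambda>(a, b). a + b) ` (F \<times> G). norm (S x + T x - y) < e" if "norm x \<le> 1" for x
  proof -
    obtain a b where ab: "a \<in> F" "norm (S x - a) < e / 2" "b \<in> G" "norm (T x - b) < e / 2"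
      using F(2) G(2) \<open>norm x \<le> 1\<close> by blast
    have "norm (S x + T x - (a + b)) \<le> norm (S x - a) + norm (T x - b)"
      by (metis add_diff_add norm_triangle_ineq)
    also have "\<dots> < e"
      using ab by simp
    finally show ?thesis
      using ab by force
  qed
  with F(1) G(1) show "\<exists>F. finite F \<and> (\<forall>x. norm x \<le> 1 \<longrightarrow> (\<exists>y\<in>F. norm (S x + T x - y) < e))"
    by (meson finite_SigmaI finite_imageI)
qed (use assms in auto)

lemma compact_operator_comp_left:
  fixes S T :: "'a::chilbert_space \<Rightarrow> 'a"
  assumes S: "op_bound S K" and T: "compact_operator T"
  shows "compact_operator (\<lambda>x. S (T x))"
proof -
  define L where "L = max K 1"
  have "L > 0" and S': "op_bound S L"
    using op_bound_mono [OF S, of L] by (auto simp: L_def)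
  show ?thesis
  proof (rule compact_operatorI [OF op_bound_comp [OF S' compact_op_bound [OF T]]])
    fix e :: real
    assume "e > 0"
    then have "e / L > 0"
      using \<open>L > 0\<close> by simp
    obtain F where F: "finite F" "\<And>x. norm x \<le> 1 \<Longrightarrow> \<exists>y\<in>F. norm (T x - y) < e / L"
      using compact_operator_net [OF T \<open>e / L > 0\<close>] by blast
    have "\<exists>y\<in>S ` F. norm (S (T x) - y) < e" if "norm x \<le> 1" for x
    proof -
      obtain y where y: "y \<in> F" "norm (T x - y) < e / L"
        using F(2) [OF \<open>norm x \<le> 1\<close>] by blast
      have "norm (S (T x) - S y) \<le> L * norm (T x - y)"
        using op_norm [OF S'] by (simp flip: op_diff [OF S'])
      also have "\<dots> < e"
        using y(2) \<open>L > 0\<close> by (simp add: field_simps)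
      finally show ?thesis
        using y(1) by blast
    qed
    with F(1) show "\<exists>F. finite F \<and> (\<forall>x. norm x \<le> 1 \<longrightarrow> (\<exists>y\<in>F. norm (S (T x) - y) < e))"
      by (meson finite_imageI)
  qed (use \<open>L > 0\<close> in simp)
qed

lemma compact_operator_scaleC:
  fixes T :: "'a::chilbert_space \<Rightarrow> 'a"
  shows "compact_operator T \<Longrightarrow> compact_operator (\<lambda>x. c *\<^sub>C T x)"
  using compact_operator_comp_left [OF op_bound_scaleC [OF op_bound_id]] by auto

lemma compact_operator_uminus:
  fixes T :: "'a::chilbert_space \<Rightarrow> 'a"
  shows "compact_operator T \<Longrightarrow> compact_operator (\<lambda>x. - T x)"
  using compact_operator_scaleC [of T "-1"] by (simp add: scaleC_minus1)

lemma compact_operator_minus: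
  fixes S T :: "'a::chilbert_space \<Rightarrow> 'a"
  shows "compact_operator S \<Longrightarrow> compact_operator T \<Longrightarrow> compact_operator (\<lambda>x. S x - T x)"
  using compact_operator_plus [OF _ compact_operator_uminus] by fastforce

lemma compact_operator_comp_right:
  fixes S T :: "'a::chilbert_space \<Rightarrow> 'a"
  assumes S: "compact_operator S" and T: "op_bound T K"
  shows "compact_operator (\<lambda>x. S (T x))"
proof -
  define L where "L = max K 1"
  have "L > 0" and T': "op_bound T L"
    using op_bound_mono [OF T, of L] by (auto simp: L_def)
  \<comment> \<open>Rescaled to a contraction, \<open>T\<close> maps the unit ball into itself, and
    the nets for \<open>S\<close> can be used unchanged.\<close>
  define R where "R = (\<lambda>x. complex_of_real (1 / L) *\<^sub>C T x)"
  have R: "op_bound R 1"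
    using op_bound_scaleC [OF T', of "complex_of_real (1 / L)"] \<open>L > 0\<close>
    by (simp add: R_def norm_divide)
  have "compact_operator (\<lambda>x. S (R x))"
  proof (rule compact_operatorI [OF op_bound_comp [OF compact_op_bound [OF S] R]])
    show "onorm S \<ge> 0"
      using S by (intro onorm_pos_le compact_operator_imp_bounded_linear)
    fix e :: real
    assume "e > 0"
    obtain F where F: "finite F" "\<And>x. norm x \<le> 1 \<Longrightarrow> \<exists>y\<in>F. norm (S x - y) < e"
      using compact_operator_net [OF S \<open>e > 0\<close>] by blast
    moreover have "norm (R x) \<le> 1" if "norm x \<le> 1" for x
      using op_norm [OF R, of x] that by simp
    ultimately show "\<exists>F. finite F \<and> (\<forall>x. norm x \<le> 1 \<longrightarrow> (\<exists>y\<in>F. norm (S (R x) - y) < e))"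
      by blast
  qed
  then have "compact_operator (\<lambda>x. complex_of_real L *\<^sub>C S (R x))"
    by (rule compact_operator_scaleC)
  moreover have "complex_of_real L *\<^sub>C S (R x) = S (T x)" for x
    using \<open>L > 0\<close> by (simp add: R_def op_scaleC [OF compact_op_bound [OF S]] scaleC_scaleC)
  ultimately show ?thesis
    by simp
qed

lemma compact_operator_zero: "compact_operator (\<lambda>x::'a::chilbert_space. 0::'a)"
  by (rule compact_operatorI [OF op_bound_zero]) (auto intro!: exI [of _ "{0}"])

lemma compact_operator_sum:
  fixes S :: "'i \<Rightarrow> 'a::chilbert_space \<Rightarrow> 'a"
  assumes "\<And>i. i \<in> I \<Longrightarrow> compact_operator (S i)"
  shows "compact_operator (\<lambda>x. \<Sum>i\<in>I. S i x)"
  using assms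
  by (induction I rule: infinite_finite_induct)
    (simp_all add: compact_operator_zero compact_operator_plus)

lemma compact_operator_suminf:
  fixes S :: "nat \<Rightarrow> 'a::chilbert_space \<Rightarrow> 'a"
  assumes S: "\<And>n. op_bound (S n) (K n)" and K: "summable K"
    and compact: "\<And>n. compact_operator (S n)"
  shows "compact_operator (\<lambda>x. \<Sum>n. S n x)"
proof (rule compact_operator_limit [OF op_bound_suminf(2) [OF S K]])
  fix e :: real
  assume "e > 0"
  obtain N where N: "\<bar>suminf (\<lambda>n. K (n + N))\<bar> \<le> e"
    using suminf_exist_split [OF \<open>e > 0\<close> K] by (metis less_imp_le order_refl real_norm_def)
  have "norm ((\<Sum>n. S n x) - (\<Sum>n<N. S n x)) \<le> e * norm x" for x
  proof -
    have "(\<Sum>n. S n x) - (\<Sum>n<N. S n x) = (\<Sum>n. S (n + N) x)"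
      using suminf_split_initial_segment [OF op_bound_suminf(1) [OF S K], of x N] by simp
    also have "norm \<dots> \<le> suminf (\<lambda>n. K (n + N)) * norm x"
      using S K by (intro op_norm [OF op_bound_suminf(2)] summable_ignore_initial_segment)
    also have "\<dots> \<le> e * norm x"
      using N by (intro mult_right_mono) auto
    finally show ?thesis .
  qed
  then show "\<exists>C. compact_operator C \<and> (\<forall>x. norm ((\<Sum>n. S n x) - C x) \<le> e * norm x)"
    by (intro exI [of _ "\<lambda>x. \<Sum>n<N. S n x"] conjI compact_operator_sum compact allI)
qed

definition form_bound :: "('a::complex_inner \<Rightarrow> complex) \<Rightarrow> real \<Rightarrow> bool" where
  "form_bound \<phi> K \<longleftrightarrow> (\<forall>x y. \<phi> (x + y) = \<phi> x + \<phi> y) \<and> (\<forall>c x. \<phi> (c *\<^sub>C x) = c * \<phi> x) \<and>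
     (\<forall>x. cmod (\<phi> x) \<le> K * norm x)"

lemma form_bound_cinner: "form_bound (\<lambda>x. \<langle>x, v\<rangle>) (norm v)"
  by (simp add: form_bound_def cinner_simps cmod_cinner_le mult.commute [of "norm v"])

lemma op_bound_rank_one:
  assumes "form_bound \<phi> K"
  shows "op_bound (\<lambda>x. \<phi> x *\<^sub>C v) (K * norm v)"
proof (rule op_boundI)
  fix x
  have "cmod (\<phi> x) * norm v \<le> K * norm x * norm v"
    using assms by (intro mult_right_mono) (auto simp: form_bound_def)
  then show "norm (\<phi> x *\<^sub>C v) \<le> K * norm v * norm x"
    by (simp add: mult_ac)
qed (use assms in \<open>auto simp: form_bound_def scaleC_add_left scaleC_scaleC\<close>)

lemma compact_operator_rank_one:
  fixes \<phi> :: "'a::chilbert_space \<Rightarrow> complex" and v :: 'a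
  assumes "form_bound \<phi> K"
  shows "compact_operator (\<lambda>x. \<phi> x *\<^sub>C v)"
proof (rule compact_operatorI [OF op_bound_rank_one [OF assms]])
  fix e :: real
  assume "e > 0"
  have "compact ((\<lambda>c. c *\<^sub>C v) ` cball 0 \<bar>K\<bar>)"
    by (intro compact_continuous_image compact_cball
        linear_continuous_on bounded_linear_scaleC_left)
  then obtain F where F: "finite F" "(\<lambda>c. c *\<^sub>C v) ` cball 0 \<bar>K\<bar> \<subseteq> (\<Union>y\<in>F. ball y e)"
    using \<open>e > 0\<close> unfolding compact_eq_totally_bounded by blast
  have "\<exists>y\<in>F. norm (\<phi> x *\<^sub>C v - y) < e" if "norm x \<le> 1" for x
  proof -
    have "cmod (\<phi> x) \<le> \<bar>K\<bar>"
      using assms that mult_mono [of K "\<bar>K\<bar>" "norm x" 1]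
      unfolding form_bound_def by (fastforce intro: order_trans)
    then have "\<phi> x *\<^sub>C v \<in> (\<Union>y\<in>F. ball y e)"
      using F(2) by (intro subsetD [OF F(2)]) auto
    then show ?thesis
      by (auto simp: dist_norm norm_minus_commute)
  qed
  with F(1) show "\<exists>F. finite F \<and> (\<forall>x. norm x \<le> 1 \<longrightarrow> (\<exists>y\<in>F. norm (\<phi> x *\<^sub>C v - y) < e))"
    by blast
qed

section \<open>Orthogonal complements of finite sets\<close>

lemma cinner_span_eq_0:
  fixes x :: "'a::complex_inner"
  assumes "y \<in> complex_vector.span Y" "\<And>y. y \<in> Y \<Longrightarrow> \<langle>x, y\<rangle> = 0"
  shows "\<langle>x, y\<rangle> = 0"
  using assms(1)
  by (induction rule: complex_vector.span_induct_alt) (simp_all add: cinner_simps assms(2))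

lemma finite_span_projection:
  fixes Y :: "'a::complex_inner set"
  assumes "finite Y"
  shows "\<exists>p\<in>complex_vector.span Y. \<forall>y\<in>Y. \<langle>z - p, y\<rangle> = 0"
  using assms
proof (induction Y arbitrary: z rule: finite_induct)
  case empty
  show ?case
    using complex_vector.span_zero by blast
next
  case (insert w Y)
  obtain p where p: "p \<in> complex_vector.span Y" "\<And>y. y \<in> Y \<Longrightarrow> \<langle>z - p, y\<rangle> = 0"
    using insert.IH by blast
  obtain q where q: "q \<in> complex_vector.span Y" "\<And>y. y \<in> Y \<Longrightarrow> \<langle>w - q, y\<rangle> = 0"
    using insert.IH by blast
  \<comment> \<open>\<open>w - q\<close> is the part of \<open>w\<close> orthogonal to
    \<open>Y\<close>, and \<open>p\<close> is corrected along it. If it vanishes, the quotient is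
    \<open>0\<close> by convention.\<close>
  define c where "c = \<langle>z - p, w - q\<rangle> / \<langle>w - q, w - q\<rangle>"
  define r where "r = p + c *\<^sub>C (w - q)"
  have mono: "complex_vector.span Y \<subseteq> complex_vector.span (insert w Y)"
    by (intro complex_vector.span_mono) auto
  have r_span: "r \<in> complex_vector.span (insert w Y)"
    unfolding r_def using mono p(1) q(1)
    by (intro complex_vector.span_add complex_vector.span_scale complex_vector.span_diff)
      (auto intro: complex_vector.span_base)
  have zr: "z - r = (z - p) - c *\<^sub>C (w - q)"
    by (simp add: r_def)
  have Y: "\<langle>z - r, y\<rangle> = 0" if "y \<in> Y" for y
    unfolding zr using p(2) [OF that] q(2) [OF that] by (simp only: cinner_diff_left cinner_scaleC_left) simp
  have "\<langle>z - r, w - q\<rangle> = 0"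
  proof (cases "w - q = 0")
    case False
    then have "\<langle>w - q, w - q\<rangle> \<noteq> 0" by (metis cinner_self_eq_0)
    then show ?thesis
      unfolding zr by (simp only: cinner_diff_left [of "z - p"] cinner_scaleC_left c_def) simp
  qed (simp only: cinner_zero_right)
  moreover have "\<langle>z - r, q\<rangle> = 0"
    using q(1) Y by (rule cinner_span_eq_0)
  ultimately have "\<langle>z - r, w\<rangle> = 0"
    by (simp add: cinner_diff_right)
  with Y r_span show ?case
    by blast
qed

lemma unit_orthogonal_finite:
  assumes "infinite_cdim TYPE('a::complex_inner)" "finite (Y :: 'a set)"
  shows "\<exists>x. norm x = 1 \<and> (\<forall>y\<in>Y. \<langle>x, y\<rangle> = 0)"
proof -
  obtain z where z: "z \<notin> complex_vector.span Y"
    using assms unfolding infinite_cdim_def by blast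
  obtain p where p: "p \<in> complex_vector.span Y" "\<forall>y\<in>Y. \<langle>z - p, y\<rangle> = 0"
    using finite_span_projection [OF assms(2)] by blast
  have "norm (z - p) \<noteq> 0"
    using z p by auto
  then show ?thesis
    using p(2)
    by (intro exI [of _ "complex_of_real (1 / norm (z - p)) *\<^sub>C (z - p)"])
      (simp add: cinner_scaleC_left norm_divide)
qed

section \<open>Orthonormal bases, adjoints, and factorization of compact operators\<close>

text \<open>Since \<open>sgn 0 = 0\<close>, a vector that depends on its predecessors contributes a
  zero vector, which \<open>orthosystem\<close> admits.\<close>

fun gram_schmidt :: "(nat \<Rightarrow> 'a::complex_inner) \<Rightarrow> nat \<Rightarrow> 'a" where
  "gram_schmidt d n =
     sgn (d n - (\<Sum>k\<in>{..<n}. \<langle>d n, gram_schmidt d k\<rangle> *\<^sub>C gram_schmidt d k))"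

declare gram_schmidt.simps [simp del]

lemma sgn_scaleC: "sgn x = complex_of_real (inverse (norm x)) *\<^sub>C (x::'a::complex_inner)"
  by (simp only: sgn_div_norm scaleC_of_real)

lemma orthosystem_gram_schmidt: "orthosystem (gram_schmidt d)"
proof -
  have unit: "gram_schmidt d n = 0 \<or> norm (gram_schmidt d n) = 1" for n
    by (subst (1 2) gram_schmidt.simps) (simp add: norm_sgn)
  have self: "\<langle>x, gram_schmidt d n\<rangle> * \<langle>gram_schmidt d n, gram_schmidt d n\<rangle> = \<langle>x, gram_schmidt d n\<rangle>" for x n
    using unit [of n] by (auto simp: cinner_self)
  have orth: "\<forall>m<n. \<langle>gram_schmidt d n, gram_schmidt d m\<rangle> = 0" for n
  proof (induction n rule: less_induct)
    case (less n)
    show ?case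
    proof (intro allI impI)
      fix m assume "m < n"
      have "\<langle>\<Sum>k<n. \<langle>d n, gram_schmidt d k\<rangle> *\<^sub>C gram_schmidt d k, gram_schmidt d m\<rangle>
        = (\<Sum>k<n. if k = m then \<langle>d n, gram_schmidt d m\<rangle> else 0)"
        unfolding cinner_sum_left
      proof (intro sum.cong refl)
        fix k assume "k \<in> {..<n}"
        then have "\<langle>gram_schmidt d k, gram_schmidt d m\<rangle> = 0" if "k \<noteq> m"
          using less.IH [of k] less.IH [of m] \<open>m < n\<close> that
          by (cases "k < m") (auto simp: cinner_eq_0_commute [of "gram_schmidt d k"])
        then show "\<langle>\<langle>d n, gram_schmidt d k\<rangle> *\<^sub>C gram_schmidt d k, gram_schmidt d m\<rangle> =
          (if k = m then \<langle>d n, gram_schmidt d m\<rangle> else 0)"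
          by (auto simp: cinner_scaleC_left self)
      qed
      then show "\<langle>gram_schmidt d n, gram_schmidt d m\<rangle> = 0"
        using \<open>m < n\<close>
        by (subst gram_schmidt.simps) (simp add: sgn_scaleC cinner_simps)
    qed
  qed
  have "\<langle>gram_schmidt d m, gram_schmidt d n\<rangle> = 0" if "m \<noteq> n" for m n
    using orth [of m] orth [of n] that cinner_eq_0_commute by (metis nat_neq_iff)
  with unit show ?thesis
    by (simp add: orthosystem_def)
qed

text \<open>Gram--Schmidt is applied to a dense sequence. Each of its members is a combination of
  finitely many \<open>e k\<close>, hence fixed by \<open>proj e\<close>, and the fixed vectors form
  a closed set.\<close>

lemma ex_orthonormal_basis:
  assumes "separable_space (euclidean :: 'a::chilbert_space topology)"
  obtains e :: "nat \<Rightarrow> 'a::chilbert_space" where "orthosystem e" "\<And>x. proj e x = x"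
proof -
  obtain C :: "'a set" where C: "countable C" "closure C = UNIV"
    using assms by (auto simp: separable_space_def)
  have "C \<noteq> {}"
    using C(2) by auto
  define d where "d = from_nat_into C"
  have d: "range d = C"
    unfolding d_def by (rule range_from_nat_into [OF \<open>C \<noteq> {}\<close> C(1)])
  define e where "e = gram_schmidt d"
  have e: "orthosystem e"
    unfolding e_def by (rule orthosystem_gram_schmidt)
  note P = op_bound_proj [OF e]
  have dn: "proj e (d n) = d n" for n
  proof -
    define r where "r = d n - (\<Sum>k<n. \<langle>d n, e k\<rangle> *\<^sub>C e k)"
    have "e n = sgn r"
      unfolding e_def r_def by (rule gram_schmidt.simps)
    then have "complex_of_real (norm r) *\<^sub>C e n = r"
      by (cases "r = 0") (simp_all add: sgn_scaleC scaleC_scaleC)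
    then have "d n = (\<Sum>k<n. \<langle>d n, e k\<rangle> *\<^sub>C e k) + complex_of_real (norm r) *\<^sub>C e n"
      by (simp add: r_def)
    moreover have "proj e ((\<Sum>k<n. \<langle>d n, e k\<rangle> *\<^sub>C e k) + complex_of_real (norm r) *\<^sub>C e n)
      = (\<Sum>k<n. \<langle>d n, e k\<rangle> *\<^sub>C e k) + complex_of_real (norm r) *\<^sub>C e n"
      by (simp add: op_add [OF P] op_sum [OF P] op_scaleC [OF P] proj_basis [OF e])
    ultimately show ?thesis
      by metis
  qed
  have "closed {x. proj e x = x}"
    by (intro closed_Collect_eq linear_continuous_on op_bounded_linear [OF P] continuous_on_id)
  moreover have "C \<subseteq> {x. proj e x = x}"
    using dn d by auto
  ultimately have "closure C \<subseteq> {x. proj e x = x}"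
    by (intro closure_minimal)
  then have "\<And>x. proj e x = x"
    using C(2) by auto
  with e show ?thesis
    by (rule that)
qed

text \<open>The adjoint is written down by its coefficients in the basis. Their square summability
  is the Riesz argument: pairing \<open>y\<close> with the image of the truncated series
  \<open>v\<close> gives \<open>S \<le> K * norm y * sqrt S\<close> for the partial sum
  \<open>S\<close> of the squares.\<close>

lemma ex_adjoint:
  fixes T :: "'a::chilbert_space \<Rightarrow> 'a" and e :: "nat \<Rightarrow> 'a"
  assumes e: "orthosystem e" and basis: "\<And>x. proj e x = x" and T: "op_bound T K" and "K \<ge> 0"
  obtains T' where "op_bound T' K" "\<And>x y. \<langle>T x, y\<rangle> = \<langle>x, T' y\<rangle>"
proof -
  have le: "(\<Sum>n<N. (cmod \<langle>y, T (e n)\<rangle>)\<^sup>2) \<le> (K * norm y)\<^sup>2" for y N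
  proof -
    define S where "S = (\<Sum>n<N. (cmod \<langle>y, T (e n)\<rangle>)\<^sup>2)"
    define v where "v = (\<Sum>n<N. \<langle>y, T (e n)\<rangle> *\<^sub>C e n)"
    have "S \<ge> 0"
      by (simp add: S_def sum_nonneg)
    have "(norm v)\<^sup>2 = (\<Sum>n<N. (norm (\<langle>y, T (e n)\<rangle> *\<^sub>C e n))\<^sup>2)"
      unfolding v_def
      by (intro norm_sum_orthogonal) (auto simp: cinner_simps orthosystem_orth [OF e])
    also have "\<dots> \<le> S"
      unfolding S_def
    proof (intro sum_mono power_mono)
      fix n
      show "norm (\<langle>y, T (e n)\<rangle> *\<^sub>C e n) \<le> cmod \<langle>y, T (e n)\<rangle>"
        using mult_left_mono [OF orthosystem_norm_le [OF e, of n], of "cmod \<langle>y, T (e n)\<rangle>"] by simp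
    qed simp
    finally have "norm v \<le> sqrt S"
      by (simp add: real_le_rsqrt)
    have "\<langle>y, T v\<rangle> = complex_of_real S"
      by (simp add: v_def S_def op_sum [OF T] op_scaleC [OF T] cinner_sum_right cinner_simps
          complex_norm_square mult.commute del: of_real_power)
    then have "S = cmod \<langle>y, T v\<rangle>"
      using \<open>S \<ge> 0\<close> by simp
    also have "\<dots> \<le> norm y * (K * norm v)"
      using cmod_cinner_le [of y "T v"] mult_left_mono [OF op_norm [OF T, of v], of "norm y"] by simp
    also have "\<dots> \<le> (K * norm y) * sqrt S"
      using mult_left_mono [OF \<open>norm v \<le> sqrt S\<close>, of "K * norm y"] \<open>K \<ge> 0\<close> by (simp add: mult_ac)
    finally have "sqrt S * sqrt S \<le> (K * norm y) * sqrt S"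
      using \<open>S \<ge> 0\<close> by simp
    then have "sqrt S \<le> K * norm y"
      using \<open>S \<ge> 0\<close> \<open>K \<ge> 0\<close> mult_right_le_imp_le [of "sqrt S" "sqrt S" "K * norm y"]
      by (cases "S = 0") auto
    then have "(sqrt S)\<^sup>2 \<le> (K * norm y)\<^sup>2"
      using \<open>S \<ge> 0\<close> by (intro power_mono) auto
    then show ?thesis
      using \<open>S \<ge> 0\<close> unfolding S_def by simp
  qed
  have sq: "summable (\<lambda>n. (cmod \<langle>y, T (e n)\<rangle>)\<^sup>2)" for y
    using le by (intro summable_of_bounded_partial_sums) auto
  define T' where "T' y = (\<Sum>n. \<langle>y, T (e n)\<rangle> *\<^sub>C e n)" for y
  have adj: "\<langle>T x, y\<rangle> = \<langle>x, T' y\<rangle>" for x y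
  proof -
    have "\<langle>T x, y\<rangle> = \<langle>T (proj e x), y\<rangle>"
      by (simp add: basis)
    also have "\<dots> = (\<Sum>n. \<langle>x, e n\<rangle> * \<langle>T (e n), y\<rangle>)"
      unfolding proj_def
      by (simp add: op_suminf [OF T proj_summable [OF e]] op_scaleC [OF T] cinner_scaleC_left
          cinner_suminf_left [OF op_summable [OF T proj_summable [OF e]], simplified op_scaleC [OF T]])
    also have "\<dots> = (\<Sum>n. \<langle>x, \<langle>y, T (e n)\<rangle> *\<^sub>C e n\<rangle>)"
      by (simp add: cinner_scaleC_right cinner_commute [symmetric] mult.commute)
    also have "\<dots> = \<langle>x, T' y\<rangle>"
      unfolding T'_def by (rule cinner_suminf_right [OF orthosystem_series(1) [OF e sq], symmetric])
    finally show ?thesis .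
  qed
  have "op_bound T' K"
  proof (rule op_boundI)
    have eq: "a = b" if "\<And>x. \<langle>x, a\<rangle> = \<langle>x, b\<rangle>" for a b :: 'a
      by (rule cinner_ext) (metis that cinner_commute)
    show "T' (x + y) = T' x + T' y" for x y
      by (rule eq) (simp add: cinner_add_right flip: adj)
    show "T' (c *\<^sub>C y) = c *\<^sub>C T' y" for c y
      by (rule eq) (simp add: cinner_scaleC_right flip: adj)
    show "norm (T' y) \<le> K * norm y" for y
    proof (cases "T' y = 0")
      case False
      have "(norm (T' y))\<^sup>2 = cmod \<langle>T (T' y), y\<rangle>"
        unfolding adj cinner_self norm_of_real by simp
      also have "\<dots> \<le> K * norm (T' y) * norm y"
        using cmod_cinner_le [of "T (T' y)" y] mult_right_mono [OF op_norm [OF T, of "T' y"], of "norm y"]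
        by simp
      finally show ?thesis
        using False by (simp add: power2_eq_square mult_ac)
    qed (use \<open>K \<ge> 0\<close> in simp)
  qed
  then show ?thesis
    using adj by (rule that)
qed

definition restrict_system :: "nat set \<Rightarrow> (nat \<Rightarrow> 'a::zero) \<Rightarrow> nat \<Rightarrow> 'a" where
  "restrict_system A e n = (if n \<in> A then e n else 0)"

lemma orthosystem_restrict: "orthosystem e \<Longrightarrow> orthosystem (restrict_system A e)"
  by (auto simp: orthosystem_def restrict_system_def)

lemma proj_restrict_finite:
  "finite A \<Longrightarrow> proj (restrict_system A e) x = (\<Sum>n\<in>A. \<langle>x, e n\<rangle> *\<^sub>C e n)"
  unfolding proj_def
  by (subst suminf_finite [of A]) (auto simp: restrict_system_def intro!: sum.cong)

lemma compact_operator_proj_finite: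
  assumes "finite A"
  shows "compact_operator (proj (restrict_system A e))"
proof -
  have "proj (restrict_system A e) = (\<lambda>x. \<Sum>n\<in>A. \<langle>x, e n\<rangle> *\<^sub>C e n)"
    using proj_restrict_finite [OF assms] by blast
  then show ?thesis
    by (simp only:) (intro compact_operator_sum compact_operator_rank_one [OF form_bound_cinner])
qed

text \<open>The truncations converge pointwise, hence uniformly on a finite net of the image of the
  ball; since their complements are contractions, the distance to the net costs only \<epsilon> /
  2.\<close>

lemma compact_operator_finite_approx:
  fixes T :: "'a::chilbert_space \<Rightarrow> 'a" and e :: "nat \<Rightarrow> 'a"
  assumes e: "orthosystem e" and basis: "\<And>x. proj e x = x" and T: "compact_operator T" and "\<epsilon> > 0"
  shows "\<exists>N. \<forall>n\<ge>N. \<forall>x. norm (T x - proj (restrict_system {..<n} e) (T x)) \<le> \<epsilon> * norm x"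
proof -
  define P where "P n = proj (restrict_system {..<n} e)" for n
  have P: "op_bound (P n) 1" for n
    unfolding P_def by (intro op_bound_proj orthosystem_restrict e)
  have contr: "norm (y - P n y) \<le> norm y" for n y
    unfolding P_def by (intro norm_diff_proj_le orthosystem_restrict e)
  have lim: "(\<lambda>n. P n y) \<longlonglongrightarrow> y" for y
    using summable_LIMSEQ [OF proj_summable [OF e], of y] basis [of y, unfolded proj_def]
    by (simp add: P_def proj_restrict_finite)
  obtain F where F: "finite F" "\<And>x. norm x \<le> 1 \<Longrightarrow> \<exists>y\<in>F. norm (T x - y) < \<epsilon> / 2"
    using compact_operator_net [OF T half_gt_zero [OF \<open>\<epsilon> > 0\<close>]] by blast
  have "\<forall>y\<in>F. \<forall>\<^sub>F n in sequentially. norm (P n y - y) < \<epsilon> / 2"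
    using lim tendstoD [OF lim half_gt_zero [OF \<open>\<epsilon> > 0\<close>]] by (simp add: dist_norm)
  then have "\<forall>\<^sub>F n in sequentially. \<forall>y\<in>F. norm (P n y - y) < \<epsilon> / 2"
    using F(1) by (simp add: eventually_ball_finite)
  then obtain N where N: "\<And>n y. n \<ge> N \<Longrightarrow> y \<in> F \<Longrightarrow> norm (P n y - y) < \<epsilon> / 2"
    unfolding eventually_sequentially by blast
  have unit: "norm (T x - P n (T x)) \<le> \<epsilon>" if n: "n \<ge> N" and x: "norm x \<le> 1" for n x
  proof -
    obtain y where y: "y \<in> F" "norm (T x - y) < \<epsilon> / 2"
      using F(2) [OF x] by blast
    have "T x - P n (T x) = ((T x - y) - P n (T x - y)) + (y - P n y)"
      by (simp add: op_diff [OF P])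
    then have "norm (T x - P n (T x)) \<le> norm ((T x - y) - P n (T x - y)) + norm (y - P n y)"
      by (metis norm_triangle_ineq)
    also have "\<dots> \<le> \<epsilon>"
      using contr [of "T x - y" n] y(2) N [OF n y(1)] by (simp add: norm_minus_commute)
    finally show ?thesis .
  qed
  note TB = compact_op_bound [OF T]
  have "norm (T x - P n (T x)) \<le> \<epsilon> * norm x" if "n \<ge> N" for n x
  proof (cases "x = 0")
    case True
    then show ?thesis by (simp add: op_zero [OF TB] op_zero [OF P])
  next
    case False
    define u where "u = complex_of_real (inverse (norm x)) *\<^sub>C x"
    have "norm u = 1" and x: "x = complex_of_real (norm x) *\<^sub>C u"
      using False by (simp_all add: u_def scaleC_scaleC norm_inverse)
    have "norm (T x - P n (T x)) = norm x * norm (T u - P n (T u))"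
      by (subst (1 2) x) (simp add: op_scaleC [OF TB] op_scaleC [OF P] flip: scaleC_diff_right)
    also have "\<dots> \<le> norm x * \<epsilon>"
      using unit [OF that, of u] \<open>norm u = 1\<close> by (intro mult_left_mono) auto
    finally show ?thesis by (simp add: mult.commute)
  qed
  then show ?thesis
    unfolding P_def by blast
qed

lemma op_bound_real_scale:
  assumes "op_bound T K" "a \<ge> 0"
  shows "op_bound (\<lambda>x. complex_of_real a *\<^sub>C T x) (a * K)"
  using op_bound_scaleC [OF assms(1), of "complex_of_real a"] assms(2) by simp

text \<open>The basis is cut into blocks so long that the part of \<open>T\<close> in block
  \<open>k\<close> has norm at most \<open>(1/4) ^ k * \<tau>\<close>. The square root of this decay
  is put into each factor: \<open>X\<close> scales block \<open>k\<close> by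
  \<open>sqrt \<tau> * (1/2) ^ k\<close>, \<open>W\<close> applies \<open>T\<close> and divides by
  that scale. Both are norm limits of finite sums of compact operators.\<close>

lemma compact_factorization:
  fixes T :: "'a::chilbert_space \<Rightarrow> 'a" and e :: "nat \<Rightarrow> 'a"
  assumes e: "orthosystem e" and basis: "\<And>x. proj e x = x"
    and T: "compact_operator T" and TK: "op_bound T \<tau>" and "\<tau> > 0"
  shows "\<exists>X W. compact_operator X \<and> compact_operator W \<and>
    op_bound X (2 * sqrt \<tau>) \<and> op_bound W (2 * sqrt \<tau>) \<and> (\<forall>x. T x = X (W x))"
proof -
  define P where "P n = proj (restrict_system {..<n} e)" for n
  have P0: "P 0 y = 0" for y
    by (simp add: P_def proj_restrict_finite)
  have "\<exists>N>m. \<forall>x. norm (T x - P N (T x)) \<le> (1/4) ^ k * \<tau> * norm x" for m k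
  proof -
    obtain N where "\<forall>n\<ge>N. \<forall>x. norm (T x - P n (T x)) \<le> ((1/4) ^ k * \<tau>) * norm x"
      using compact_operator_finite_approx [OF e basis T, of "(1/4) ^ k * \<tau>"] \<open>\<tau> > 0\<close>
      unfolding P_def by auto
    then show ?thesis
      by (intro exI [of _ "max N (Suc m)"]) auto
  qed
  then obtain nx where nx: "\<And>m k. nx m k > m"
    "\<And>m k x. norm (T x - P (nx m k) (T x)) \<le> (1/4) ^ k * \<tau> * norm x"
    by metis
  \<comment> \<open>With \<open>n 0 = 0\<close> the blocks exhaust the basis, and the estimate for
    \<open>k = 0\<close> is the norm bound of \<open>T\<close> itself.\<close>
  define n where "n = rec_nat 0 (\<lambda>k m. nx m (Suc k))"
  have n0: "n 0 = 0" and nSuc: "n (Suc k) = nx (n k) (Suc k)" for k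
    by (simp_all add: n_def)
  have less: "n k < n (Suc k)" for k
    unfolding nSuc by (rule nx)
  have mono: "n k \<le> n l" if "k \<le> l" for k l
    using lift_Suc_mono_le [of n, OF less_imp_le [OF less] that] .
  have approx: "norm (T x - P (n k) (T x)) \<le> (1/4) ^ k * \<tau> * norm x" for k x
  proof (cases k)
    case 0
    then show ?thesis using op_norm [OF TK, of x] by (simp add: n0 P0)
  next
    case (Suc l)
    then show ?thesis using nx(2) [of x "n l" "Suc l"] by (simp add: nSuc)
  qed
  define A where "A k = {n k..<n (Suc k)}" for k
  define D where "D k = proj (restrict_system (A k) e)" for k
  have D: "op_bound (D k) 1" and D_compact: "compact_operator (D k)" for k
    unfolding D_def by (auto intro: op_bound_proj orthosystem_restrict e compact_operator_proj_finite simp: A_def)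
  have D_eq: "D k y = (\<Sum>m\<in>A k. \<langle>y, e m\<rangle> *\<^sub>C e m)" for k y
    by (simp add: D_def proj_restrict_finite A_def)
  have D_cong: "D k y = D k z" if "\<And>m. m \<in> A k \<Longrightarrow> \<langle>y, e m\<rangle> = \<langle>z, e m\<rangle>" for k y z
    unfolding D_eq using that by (intro sum.cong) auto
  \<comment> \<open>Block \<open>k\<close> does not see the truncation at \<open>n k\<close>, so it
    inherits the smallness of the remainder of \<open>T\<close> beyond \<open>n k\<close>.\<close>
  have DP: "D k (y - P (n k) y) = D k y" for k y
  proof (rule D_cong)
    fix m assume "m \<in> A k"
    then have "\<langle>P (n k) y, e m\<rangle> = 0"
      unfolding P_def by (intro proj_cinner_orth orthosystem_restrict e)
        (auto simp: restrict_system_def A_def orthosystem_orth [OF e])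
    then show "\<langle>y - P (n k) y, e m\<rangle> = \<langle>y, e m\<rangle>"
      by (simp add: cinner_diff_left)
  qed
  have DD: "D k (D l y) = (if k = l then D k y else 0)" for k l y
  proof -
    have "\<langle>D l y, e m\<rangle> = (if k = l then \<langle>y, e m\<rangle> else 0)" if "m \<in> A k" for m
    proof (cases "k = l")
      case True
      have "restrict_system (A k) e m = e m"
        using that by (simp add: restrict_system_def)
      then show ?thesis
        using True cinner_proj_basis [OF orthosystem_restrict [OF e], of "A k" y m]
        by (simp add: D_def)
    next
      case False
      have "m \<notin> A l"
        using False that mono [of "Suc k" l] mono [of "Suc l" k] unfolding A_def
        by (cases "k < l") (auto simp: not_less)
      then have "\<langle>restrict_system (A l) e i, e m\<rangle> = 0" for i
        using orthosystem_orth [OF e, of i m] by (cases "i = m") (auto simp: restrict_system_def)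
      then have "\<langle>D l y, e m\<rangle> = 0"
        unfolding D_def by (intro proj_cinner_orth orthosystem_restrict e)
      with False show ?thesis by simp
    qed
    then have "D k (D l y) = D k (if k = l then y else 0)"
      by (intro D_cong) auto
    then show ?thesis
      by (simp add: op_zero [OF D])
  qed
  have DT: "op_bound (\<lambda>x. D k (T x)) ((1/4) ^ k * \<tau>)" for k
  proof (rule op_boundI)
    fix x
    show "norm (D k (T x)) \<le> (1/4) ^ k * \<tau> * norm x"
      using op_norm [OF D, of k "T x - P (n k) (T x)"] approx [of x k]
      unfolding DP by simp
  qed (simp_all add: op_add [OF D] op_add [OF TK] op_scaleC [OF D] op_scaleC [OF TK])
  have DT_compact: "compact_operator (\<lambda>x. D k (T x))" for k
    by (rule compact_operator_comp_left [OF D T])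
  define r where "r = sqrt \<tau>"
  have r: "r > 0" "r * r = \<tau>"
    using \<open>\<tau> > 0\<close> by (simp_all add: r_def)
  define SX where "SX k x = complex_of_real (r * (1/2) ^ k) *\<^sub>C D k x" for k x
  define SW where "SW k x = complex_of_real (2 ^ k / r) *\<^sub>C D k (T x)" for k x
  have geo: "summable (\<lambda>k. r * (1/2) ^ k)" "(\<Sum>k. r * (1/2) ^ k) = 2 * r"
    using suminf_mult [of "\<lambda>k. (1/2::real) ^ k" r] by (auto simp: suminf_geometric)
  have SX: "op_bound (SX k) (r * (1/2) ^ k)" for k
    using op_bound_real_scale [OF D, of "r * (1/2) ^ k" k] r(1) by (simp add: SX_def [abs_def])
  have SW: "op_bound (SW k) (r * (1/2) ^ k)" for k
  proof -
    have "2 ^ k / r * ((1/4) ^ k * \<tau>) = (2 * (1/4)) ^ k * (\<tau> / r)"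
      by (simp only: power_mult_distrib) simp
    also have "\<tau> / r = r"
      using r by (simp add: field_simps)
    finally show ?thesis
      using op_bound_real_scale [OF DT, of "2 ^ k / r" k] r(1) by (simp add: SW_def [abs_def] mult.commute)
  qed
  define X where "X x = (\<Sum>k. SX k x)" for x
  define W where "W x = (\<Sum>k. SW k x)" for x
  have X: "op_bound X (2 * r)" and W: "op_bound W (2 * r)"
    unfolding X_def [abs_def] W_def [abs_def]
    using op_bound_suminf(2) [OF SX geo(1)] op_bound_suminf(2) [OF SW geo(1)] by (simp_all only: geo(2))
  have "compact_operator X"
    unfolding X_def [abs_def]
    by (rule compact_operator_suminf [OF SX geo(1)]) (simp add: SX_def [abs_def] compact_operator_scaleC D_compact)
  moreover have "compact_operator W"
    unfolding W_def [abs_def]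
    by (rule compact_operator_suminf [OF SW geo(1)]) (simp add: SW_def [abs_def] compact_operator_scaleC DT_compact)
  moreover have "T x = X (W x)" for x
  proof -
    have DW: "D k (W x) = complex_of_real (2 ^ k / r) *\<^sub>C D k (T x)" for k
    proof -
      have "D k (W x) = (\<Sum>l. D k (SW l x))"
        unfolding W_def by (rule op_suminf [OF D op_bound_suminf(1) [OF SW geo(1)]])
      also have "\<dots> = (\<Sum>l\<in>{k}. D k (SW l x))"
        by (rule suminf_finite) (auto simp: SW_def op_scaleC [OF D] DD)
      finally show ?thesis
        by (simp add: SW_def op_scaleC [OF D] DD)
    qed
    have "SX k (W x) = D k (T x)" for k
    proof -
      have "(r * (1/2) ^ k) * (2 ^ k / r) = 1"
        using r(1) by (simp add: power_divide)
      then show ?thesis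
        unfolding SX_def DW scaleC_scaleC of_real_mult [symmetric] by simp
    qed
    then have XW: "X (W x) = (\<Sum>k. D k (T x))" and s: "summable (\<lambda>k. D k (T x))"
      using op_bound_suminf(1) [OF SX geo(1), of "W x"] by (simp_all add: X_def)
    have part: "(\<Sum>k<K. D k y) = P (n K) y" for K y
    proof (induction K)
      case 0
      then show ?case by (simp add: n0 P0)
    next
      case (Suc K)
      have A: "{..<n (Suc K)} = {..<n K} \<union> A K" "{..<n K} \<inter> A K = {}" "finite (A K)"
        using less [of K] by (auto simp: A_def)
      have "P (n (Suc K)) y = P (n K) y + D K y"
        unfolding P_def D_eq A(1) using A(2,3) by (simp add: proj_restrict_finite sum.union_disjoint)
      with Suc show ?case by simp
    qed
    have "(\<lambda>K. P (n K) (T x) - T x) \<longlonglongrightarrow> 0"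
    proof (rule Lim_null_comparison)
      show "\<forall>\<^sub>F K in sequentially. norm (P (n K) (T x) - T x) \<le> (1/4) ^ K * \<tau> * norm x"
        using approx by (simp add: norm_minus_commute)
      have "(\<lambda>K. (1/4 :: real) ^ K) \<longlonglongrightarrow> 0"
        by (rule LIMSEQ_realpow_zero) auto
      from tendsto_mult_right [OF this, of "\<tau> * norm x"]
      show "(\<lambda>K. (1/4) ^ K * \<tau> * norm x) \<longlonglongrightarrow> 0"
        by (simp add: mult_ac)
    qed
    then have "(\<lambda>K. P (n K) (T x)) \<longlonglongrightarrow> T x"
      by (rule LIM_zero_cancel)
    then have "(\<Sum>k. D k (T x)) = T x"
      using summable_LIMSEQ [OF s] unfolding part by (rule LIMSEQ_unique [rotated])
    with XW show ?thesis by simp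
  qed
  ultimately show ?thesis
    using X W unfolding r_def by (intro exI [of _ X] exI [of _ W]) simp
qed

section \<open>A two-mode weighted shift\<close>

text \<open>The weight of the edge between \<open>(i - 1, l)\<close> and \<open>(i, l)\<close>; for
  the edge between \<open>(i, l - 1)\<close> and \<open>(i, l)\<close> the arguments are swapped.
  The squares form a flow in which every node of degree \<open>n\<close> passes on
  \<open>1 / (n + 1)\<close>. At the origin \<open>0 / 0 = 0\<close> gives the correct
  value.\<close>

definition hop :: "nat \<Rightarrow> nat \<Rightarrow> real" where
  "hop i l = sqrt (real i / (real (i + l) * real (i + l + 1)))"

lemma hop_0 [simp]: "hop 0 l = 0"
  by (simp add: hop_def)

lemma hop_nonneg [simp]: "0 \<le> hop i l"
  by (simp add: hop_def)

lemma hop_square: "hop i l * hop i l = real i / (real (i + l) * real (i + l + 1))"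
  by (simp add: hop_def)

lemma hop_le: "hop i l \<le> 1 / sqrt (real (i + l + 1))"
proof -
  have "real i / (real (i + l) * real (i + l + 1)) = real i / real (i + l) * (1 / real (i + l + 1))"
    by simp
  also have "\<dots> \<le> 1 * (1 / real (i + l + 1))"
    by (intro mult_right_mono) (auto simp: divide_le_eq)
  finally show ?thesis
    unfolding hop_def by (metis mult_1 real_sqrt_divide real_sqrt_le_mono real_sqrt_one)
qed

lemma hop_le_1: "hop i l \<le> 1"
proof -
  have "1 / sqrt (real (i + l + 1)) \<le> 1"
    by simp
  with hop_le [of i l] show ?thesis
    by linarith
qed

lemma hop_outflow: "hop (Suc i) l * hop (Suc i) l + hop (Suc l) i * hop (Suc l) i = 1 / (real (i + l) + 1)"
proof -
  have "real (Suc i) / (a * b) + real (Suc l) / (a * b) = 1 / a"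
    if "a = real (i + l) + 1" "b = real (i + l) + 2" for a b
  proof -
    have "b \<noteq> 0" "a \<noteq> 0" using that by auto
    then show ?thesis using that by (simp add: divide_simps)
  qed
  from this [of "real (i + l) + 1" "real (i + l) + 2"] show ?thesis
    unfolding hop_square by (simp add: add_ac)
qed

text \<open>Together with \<open>hop_outflow\<close> this is conservation of the flow at every node
  except the origin, where nothing enters and \<open>1\<close> leaves. That defect is the projection
  onto degree \<open>0\<close>.\<close>

lemma hop_inflow:
  assumes "i + l > 0"
  shows "hop i l * hop i l + hop l i * hop l i = 1 / (real (i + l) + 1)"
proof -
  have "real i / (a * (a + 1)) + real l / (a * (a + 1)) = 1 / (a + 1)" if "a = real (i + l)" for a
  proof -
    have "a > 0" using assms unfolding that by (simp only: of_nat_0_less_iff)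
    then show ?thesis using that by (simp add: divide_simps)
  qed
  from this [of "real (i + l)"] show ?thesis
    unfolding hop_square by (simp add: add_ac)
qed

text \<open>The two weighted shifts commute: both ways around a unit square have the same weight.
  This cancels the terms of the commutator that move diagonally across a square.\<close>

lemma hop_plaquette: "hop (Suc i) l * hop (Suc l) (Suc i) = hop (Suc l) i * hop (Suc i) (Suc l)"
  unfolding hop_def real_sqrt_mult [symmetric] by (simp add: add_ac mult_ac)

lemma hop_sum:
  fixes a :: "'n \<Rightarrow> real" and h :: "'m \<Rightarrow> real"
  assumes a: "\<And>S. finite S \<Longrightarrow> (\<Sum>\<nu>\<in>S. (a \<nu>)\<^sup>2) \<le> R\<^sup>2" and "finite S" and inj: "inj_on \<sigma> D"
    and h: "\<And>\<nu>. \<nu> \<in> D \<Longrightarrow> \<bar>h \<nu>\<bar> \<le> \<kappa> * a (\<sigma> \<nu>)" "\<And>\<nu>. \<nu> \<notin> D \<Longrightarrow> h \<nu> = 0" and "\<kappa> \<ge> 0" "R \<ge> 0"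
  shows "L2_set h S \<le> \<kappa> * R"
proof -
  have "(\<Sum>\<nu>\<in>S. (h \<nu>)\<^sup>2) = (\<Sum>\<nu>\<in>S \<inter> D. (h \<nu>)\<^sup>2)"
    using \<open>finite S\<close> h(2) by (intro sum.mono_neutral_right) auto
  also have "\<dots> \<le> (\<Sum>\<nu>\<in>S \<inter> D. (\<kappa> * a (\<sigma> \<nu>))\<^sup>2)"
    using h(1) by (intro sum_mono abs_le_square_iff [THEN iffD1]) force
  also have "\<dots> = \<kappa>\<^sup>2 * (\<Sum>\<mu>\<in>\<sigma> ` (S \<inter> D). (a \<mu>)\<^sup>2)"
    using inj by (subst sum.reindex) (auto simp: sum_distrib_left power_mult_distrib inj_on_def)
  also have "\<dots> \<le> \<kappa>\<^sup>2 * R\<^sup>2"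
    using a \<open>finite S\<close> by (intro mult_left_mono) auto
  finally show ?thesis
    unfolding L2_set_def using \<open>\<kappa> \<ge> 0\<close> \<open>R \<ge> 0\<close> by (intro real_le_lsqrt) (auto simp: power_mult_distrib sum_nonneg)
qed

text \<open>Made for a vector each of whose components is fed by two neighbours: \<open>f\<close>
  and \<open>g\<close> bound the two contributions, and since each shift of the lattice is
  injective, every \<open>a\<close> is counted at most once per direction.\<close>

lemma two_hop_sum:
  fixes a :: "'n \<Rightarrow> real" and h :: "'m \<Rightarrow> real"
  assumes a: "\<And>S. finite S \<Longrightarrow> (\<Sum>\<nu>\<in>S. (a \<nu>)\<^sup>2) \<le> R\<^sup>2" and "finite S"
    and "inj_on \<sigma> D" "\<And>\<nu>. \<nu> \<in> D \<Longrightarrow> \<bar>f \<nu>\<bar> \<le> \<kappa> * a (\<sigma> \<nu>)" "\<And>\<nu>. \<nu> \<notin> D \<Longrightarrow> f \<nu> = 0"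
    and "inj_on \<rho> E" "\<And>\<nu>. \<nu> \<in> E \<Longrightarrow> \<bar>g \<nu>\<bar> \<le> \<kappa> * a (\<rho> \<nu>)" "\<And>\<nu>. \<nu> \<notin> E \<Longrightarrow> g \<nu> = 0"
    and h: "\<And>\<nu>. 0 \<le> h \<nu>" "\<And>\<nu>. h \<nu> \<le> f \<nu> + g \<nu>" and "\<kappa> \<ge> 0" "R \<ge> 0"
  shows "(\<Sum>\<nu>\<in>S. (h \<nu>)\<^sup>2) \<le> (2 * \<kappa> * R)\<^sup>2"
proof -
  have "L2_set h S \<le> L2_set (\<lambda>\<nu>. f \<nu> + g \<nu>) S"
    using h by (intro L2_set_mono) auto
  also have "\<dots> \<le> L2_set f S + L2_set g S"
    by (rule L2_set_triangle_ineq)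
  also have "L2_set f S \<le> \<kappa> * R"
    by (rule hop_sum [OF a, where \<sigma> = \<sigma> and D = D]) (use assms in auto)
  also have "L2_set g S \<le> \<kappa> * R"
    by (rule hop_sum [OF a, where \<sigma> = \<rho> and D = E]) (use assms in auto)
  finally have "sqrt (\<Sum>\<nu>\<in>S. (h \<nu>)\<^sup>2) \<le> 2 * \<kappa> * R"
    by (simp add: L2_set_def mult_ac)
  then show ?thesis
    by (simp add: real_sqrt_le_iff sqrt_le_D)
qed

text \<open>
  Copies of one Hilbert space sit at the nodes \<open>(i, l)\<close> other than the origin, embedded by
  \<open>j i l\<close> with adjoint \<open>k i l\<close>; at the origin both maps are the projection onto the subspace
  in which the factorized operator lives.
\<close>

locale node_system =
  fixes j k :: "nat \<Rightarrow> nat \<Rightarrow> 'a::chilbert_space \<Rightarrow> 'a" and X W :: "'a \<Rightarrow> 'a" and c :: real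
  assumes j: "op_bound (j i l) 1" and k: "op_bound (k i l) 1"
    and j_orth: "(i, l) \<noteq> (i', l') \<Longrightarrow> \<langle>j i l x, j i' l' y\<rangle> = 0"
    and kj_neq: "(i, l) \<noteq> (i', l') \<Longrightarrow> k i l (j i' l' x) = 0"
    and kj_eq: "(i, l) \<noteq> (0, 0) \<Longrightarrow> k i l (j i l x) = x"
    and kj_X: "k 0 0 (j 0 0 (X x)) = X x"
    and k_bessel: "finite S \<Longrightarrow> (\<Sum>(i, l)\<in>S. (norm (k i l y))\<^sup>2) \<le> (norm y)\<^sup>2"
    and X_compact: "compact_operator X" and W_compact: "compact_operator W"
    and X_bound: "op_bound X c" and W_bound: "op_bound W c" and c_nonneg: "c \<ge> 0"
begin

section \<open>Vectors assembled from components at the nodes\<close>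

definition jn :: "nat \<times> nat \<Rightarrow> 'a \<Rightarrow> 'a" where "jn \<nu> = j (fst \<nu>) (snd \<nu>)"
definition kn :: "nat \<times> nat \<Rightarrow> 'a \<Rightarrow> 'a" where "kn \<nu> = k (fst \<nu>) (snd \<nu>)"

lemma jn: "op_bound (jn \<nu>) 1" and kn: "op_bound (kn \<nu>) 1"
  by (simp_all add: jn_def kn_def j k)

lemma jn_orth: "\<mu> \<noteq> \<nu> \<Longrightarrow> \<langle>jn \<mu> x, jn \<nu> y\<rangle> = 0"
  unfolding jn_def by (rule j_orth) (simp add: prod_eq_iff)

lemma kn_jn_neq: "\<mu> \<noteq> \<nu> \<Longrightarrow> kn \<mu> (jn \<nu> x) = 0"
  unfolding jn_def kn_def by (rule kj_neq) (simp add: prod_eq_iff)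

lemma kn_bessel: "finite S \<Longrightarrow> (\<Sum>\<nu>\<in>S. (norm (kn \<nu> y))\<^sup>2) \<le> (norm y)\<^sup>2"
  using k_bessel [of S y] by (simp add: kn_def case_prod_unfold)

lemma jn_norm: "norm (jn \<nu> x) \<le> norm x" and kn_norm: "norm (kn \<nu> x) \<le> norm x"
  using op_norm [OF jn] op_norm [OF kn] by simp_all

definition assemble :: "(nat \<times> nat \<Rightarrow> 'a) \<Rightarrow> 'a" where
  "assemble u = (\<Sum>n. jn (prod_decode n) (u (prod_decode n)))"

text \<open>Orthogonality of the embedded copies reduces convergence to square summability. The last
  claim retains \<open>kn \<nu> (jn \<nu> _)\<close>, because at the origin this composition is
  known to be the identity only on the range of \<open>X\<close>.\<close>

lemma assemble:
  assumes u: "\<And>S. finite S \<Longrightarrow> (\<Sum>\<nu>\<in>S. (norm (u \<nu>))\<^sup>2) \<le> R\<^sup>2" and "R \<ge> 0"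
  shows "summable (\<lambda>n. jn (prod_decode n) (u (prod_decode n)))"
    and "norm (assemble u) \<le> R"
    and "kn \<nu> (assemble u) = kn \<nu> (jn \<nu> (u \<nu>))"
proof -
  have part: "(\<Sum>n<N. (norm (jn (prod_decode n) (u (prod_decode n))))\<^sup>2) \<le> R\<^sup>2" for N
  proof -
    have "(\<Sum>n<N. (norm (jn (prod_decode n) (u (prod_decode n))))\<^sup>2) \<le>
        (\<Sum>n<N. (norm (u (prod_decode n)))\<^sup>2)"
      by (intro sum_mono power_mono jn_norm) simp
    also have "\<dots> = (\<Sum>\<nu>\<in>prod_decode ` {..<N}. (norm (u \<nu>))\<^sup>2)"
      by (subst sum.reindex) (auto simp: inj_prod_decode)
    also have "\<dots> \<le> R\<^sup>2"
      by (rule u) simp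
    finally show ?thesis .
  qed
  have sq: "summable (\<lambda>n. (norm (jn (prod_decode n) (u (prod_decode n))))\<^sup>2)"
    and le: "(\<Sum>n. (norm (jn (prod_decode n) (u (prod_decode n))))\<^sup>2) \<le> R\<^sup>2"
    using summable_of_bounded_partial_sums [OF _ part] by simp_all
  have orth: "\<langle>jn (prod_decode m) (u (prod_decode m)), jn (prod_decode n) (u (prod_decode n))\<rangle> = 0"
    if "m \<noteq> n" for m n
    using that by (intro jn_orth) (metis prod_decode_inverse)
  show s: "summable (\<lambda>n. jn (prod_decode n) (u (prod_decode n)))"
    using orth sq by (rule orthogonal_summable)
  have "(norm (assemble u))\<^sup>2 \<le> R\<^sup>2"
    unfolding assemble_def using orthogonal_norm_suminf [OF orth sq] le by simp
  then show "norm (assemble u) \<le> R"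
    using \<open>R \<ge> 0\<close> by (rule power2_le_imp_le)
  have "kn \<nu> (assemble u) = (\<Sum>n. kn \<nu> (jn (prod_decode n) (u (prod_decode n))))"
    unfolding assemble_def by (rule op_suminf [OF kn s])
  also have "\<dots> = (\<Sum>n\<in>{prod_encode \<nu>}. kn \<nu> (jn (prod_decode n) (u (prod_decode n))))"
    by (rule suminf_finite) (auto, metis kn_jn_neq prod_decode_inverse)
  finally show "kn \<nu> (assemble u) = kn \<nu> (jn \<nu> (u \<nu>))"
    by simp
qed

lemma assemble_op_bound:
  assumes u: "\<And>S y. finite S \<Longrightarrow> (\<Sum>\<nu>\<in>S. (norm (u \<nu> y))\<^sup>2) \<le> (K * norm y)\<^sup>2" and "K \<ge> 0"
    and lin: "\<And>\<nu>. op_bound (u \<nu>) (L \<nu>)"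
  shows "op_bound (\<lambda>y. assemble (\<lambda>\<nu>. u \<nu> y)) K"
proof (rule op_boundI)
  have "K * norm y \<ge> 0" for y :: 'a
    using \<open>K \<ge> 0\<close> by simp
  note s = assemble(1) [OF u this]
  show "assemble (\<lambda>\<nu>. u \<nu> (x + y)) = assemble (\<lambda>\<nu>. u \<nu> x) + assemble (\<lambda>\<nu>. u \<nu> y)" for x y
    unfolding assemble_def op_add [OF lin] op_add [OF jn] by (rule suminf_add [OF s s, symmetric])
  show "assemble (\<lambda>\<nu>. u \<nu> (a *\<^sub>C x)) = a *\<^sub>C assemble (\<lambda>\<nu>. u \<nu> x)" for a x
    unfolding assemble_def op_scaleC [OF lin] op_scaleC [OF jn] by (rule scaleC_suminf [OF s, symmetric])
  show "norm (assemble (\<lambda>\<nu>. u \<nu> y)) \<le> K * norm y" for y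
    by (rule assemble(2) [OF u]) (use \<open>K \<ge> 0\<close> in simp_all)
qed

lemma assemble_compact:
  assumes u: "\<And>S y. finite S \<Longrightarrow> (\<Sum>\<nu>\<in>S. (norm (u \<nu> y))\<^sup>2) \<le> (K * norm y)\<^sup>2" and "K \<ge> 0"
    and lin: "\<And>\<nu>. op_bound (u \<nu>) (L \<nu>)" and compact: "\<And>\<nu>. compact_operator (u \<nu>)"
    and tail: "\<And>\<epsilon>. \<epsilon> > 0 \<Longrightarrow> \<exists>D. finite D \<and> (\<forall>S y. finite S \<longrightarrow> S \<inter> D = {} \<longrightarrow>
       (\<Sum>\<nu>\<in>S. (norm (u \<nu> y))\<^sup>2) \<le> (\<epsilon> * norm y)\<^sup>2)"
  shows "compact_operator (\<lambda>y. assemble (\<lambda>\<nu>. u \<nu> y))"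
proof (rule compact_operator_limit [OF assemble_op_bound [OF u \<open>K \<ge> 0\<close> lin]])
  fix \<epsilon> :: real
  assume "\<epsilon> > 0"
  obtain D where D: "finite D" "\<And>S y. finite S \<Longrightarrow> S \<inter> D = {} \<Longrightarrow>
       (\<Sum>\<nu>\<in>S. (norm (u \<nu> y))\<^sup>2) \<le> (\<epsilon> * norm y)\<^sup>2"
    using tail [OF \<open>\<epsilon> > 0\<close>] by blast
  define C where "C y = (\<Sum>\<nu>\<in>D. jn \<nu> (u \<nu> y))" for y
  have C: "compact_operator C"
    unfolding C_def by (intro compact_operator_sum compact_operator_comp_left [OF jn] compact)
  have "norm (assemble (\<lambda>\<nu>. u \<nu> y) - C y) \<le> \<epsilon> * norm y" for y
  proof -
    define v where "v \<nu> = (if \<nu> \<in> D then 0 else u \<nu> y)" for \<nu>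
    define w where "w \<nu> = (if \<nu> \<in> D then u \<nu> y else 0)" for \<nu>
    have Ky: "K * norm y \<ge> 0"
      using \<open>K \<ge> 0\<close> by simp
    have "(\<Sum>\<nu>\<in>S. (norm (v \<nu>))\<^sup>2) \<le> (\<epsilon> * norm y)\<^sup>2" if "finite S" for S
    proof -
      have "(\<Sum>\<nu>\<in>S. (norm (v \<nu>))\<^sup>2) = (\<Sum>\<nu>\<in>S - D. (norm (u \<nu> y))\<^sup>2)"
        using that by (intro sum.mono_neutral_cong_right) (auto simp: v_def)
      also have "\<dots> \<le> (\<epsilon> * norm y)\<^sup>2"
        using that by (intro D(2)) auto
      finally show ?thesis .
    qed
    then have v: "norm (assemble v) \<le> \<epsilon> * norm y"
      using \<open>\<epsilon> > 0\<close> by (intro assemble(2)) auto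
    have sw: "summable (\<lambda>n. jn (prod_decode n) (w (prod_decode n)))"
      and w: "assemble w = C y"
    proof -
      have 0: "jn (prod_decode n) (w (prod_decode n)) = 0" if "n \<notin> prod_encode ` D" for n
        using that by (auto simp: w_def op_zero [OF jn]) (metis image_eqI prod_decode_inverse)
      show "summable (\<lambda>n. jn (prod_decode n) (w (prod_decode n)))"
        by (rule summable_finite [of "prod_encode ` D"]) (use D(1) 0 in auto)
      have "assemble w = (\<Sum>n\<in>prod_encode ` D. jn (prod_decode n) (w (prod_decode n)))"
        unfolding assemble_def by (rule suminf_finite) (use D(1) 0 in auto)
      also have "\<dots> = C y"
        unfolding C_def by (subst sum.reindex) (auto simp: inj_prod_encode w_def)
      finally show "assemble w = C y" .
    qed
    have "jn \<nu> (v \<nu>) = jn \<nu> (u \<nu> y) - jn \<nu> (w \<nu>)" for \<nu>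
      by (auto simp: v_def w_def op_zero [OF jn])
    then have "assemble v = assemble (\<lambda>\<nu>. u \<nu> y) - assemble w"
      unfolding assemble_def using suminf_diff [OF assemble(1) [OF u Ky] sw] by simp
    then show ?thesis
      using v w by simp
  qed
  with C show "\<exists>C. compact_operator C \<and> (\<forall>y. norm (assemble (\<lambda>\<nu>. u \<nu> y) - C y) \<le> \<epsilon> * norm y)"
    by blast
qed

text \<open>At a node of degree \<open>n\<close> the outgoing edges contribute \<open>Xs n\<close>
  after \<open>Ys n\<close>, the incoming ones \<open>Ys (n - 1)\<close> after
  \<open>Xs (n - 1)\<close>. Exchanging the factors with the parity makes the two products equal
  (\<open>XY_shift\<close>), so that the flow balance applies; degree \<open>0\<close> gets
  \<open>X\<close> after \<open>W\<close>.\<close>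

definition Xs :: "nat \<Rightarrow> 'a \<Rightarrow> 'a" where "Xs n = (if even n then X else W)"
definition Ys :: "nat \<Rightarrow> 'a \<Rightarrow> 'a" where "Ys n = (if even n then W else X)"

text \<open>The component at \<nu> of the image of \<open>y\<close> under \<open>A\<close>. For
  \<open>l = 0\<close> the truncated \<open>l - 1\<close> is harmless, since then
  \<open>hop l i = 0\<close>.\<close>

definition lower_coeff :: "nat \<times> nat \<Rightarrow> 'a \<Rightarrow> 'a" where
  "lower_coeff \<nu> y = (case \<nu> of (i, l) \<Rightarrow>
     complex_of_real (hop (Suc i) l) *\<^sub>C Xs (i + l) (k (Suc i) l y) -
     complex_of_real (hop l i) *\<^sub>C Ys (i + l - 1) (k i (l - 1) y))"

definition raise_coeff :: "nat \<times> nat \<Rightarrow> 'a \<Rightarrow> 'a" where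
  "raise_coeff \<nu> y = (case \<nu> of (i, l) \<Rightarrow>
     complex_of_real (hop i l) *\<^sub>C Ys (i + l - 1) (k (i - 1) l y) +
     complex_of_real (hop (Suc l) i) *\<^sub>C Xs (i + l) (k i (Suc l) y))"

definition A :: "'a \<Rightarrow> 'a" where "A y = assemble (\<lambda>\<nu>. lower_coeff \<nu> y)"
definition B :: "'a \<Rightarrow> 'a" where "B y = assemble (\<lambda>\<nu>. raise_coeff \<nu> y)"

lemma Xs: "op_bound (Xs n) c" and Ys: "op_bound (Ys n) c"
  by (simp_all add: Xs_def Ys_def X_bound W_bound)

lemma Xs_compact: "compact_operator (Xs n)" and Ys_compact: "compact_operator (Ys n)"
  by (simp_all add: Xs_def Ys_def X_compact W_compact)

lemma XY_shift: "n > 0 \<Longrightarrow> Xs n (Ys n y) = Ys (n - 1) (Xs (n - 1) y)"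
  by (auto simp: Xs_def Ys_def)

lemma hop_term:
  assumes "op_bound F c"
  shows "op_bound (\<lambda>y. complex_of_real (hop a b) *\<^sub>C F (k i l y)) (hop a b * c)"
  using op_bound_real_scale [OF op_bound_comp [OF assms k c_nonneg], of "hop a b" i l] by simp

lemma hop_term_le:
  assumes "op_bound F c"
  shows "norm (complex_of_real (hop a b) *\<^sub>C F (k i l y)) \<le> hop a b * (c * norm (k i l y))"
  using mult_left_mono [OF op_norm [OF assms, of "k i l y"], of "hop a b"] by simp

lemma hop_term_compact:
  fixes F :: "'a \<Rightarrow> 'a"
  assumes "compact_operator F"
  shows "compact_operator (\<lambda>y. complex_of_real (hop a b) *\<^sub>C F (k i l y))"
  by (intro compact_operator_scaleC compact_operator_comp_right [OF assms k])

lemma lower_coeff_op_bound: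
  "op_bound (lower_coeff \<nu>) (hop (Suc (fst \<nu>)) (snd \<nu>) * c + hop (snd \<nu>) (fst \<nu>) * c)"
  unfolding lower_coeff_def case_prod_unfold by (intro op_bound_minus hop_term Xs Ys)

lemma raise_coeff_op_bound:
  "op_bound (raise_coeff \<nu>) (hop (fst \<nu>) (snd \<nu>) * c + hop (Suc (snd \<nu>)) (fst \<nu>) * c)"
  unfolding raise_coeff_def case_prod_unfold by (intro op_bound_plus hop_term Xs Ys)

lemma lower_coeff_compact: "compact_operator (lower_coeff \<nu>)"
  unfolding lower_coeff_def [abs_def] case_prod_unfold
  by (intro compact_operator_minus hop_term_compact Xs_compact Ys_compact)

lemma raise_coeff_compact: "compact_operator (raise_coeff \<nu>)"
  unfolding raise_coeff_def [abs_def] case_prod_unfold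
  by (intro compact_operator_plus hop_term_compact Xs_compact Ys_compact)

text \<open>
  The weights \<open>\<delta>\<close> make it possible to estimate powers of the lowering operator, which drives
  every vector towards nodes with small first and large second coordinate.
\<close>

lemma lower_coeff_sum:
  assumes S: "finite S" and \<delta>: "\<And>i l. \<delta> i l \<ge> 0" and "\<theta> \<ge> 0" "R \<ge> 0"
    and w1: "\<And>i l. (i, l) \<in> S \<Longrightarrow> hop (Suc i) l * \<delta> i l \<le> \<theta> * \<delta> (Suc i) l"
    and w2: "\<And>i l. (i, Suc l) \<in> S \<Longrightarrow> hop (Suc l) i * \<delta> i (Suc l) \<le> \<theta> * \<delta> i l"
    and y: "\<And>S. finite S \<Longrightarrow> (\<Sum>\<nu>\<in>S. (\<delta> (fst \<nu>) (snd \<nu>) * norm (kn \<nu> y))\<^sup>2) \<le> R\<^sup>2"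
  shows "(\<Sum>\<nu>\<in>S. (\<delta> (fst \<nu>) (snd \<nu>) * norm (lower_coeff \<nu> y))\<^sup>2) \<le> (2 * (c * \<theta>) * R)\<^sup>2"
proof -
  define a where "a \<nu> = \<delta> (fst \<nu>) (snd \<nu>) * norm (kn \<nu> y)" for \<nu>
  define up where "up \<nu> = (Suc (fst \<nu>), snd \<nu>)" for \<nu> :: "nat \<times> nat"
  define dn where "dn \<nu> = (fst \<nu>, snd \<nu> - 1)" for \<nu> :: "nat \<times> nat"
  define f where "f \<nu> = (if \<nu> \<in> S then \<delta> (fst \<nu>) (snd \<nu>) * (hop (Suc (fst \<nu>)) (snd \<nu>) * (c * norm (kn (up \<nu>) y))) else 0)" for \<nu>
  define g where "g \<nu> = (if \<nu> \<in> S then \<delta> (fst \<nu>) (snd \<nu>) * (hop (snd \<nu>) (fst \<nu>) * (c * norm (kn (dn \<nu>) y))) else 0)" for \<nu>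
  define h where "h \<nu> = (if \<nu> \<in> S then \<delta> (fst \<nu>) (snd \<nu>) * norm (lower_coeff \<nu> y) else 0)" for \<nu>
  have "(\<Sum>\<nu>\<in>S. (h \<nu>)\<^sup>2) \<le> (2 * (c * \<theta>) * R)\<^sup>2"
  proof (rule two_hop_sum [where a = a and f = f and g = g and \<sigma> = up and \<rho> = dn
        and D = S and E = "{\<nu> \<in> S. snd \<nu> > 0}"])
    show "inj_on up S" "inj_on dn {\<nu> \<in> S. snd \<nu> > 0}"
      by (auto simp: inj_on_def up_def dn_def prod_eq_iff)
    show "\<bar>f \<nu>\<bar> \<le> c * \<theta> * a (up \<nu>)" if "\<nu> \<in> S" for \<nu>
    proof -
      have "hop (Suc (fst \<nu>)) (snd \<nu>) * \<delta> (fst \<nu>) (snd \<nu>) \<le> \<theta> * \<delta> (Suc (fst \<nu>)) (snd \<nu>)"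
        using w1 that by simp
      from mult_right_mono [OF this, of "c * norm (kn (up \<nu>) y)"]
      show ?thesis
        using \<delta> c_nonneg that by (simp add: f_def a_def up_def abs_mult mult_ac)
    qed
    show "\<bar>g \<nu>\<bar> \<le> c * \<theta> * a (dn \<nu>)" if "\<nu> \<in> {\<nu> \<in> S. snd \<nu> > 0}" for \<nu>
    proof -
      have "hop (snd \<nu>) (fst \<nu>) * \<delta> (fst \<nu>) (snd \<nu>) \<le> \<theta> * \<delta> (fst \<nu>) (snd \<nu> - 1)"
        using w2 [of "fst \<nu>" "snd \<nu> - 1"] that by simp
      from mult_right_mono [OF this, of "c * norm (kn (dn \<nu>) y)"]
      show ?thesis
        using \<delta> c_nonneg that by (simp add: g_def a_def dn_def abs_mult mult_ac)
    qed
    show "h \<nu> \<le> f \<nu> + g \<nu>" for \<nu>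
    proof (cases "\<nu> \<in> S")
      case True
      have "norm (lower_coeff \<nu> y) \<le> hop (Suc (fst \<nu>)) (snd \<nu>) * (c * norm (kn (up \<nu>) y)) +
          hop (snd \<nu>) (fst \<nu>) * (c * norm (kn (dn \<nu>) y))"
        unfolding lower_coeff_def case_prod_unfold kn_def up_def dn_def fst_conv snd_conv
        by (rule order_trans [OF norm_triangle_ineq4 add_mono [OF hop_term_le [OF Xs] hop_term_le [OF Ys]]])
      from mult_left_mono [OF this \<delta>]
      show ?thesis
        using True by (simp add: h_def f_def g_def distrib_left)
    qed (simp add: h_def f_def g_def)
  qed (use S \<delta> y c_nonneg \<open>\<theta> \<ge> 0\<close> \<open>R \<ge> 0\<close> in \<open>auto simp: a_def h_def f_def g_def\<close>)
  then show ?thesis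
    by (simp add: h_def)
qed

lemma raise_coeff_sum:
  assumes S: "finite S" and "\<theta> \<ge> 0"
    and w1: "\<And>i l. (i, l) \<in> S \<Longrightarrow> hop i l \<le> \<theta>"
    and w2: "\<And>i l. (i, l) \<in> S \<Longrightarrow> hop (Suc l) i \<le> \<theta>"
  shows "(\<Sum>\<nu>\<in>S. (norm (raise_coeff \<nu> y))\<^sup>2) \<le> (2 * (c * \<theta>) * norm y)\<^sup>2"
proof -
  define a where "a \<nu> = norm (kn \<nu> y)" for \<nu>
  define up where "up \<nu> = (fst \<nu>, Suc (snd \<nu>))" for \<nu> :: "nat \<times> nat"
  define dn where "dn \<nu> = (fst \<nu> - 1, snd \<nu>)" for \<nu> :: "nat \<times> nat"
  define f where "f \<nu> = (if \<nu> \<in> S then hop (Suc (snd \<nu>)) (fst \<nu>) * (c * norm (kn (up \<nu>) y)) else 0)" for \<nu>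
  define g where "g \<nu> = (if \<nu> \<in> S then hop (fst \<nu>) (snd \<nu>) * (c * norm (kn (dn \<nu>) y)) else 0)" for \<nu>
  define h where "h \<nu> = (if \<nu> \<in> S then norm (raise_coeff \<nu> y) else 0)" for \<nu>
  have "(\<Sum>\<nu>\<in>S. (h \<nu>)\<^sup>2) \<le> (2 * (c * \<theta>) * norm y)\<^sup>2"
  proof (rule two_hop_sum [where a = a and f = f and g = g and \<sigma> = up and \<rho> = dn
        and D = S and E = "{\<nu> \<in> S. fst \<nu> > 0}"])
    show "inj_on up S" "inj_on dn {\<nu> \<in> S. fst \<nu> > 0}"
      by (auto simp: inj_on_def up_def dn_def prod_eq_iff)
    show "\<bar>f \<nu>\<bar> \<le> c * \<theta> * a (up \<nu>)" if "\<nu> \<in> S" for \<nu>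
      using mult_right_mono [OF w2 [of "fst \<nu>" "snd \<nu>"], of "c * norm (kn (up \<nu>) y)"] c_nonneg that
      by (simp add: f_def a_def abs_mult mult_ac)
    show "\<bar>g \<nu>\<bar> \<le> c * \<theta> * a (dn \<nu>)" if "\<nu> \<in> {\<nu> \<in> S. fst \<nu> > 0}" for \<nu>
      using mult_right_mono [OF w1 [of "fst \<nu>" "snd \<nu>"], of "c * norm (kn (dn \<nu>) y)"] c_nonneg that
      by (simp add: g_def a_def abs_mult mult_ac)
    show "h \<nu> \<le> f \<nu> + g \<nu>" for \<nu>
    proof (cases "\<nu> \<in> S")
      case True
      have "norm (raise_coeff \<nu> y) \<le> hop (fst \<nu>) (snd \<nu>) * (c * norm (kn (dn \<nu>) y)) +
          hop (Suc (snd \<nu>)) (fst \<nu>) * (c * norm (kn (up \<nu>) y))"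
        unfolding raise_coeff_def case_prod_unfold kn_def up_def dn_def fst_conv snd_conv
        by (rule order_trans [OF norm_triangle_ineq add_mono [OF hop_term_le [OF Ys] hop_term_le [OF Xs]]])
      then show ?thesis
        using True by (simp add: h_def f_def g_def)
    qed (simp add: h_def f_def g_def)
    show "(\<Sum>\<nu>\<in>S. (a \<nu>)\<^sup>2) \<le> (norm y)\<^sup>2" if "finite S" for S
      unfolding a_def using that by (rule kn_bessel)
  qed (use S c_nonneg \<open>\<theta> \<ge> 0\<close> in \<open>auto simp: a_def h_def f_def g_def\<close>)
  then show ?thesis
    by (simp add: h_def)
qed

lemma lower_coeff_sum_const:
  assumes "finite S" and "\<theta> \<ge> 0"
    and "\<And>i l. (i, l) \<in> S \<Longrightarrow> hop (Suc i) l \<le> \<theta>" "\<And>i l. (i, l) \<in> S \<Longrightarrow> hop l i \<le> \<theta>"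
  shows "(\<Sum>\<nu>\<in>S. (norm (lower_coeff \<nu> y))\<^sup>2) \<le> (2 * (c * \<theta>) * norm y)\<^sup>2"
  using lower_coeff_sum [of S "\<lambda>i l. 1" \<theta> "norm y" y] assms kn_bessel by simp

lemma lower_coeff_sum_1: "finite S \<Longrightarrow> (\<Sum>\<nu>\<in>S. (norm (lower_coeff \<nu> y))\<^sup>2) \<le> (2 * c * norm y)\<^sup>2"
  using lower_coeff_sum_const [of S 1 y] by (simp add: hop_le_1)

lemma raise_coeff_sum_1: "finite S \<Longrightarrow> (\<Sum>\<nu>\<in>S. (norm (raise_coeff \<nu> y))\<^sup>2) \<le> (2 * c * norm y)\<^sup>2"
  using raise_coeff_sum [of S 1 y] by (simp add: hop_le_1)

section \<open>Norms and compactness of the two lattice operators\<close>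

lemma A_bound: "op_bound A (2 * c)"
  unfolding A_def [abs_def]
  by (rule assemble_op_bound [OF lower_coeff_sum_1 _ lower_coeff_op_bound]) (simp_all add: c_nonneg)

lemma B_bound: "op_bound B (2 * c)"
  unfolding B_def [abs_def]
  by (rule assemble_op_bound [OF raise_coeff_sum_1 _ raise_coeff_op_bound]) (simp_all add: c_nonneg)

lemma hop_small:
  assumes "\<epsilon> > 0"
  obtains D where "finite D" "\<And>i l. (i, l) \<notin> D \<Longrightarrow> hop i l \<le> \<epsilon>" "\<And>i l. (i, l) \<notin> D \<Longrightarrow> hop l i \<le> \<epsilon>"
    "\<And>i l. (i, l) \<notin> D \<Longrightarrow> hop (Suc i) l \<le> \<epsilon>" "\<And>i l. (i, l) \<notin> D \<Longrightarrow> hop (Suc l) i \<le> \<epsilon>"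
proof -
  obtain M :: nat where M: "1 / \<epsilon>\<^sup>2 < real M"
    using reals_Archimedean2 by blast
  have le: "hop i l \<le> \<epsilon>" if "i + l \<ge> M" for i l
  proof -
    have "1 / \<epsilon>\<^sup>2 \<le> real (i + l + 1)"
      using M that by linarith
    then have "sqrt (1 / \<epsilon>\<^sup>2) \<le> sqrt (real (i + l + 1))"
      by (rule real_sqrt_le_mono)
    then have "1 / \<epsilon> \<le> sqrt (real (i + l + 1))"
      using \<open>\<epsilon> > 0\<close> by (simp add: real_sqrt_divide)
    then have "1 / sqrt (real (i + l + 1)) \<le> \<epsilon>"
      using \<open>\<epsilon> > 0\<close> by (simp add: field_simps)
    then show ?thesis
      using hop_le [of i l] by linarith
  qed
  show ?thesis
  proof (rule that [of "{..M} \<times> {..M}"])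
    fix i l :: nat
    assume "(i, l) \<notin> {..M} \<times> {..M}"
    then have "i + l \<ge> M" by auto
    then show "hop i l \<le> \<epsilon>" "hop l i \<le> \<epsilon>" "hop (Suc i) l \<le> \<epsilon>" "hop (Suc l) i \<le> \<epsilon>"
      by (auto intro: le)
  qed simp
qed

lemma A_compact: "compact_operator A"
  unfolding A_def [abs_def]
proof (rule assemble_compact [OF lower_coeff_sum_1 _ lower_coeff_op_bound lower_coeff_compact])
  fix \<epsilon> :: real
  assume "\<epsilon> > 0"
  define \<theta> where "\<theta> = \<epsilon> / (2 * (c + 1))"
  have \<theta>: "\<theta> > 0" "2 * (c * \<theta>) \<le> \<epsilon>"
    using \<open>\<epsilon> > 0\<close> c_nonneg by (simp_all add: \<theta>_def field_simps)
  obtain D where "finite D" and D: "\<And>i l. (i, l) \<notin> D \<Longrightarrow> hop (Suc i) l \<le> \<theta>"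
    "\<And>i l. (i, l) \<notin> D \<Longrightarrow> hop l i \<le> \<theta>"
    using hop_small [OF \<open>\<theta> > 0\<close>] by metis
  have "(\<Sum>\<nu>\<in>S. (norm (lower_coeff \<nu> y))\<^sup>2) \<le> (\<epsilon> * norm y)\<^sup>2" if "finite S" "S \<inter> D = {}" for S y
  proof -
    have "(\<Sum>\<nu>\<in>S. (norm (lower_coeff \<nu> y))\<^sup>2) \<le> (2 * (c * \<theta>) * norm y)\<^sup>2"
    proof (rule lower_coeff_sum_const)
      show "finite S" "\<theta> \<ge> 0"
        using that(1) \<theta>(1) by auto
    qed (use that(2) D in blast)+
    also have "\<dots> \<le> (\<epsilon> * norm y)\<^sup>2"
      using \<theta> c_nonneg by (intro power_mono mult_right_mono) auto
    finally show ?thesis .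
  qed
  with \<open>finite D\<close> show "\<exists>D. finite D \<and> (\<forall>S y. finite S \<longrightarrow> S \<inter> D = {} \<longrightarrow>
       (\<Sum>\<nu>\<in>S. (norm (lower_coeff \<nu> y))\<^sup>2) \<le> (\<epsilon> * norm y)\<^sup>2)"
    by blast
qed (simp_all add: c_nonneg)

lemma B_compact: "compact_operator B"
  unfolding B_def [abs_def]
proof (rule assemble_compact [OF raise_coeff_sum_1 _ raise_coeff_op_bound raise_coeff_compact])
  fix \<epsilon> :: real
  assume "\<epsilon> > 0"
  define \<theta> where "\<theta> = \<epsilon> / (2 * (c + 1))"
  have \<theta>: "\<theta> > 0" "2 * (c * \<theta>) \<le> \<epsilon>"
    using \<open>\<epsilon> > 0\<close> c_nonneg by (simp_all add: \<theta>_def field_simps)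
  obtain D where "finite D" and D: "\<And>i l. (i, l) \<notin> D \<Longrightarrow> hop (Suc l) i \<le> \<theta>"
    "\<And>i l. (i, l) \<notin> D \<Longrightarrow> hop i l \<le> \<theta>"
    using hop_small [OF \<open>\<theta> > 0\<close>] by metis
  have "(\<Sum>\<nu>\<in>S. (norm (raise_coeff \<nu> y))\<^sup>2) \<le> (\<epsilon> * norm y)\<^sup>2" if "finite S" "S \<inter> D = {}" for S y
  proof -
    have "(\<Sum>\<nu>\<in>S. (norm (raise_coeff \<nu> y))\<^sup>2) \<le> (2 * (c * \<theta>) * norm y)\<^sup>2"
    proof (rule raise_coeff_sum)
      show "finite S" "\<theta> \<ge> 0"
        using that(1) \<theta>(1) by auto
    qed (use that(2) D in blast)+
    also have "\<dots> \<le> (\<epsilon> * norm y)\<^sup>2"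
      using \<theta> c_nonneg by (intro power_mono mult_right_mono) auto
    finally show ?thesis .
  qed
  with \<open>finite D\<close> show "\<exists>D. finite D \<and> (\<forall>S y. finite S \<longrightarrow> S \<inter> D = {} \<longrightarrow>
       (\<Sum>\<nu>\<in>S. (norm (raise_coeff \<nu> y))\<^sup>2) \<le> (\<epsilon> * norm y)\<^sup>2)"
    by blast
qed (simp_all add: c_nonneg)

lemma kn_A: "norm (kn \<nu> (A y)) \<le> norm (lower_coeff \<nu> y)"
  unfolding A_def
  by (subst assemble(3) [OF lower_coeff_sum_1]) (auto simp: c_nonneg intro: order_trans [OF kn_norm jn_norm])

text \<open>At the origin the second term vanishes with \<open>hop 0 0\<close>, and what is left is
  a multiple of a value of \<open>X\<close>, to which \<open>kj_X\<close> applies.\<close>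

lemma k_A: "k i l (A y) = lower_coeff (i, l) y"
proof -
  have "k i l (A y) = kn (i, l) (assemble (\<lambda>\<nu>. lower_coeff \<nu> y))"
    by (simp add: kn_def A_def)
  also have "\<dots> = k i l (j i l (lower_coeff (i, l) y))"
    by (subst assemble(3) [OF lower_coeff_sum_1]) (auto simp: c_nonneg kn_def jn_def)
  also have "\<dots> = lower_coeff (i, l) y"
  proof (cases "(i, l) = (0, 0)")
    case True
    then have "lower_coeff (i, l) y = complex_of_real (hop 1 0) *\<^sub>C X (k 1 0 y)"
      by (simp add: lower_coeff_def Xs_def)
    with True show ?thesis
      by (simp add: op_scaleC [OF j] op_scaleC [OF k] kj_X)
  qed (rule kj_eq)
  finally show ?thesis .
qed

lemma k_B: "k i l (B y) = raise_coeff (i, l) y"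
proof -
  have "k i l (B y) = kn (i, l) (assemble (\<lambda>\<nu>. raise_coeff \<nu> y))"
    by (simp add: kn_def B_def)
  also have "\<dots> = k i l (j i l (raise_coeff (i, l) y))"
    by (subst assemble(3) [OF raise_coeff_sum_1]) (auto simp: c_nonneg kn_def jn_def)
  also have "\<dots> = raise_coeff (i, l) y"
  proof (cases "(i, l) = (0, 0)")
    case True
    then have "raise_coeff (i, l) y = complex_of_real (hop 1 0) *\<^sub>C X (k 0 1 y)"
      by (simp add: raise_coeff_def Xs_def)
    with True show ?thesis
      by (simp add: op_scaleC [OF j] op_scaleC [OF k] kj_X)
  qed (rule kj_eq)
  finally show ?thesis .
qed

text \<open>Four kinds of two-step moves end at a node: out and back (\<open>v1\<close>), in and
  back (\<open>v4\<close>), and across the two adjacent squares (\<open>v2\<close>,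
  \<open>v3\<close>). The last two cancel by \<open>hop_plaquette\<close>. The first two carry the
  outflow and the inflow as weights, and \<open>v1 = v4\<close> away from the origin.\<close>

lemma coeff_commutator:
  "lower_coeff (i, l) (B y) - raise_coeff (i, l) (A y) = (if (i, l) = (0, 0) then X (W (k 0 0 y)) else 0)"
proof -
  define n where "n = i + l"
  define P where "P = complex_of_real (hop (Suc i) l)"
  define Q where "Q = complex_of_real (hop (Suc l) i)"
  define p where "p = complex_of_real (hop i l)"
  define q where "q = complex_of_real (hop l i)"
  define v1 where "v1 = Xs n (Ys n (k i l y))"
  define v2 where "v2 = Xs n (Xs (Suc n) (k (Suc i) (Suc l) y))"
  define v3 where "v3 = Ys (n - 1) (Ys (n - 1 - 1) (k (i - 1) (l - 1) y))"
  define v4 where "v4 = Ys (n - 1) (Xs (n - 1) (k i l y))"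
  have 1: "P *\<^sub>C Xs n (raise_coeff (Suc i, l) (y)) =
      (P * P) *\<^sub>C v1 + (P * complex_of_real (hop (Suc l) (Suc i))) *\<^sub>C v2"
    by (simp add: raise_coeff_def op_add [OF Xs] op_scaleC [OF Xs] scaleC_add_right scaleC_scaleC
        v1_def v2_def n_def P_def)
  have 2: "q *\<^sub>C Ys (n - 1) (raise_coeff (i, l - 1) y) =
      (q * complex_of_real (hop i (l - 1))) *\<^sub>C v3 + (q * q) *\<^sub>C v4"
    by (cases l) (simp_all add: raise_coeff_def op_add [OF Ys] op_scaleC [OF Ys] scaleC_add_right scaleC_scaleC
        v3_def v4_def n_def q_def)
  have 3: "p *\<^sub>C Ys (n - 1) (lower_coeff (i - 1, l) y) =
      (p * p) *\<^sub>C v4 - (p * complex_of_real (hop l (i - 1))) *\<^sub>C v3"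
    by (cases i) (simp_all add: lower_coeff_def op_diff [OF Ys] op_scaleC [OF Ys] scaleC_diff_right scaleC_scaleC
        v3_def v4_def n_def p_def)
  have 4: "Q *\<^sub>C Xs n (lower_coeff (i, Suc l) y) =
      (Q * complex_of_real (hop (Suc i) (Suc l))) *\<^sub>C v2 - (Q * Q) *\<^sub>C v1"
    by (simp add: lower_coeff_def op_diff [OF Xs] op_scaleC [OF Xs] scaleC_diff_right scaleC_scaleC
        v1_def v2_def n_def Q_def)
  have 5: "P * complex_of_real (hop (Suc l) (Suc i)) = Q * complex_of_real (hop (Suc i) (Suc l))"
    unfolding P_def Q_def of_real_mult [symmetric] by (simp only: hop_plaquette)
  have 6: "q * complex_of_real (hop i (l - 1)) = p * complex_of_real (hop l (i - 1))"
  proof (cases "i = 0 \<or> l = 0")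
    case False
    then obtain i' l' where "i = Suc i'" "l = Suc l'"
      by (metis not0_implies_Suc)
    then show ?thesis
      unfolding p_def q_def of_real_mult [symmetric]
      using hop_plaquette [of i' l'] by (simp add: mult.commute)
  qed (auto simp: p_def q_def)
  have "lower_coeff (i, l) (B y) - raise_coeff (i, l) (A y) =
      P *\<^sub>C Xs n (raise_coeff (Suc i, l) y) - q *\<^sub>C Ys (n - 1) (raise_coeff (i, l - 1) y) -
      (p *\<^sub>C Ys (n - 1) (lower_coeff (i - 1, l) y) + Q *\<^sub>C Xs n (lower_coeff (i, Suc l) y))"
    by (simp add: lower_coeff_def [of _ "B y"] raise_coeff_def [of _ "A y"] k_A k_B n_def P_def Q_def p_def q_def)
  also have "\<dots> = (P * P + Q * Q) *\<^sub>C v1 - (p * p + q * q) *\<^sub>C v4"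
    unfolding 1 2 3 4 5 6 by (simp add: scaleC_add_left)
  also have "P * P + Q * Q = complex_of_real (1 / (real n + 1))"
    unfolding P_def Q_def n_def of_real_mult [symmetric] of_real_add [symmetric] by (simp only: hop_outflow)
  also have "complex_of_real (1 / (real n + 1)) *\<^sub>C v1 - (p * p + q * q) *\<^sub>C v4 =
      (if (i, l) = (0, 0) then X (W (k 0 0 y)) else 0)"
  proof (cases "n = 0")
    case True
    then show ?thesis
      by (simp add: p_def q_def v1_def n_def Xs_def Ys_def)
  next
    case False
    then have "p * p + q * q = complex_of_real (1 / (real n + 1))"
      unfolding p_def q_def n_def of_real_mult [symmetric] of_real_add [symmetric]
      by (simp only: hop_inflow)
    moreover have "v1 = v4"
      using False by (simp add: v1_def v4_def XY_shift)
    ultimately show ?thesis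
      using False by (auto simp: n_def)
  qed
  finally show ?thesis .
qed

lemma commutator: "A (B y) - B (A y) = j 0 0 (X (W (k 0 0 y)))"
proof -
  have c: "2 * c * norm x \<ge> 0" for x :: 'a
    using c_nonneg by simp
  have "A (B y) - B (A y) =
      (\<Sum>n. jn (prod_decode n) (lower_coeff (prod_decode n) (B y)) -
        jn (prod_decode n) (raise_coeff (prod_decode n) (A y)))"
    unfolding A_def [of "B y"] B_def [of "A y"] assemble_def
    by (rule suminf_diff [OF assemble(1) [OF lower_coeff_sum_1 c] assemble(1) [OF raise_coeff_sum_1 c]])
  also have "\<dots> = (\<Sum>n. jn (prod_decode n) (if prod_decode n = (0, 0) then X (W (k 0 0 y)) else 0))"
  proof (rule suminf_cong)
    fix n
    obtain i l where "prod_decode n = (i, l)"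
      by (cases "prod_decode n")
    then show "jn (prod_decode n) (lower_coeff (prod_decode n) (B y)) -
        jn (prod_decode n) (raise_coeff (prod_decode n) (A y)) =
        jn (prod_decode n) (if prod_decode n = (0, 0) then X (W (k 0 0 y)) else 0)"
      by (simp only: op_diff [OF jn, symmetric] coeff_commutator)
  qed
  also have "\<dots> = (\<Sum>n\<in>{prod_encode (0, 0)}. jn (prod_decode n) (if prod_decode n = (0, 0) then X (W (k 0 0 y)) else 0))"
  proof (rule suminf_finite)
    fix n
    assume "n \<notin> {prod_encode (0, 0)}"
    then have "prod_decode n \<noteq> (0, 0)"
      by (metis prod_decode_inverse singletonI)
    then show "jn (prod_decode n) (if prod_decode n = (0, 0) then X (W (k 0 0 y)) else 0) = 0"
      by (simp add: op_zero [OF jn])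
  qed simp
  finally show ?thesis
    by (simp add: jn_def)
qed

lemma A_eq_0: "(\<And>i l. k i l y = 0) \<Longrightarrow> A y = 0" and B_eq_0: "(\<And>i l. k i l y = 0) \<Longrightarrow> B y = 0"
  by (simp_all add: A_def B_def assemble_def lower_coeff_def raise_coeff_def case_prod_unfold
      op_zero [OF Xs] op_zero [OF Ys] op_zero [OF jn])

lemma
  assumes "\<And>i l x. \<langle>j i l x, h\<rangle> = 0"
  shows cinner_A_eq_0: "\<langle>A y, h\<rangle> = 0" and cinner_B_eq_0: "\<langle>B y, h\<rangle> = 0"
proof -
  have c: "2 * c * norm y \<ge> 0"
    using c_nonneg by simp
  have "\<langle>jn \<nu> x, h\<rangle> = 0" for \<nu> x
    by (simp add: jn_def assms)
  then show "\<langle>A y, h\<rangle> = 0" "\<langle>B y, h\<rangle> = 0"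
    unfolding A_def B_def assemble_def
    by (simp_all add: cinner_suminf_left [OF assemble(1) [OF lower_coeff_sum_1 c]]
        cinner_suminf_left [OF assemble(1) [OF raise_coeff_sum_1 c]])
qed

text \<open>Along a path of \<open>A\<close> the first coordinate only decreases and the second only
  increases. A step changes a coordinate within the first \<open>M\<close> values, which happens at
  most \<open>2 * M\<close> times, or else its weight is at most \<open>1 / s\<close>. The factor
  \<delta> gains \<open>s\<close> in the exceptional steps; it lies between \<open>1 / s ^ M\<close>
  and \<open>s ^ M\<close>, whence the constant \<open>s ^ (2 * M) = (M + 1) ^ M\<close>. As
  \<open>M\<close> is free, \<open>A\<close> is quasinilpotent.\<close>

lemma A_power_bound:
  "norm ((A ^^ m) y) \<le> real (M + 1) ^ M * (2 * c / sqrt (real (M + 1))) ^ m * norm y"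
proof -
  define s where "s = sqrt (real (M + 1))"
  have s: "s \<ge> 1" "s * s = real (M + 1)"
    by (simp_all add: s_def)
  define \<delta> where "\<delta> i l = s ^ min i M / s ^ min l M" for i l
  have pow: "1 \<le> s ^ n" "s ^ min n M \<le> s ^ M" for n
    using s(1) by (auto intro: power_increasing one_le_power)
  have \<delta>_pos: "\<delta> i l > 0" and \<delta>_le: "\<delta> i l \<le> s ^ M" and \<delta>_ge: "1 \<le> s ^ M * \<delta> i l" for i l
  proof -
    show "\<delta> i l > 0" using s(1) by (simp add: \<delta>_def)
    have "s ^ min i M / s ^ min l M \<le> s ^ M / 1"
      using pow s(1) by (intro frac_le) auto
    then show "\<delta> i l \<le> s ^ M" by (simp add: \<delta>_def)
    have "1 / s ^ M \<le> s ^ min i M / s ^ min l M"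
      using pow s(1) by (intro frac_le) auto
    then show "1 \<le> s ^ M * \<delta> i l"
      using s(1) by (simp add: \<delta>_def field_simps)
  qed
  have hop_s: "hop i l \<le> 1 / s" if "i + l \<ge> M" for i l
  proof -
    have "1 / sqrt (real (i + l + 1)) \<le> 1 / s"
      unfolding s_def using that by (intro frac_le) auto
    with hop_le [of i l] show ?thesis by linarith
  qed
  have w1: "hop (Suc i) l * \<delta> i l \<le> 1 / s * \<delta> (Suc i) l" for i l
  proof (cases "i < M")
    case True
    then have "\<delta> (Suc i) l = s * \<delta> i l" by (simp add: \<delta>_def min_def)
    then show ?thesis
      using hop_le_1 [of "Suc i" l] \<delta>_pos [of i l] s(1) by simp
  next
    case False
    then have "\<delta> (Suc i) l = \<delta> i l" by (simp add: \<delta>_def min_def)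
    then show ?thesis
      using mult_right_mono [OF hop_s [of "Suc i" l], of "\<delta> i l"] False \<delta>_pos [of i l] by simp
  qed
  have w2: "hop (Suc l) i * \<delta> i (Suc l) \<le> 1 / s * \<delta> i l" for i l
  proof (cases "l < M")
    case True
    then have "\<delta> i (Suc l) = 1 / s * \<delta> i l" by (simp add: \<delta>_def min_def)
    then show ?thesis
      using mult_right_mono [OF hop_le_1 [of "Suc l" i], of "\<delta> i (Suc l)"] \<delta>_pos [of i "Suc l"] by simp
  next
    case False
    then have "\<delta> i (Suc l) = \<delta> i l" by (simp add: \<delta>_def min_def)
    then show ?thesis
      using mult_right_mono [OF hop_s [of "Suc l" i], of "\<delta> i l"] False \<delta>_pos [of i l] by simp
  qed
  define \<theta> where "\<theta> = 2 * c / s"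
  have "\<theta> \<ge> 0" using c_nonneg s(1) by (simp add: \<theta>_def)
  have low: "(\<Sum>\<nu>\<in>S. (\<delta> (fst \<nu>) (snd \<nu>) * norm (lower_coeff \<nu> z))\<^sup>2) \<le> (\<theta> * R)\<^sup>2"
    if "finite S" "R \<ge> 0" "\<And>S. finite S \<Longrightarrow> (\<Sum>\<nu>\<in>S. (\<delta> (fst \<nu>) (snd \<nu>) * norm (kn \<nu> z))\<^sup>2) \<le> R\<^sup>2"
    for S R z
    using lower_coeff_sum [OF that(1) less_imp_le [OF \<delta>_pos] _ that(2) w1 w2 that(3)] s(1)
    by (simp add: \<theta>_def mult_ac)
  have pow_sum: "(\<Sum>\<nu>\<in>S. (\<delta> (fst \<nu>) (snd \<nu>) * norm (kn \<nu> ((A ^^ m) y)))\<^sup>2) \<le> (\<theta> ^ m * (s ^ M * norm y))\<^sup>2"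
    if "finite S" for S m
    using that
  proof (induction m arbitrary: S)
    case 0
    have "(\<Sum>\<nu>\<in>S. (\<delta> (fst \<nu>) (snd \<nu>) * norm (kn \<nu> y))\<^sup>2) \<le> (\<Sum>\<nu>\<in>S. (s ^ M * norm (kn \<nu> y))\<^sup>2)"
      using \<delta>_le \<delta>_pos by (intro sum_mono power_mono mult_right_mono mult_nonneg_nonneg) (auto simp: less_imp_le)
    also have "\<dots> = (s ^ M)\<^sup>2 * (\<Sum>\<nu>\<in>S. (norm (kn \<nu> y))\<^sup>2)"
      by (simp add: power_mult_distrib sum_distrib_left)
    also have "\<dots> \<le> (s ^ M)\<^sup>2 * (norm y)\<^sup>2"
      using kn_bessel [OF \<open>finite S\<close>] by (intro mult_left_mono) auto
    finally show ?case by (simp add: power_mult_distrib)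
  next
    case (Suc m)
    have "(\<Sum>\<nu>\<in>S. (\<delta> (fst \<nu>) (snd \<nu>) * norm (kn \<nu> ((A ^^ Suc m) y)))\<^sup>2) \<le>
       (\<Sum>\<nu>\<in>S. (\<delta> (fst \<nu>) (snd \<nu>) * norm (lower_coeff \<nu> ((A ^^ m) y)))\<^sup>2)"
      using \<delta>_pos by (intro sum_mono power_mono mult_left_mono mult_nonneg_nonneg)
        (auto simp: less_imp_le kn_A)
    also have "\<dots> \<le> (\<theta> * (\<theta> ^ m * (s ^ M * norm y)))\<^sup>2"
      using Suc.prems Suc.IH \<open>\<theta> \<ge> 0\<close> s(1) by (intro low) auto
    finally show ?case by (simp add: mult_ac)
  qed
  have sM: "s ^ M * s ^ M = real (M + 1) ^ M"
    using s(2) by (metis power_mult_distrib)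
  \<comment> \<open>For \<open>m > 0\<close> the vector is assembled from its components, which
    therefore bound its norm. This need not hold for \<open>y\<close> itself, so
    \<open>m = 0\<close> is separate.\<close>
  show ?thesis
  proof (cases m)
    case 0
    have "1 * norm y \<le> real (M + 1) ^ M * norm y"
      by (intro mult_right_mono one_le_power) auto
    with 0 show ?thesis by simp
  next
    case (Suc r)
    define R where "R = \<theta> ^ m * (s ^ M * norm y)"
    have "R \<ge> 0" using \<open>\<theta> \<ge> 0\<close> s(1) by (simp add: R_def)
    have "(\<Sum>\<nu>\<in>S. (norm (lower_coeff \<nu> ((A ^^ r) y)))\<^sup>2) \<le> (s ^ M * R)\<^sup>2" if "finite S" for S
    proof -
      have "(\<Sum>\<nu>\<in>S. (norm (lower_coeff \<nu> ((A ^^ r) y)))\<^sup>2) \<le>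
          (\<Sum>\<nu>\<in>S. (s ^ M * (\<delta> (fst \<nu>) (snd \<nu>) * norm (lower_coeff \<nu> ((A ^^ r) y))))\<^sup>2)"
        using mult_right_mono [OF \<delta>_ge norm_ge_zero]
        by (intro sum_mono power_mono) (auto simp: mult.assoc)
      also have "\<dots> = (s ^ M)\<^sup>2 * (\<Sum>\<nu>\<in>S. (\<delta> (fst \<nu>) (snd \<nu>) * norm (lower_coeff \<nu> ((A ^^ r) y)))\<^sup>2)"
        by (simp add: power_mult_distrib sum_distrib_left)
      also have "\<dots> \<le> (s ^ M)\<^sup>2 * (\<theta> * (\<theta> ^ r * (s ^ M * norm y)))\<^sup>2"
        using that pow_sum \<open>\<theta> \<ge> 0\<close> s(1) by (intro mult_left_mono low) auto
      finally show ?thesis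
        by (simp add: R_def Suc power_mult_distrib mult_ac)
    qed
    then have "norm (assemble (\<lambda>\<nu>. lower_coeff \<nu> ((A ^^ r) y))) \<le> s ^ M * R"
      using \<open>R \<ge> 0\<close> s(1) by (intro assemble(2)) auto
    then have "norm ((A ^^ m) y) \<le> s ^ M * R"
      by (simp add: Suc A_def)
    also have "s ^ M * R = real (M + 1) ^ M * \<theta> ^ m * norm y"
      unfolding R_def sM [symmetric] by (simp add: mult_ac)
    finally show ?thesis
      by (simp add: \<theta>_def s_def)
  qed
qed

end

section \<open>Compact operators with a large reducing kernel\<close>

text \<open>For orthonormal \<open>u\<close> and \<open>v\<close> this is the partial isometry
  taking \<open>u m\<close> to \<open>v m\<close>; its adjoint is
  \<open>transfer v u\<close>.\<close>

definition transfer :: "(nat \<Rightarrow> 'a::chilbert_space) \<Rightarrow> (nat \<Rightarrow> 'a) \<Rightarrow> 'a \<Rightarrow> 'a" where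
  "transfer u v x = (\<Sum>m. \<langle>x, u m\<rangle> *\<^sub>C v m)"

lemma transfer_proj: "transfer e e = proj e"
  by (simp add: transfer_def proj_def fun_eq_iff)

context
  fixes u v :: "nat \<Rightarrow> 'a::chilbert_space"
  assumes u: "orthosystem u" and v: "orthosystem v"
begin

lemma transfer_summable: "summable (\<lambda>m. \<langle>x, u m\<rangle> *\<^sub>C v m)"
  by (intro orthosystem_series(1) v bessel_summable u)

lemma op_bound_transfer: "op_bound (transfer u v) 1"
proof (rule op_boundI)
  fix x y a
  show "transfer u v (x + y) = transfer u v x + transfer u v y"
    unfolding transfer_def cinner_add_left scaleC_add_left
    by (rule suminf_add [OF transfer_summable transfer_summable, symmetric])
  show "transfer u v (a *\<^sub>C x) = a *\<^sub>C transfer u v x"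
    unfolding transfer_def cinner_scaleC_left scaleC_scaleC [symmetric]
    by (rule scaleC_suminf [OF transfer_summable, symmetric])
  have "(norm (transfer u v x))\<^sup>2 \<le> (\<Sum>m. (cmod \<langle>x, u m\<rangle>)\<^sup>2)"
    unfolding transfer_def by (intro orthosystem_series(2) v bessel_summable u)
  also have "\<dots> \<le> (norm x)\<^sup>2"
    using bessel_finite [OF u] by (rule summable_of_bounded_partial_sums(2) [rotated]) simp
  finally have "norm (transfer u v x) \<le> norm x"
    by (rule power2_le_imp_le) simp
  then show "norm (transfer u v x) \<le> 1 * norm x"
    by simp
qed

lemma cinner_transfer: "\<langle>transfer u v x, v m\<rangle> = \<langle>x, u m\<rangle> * \<langle>v m, v m\<rangle>"
  unfolding transfer_def by (intro orthosystem_series(3) v bessel_summable u)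

lemma transfer_orth: "(\<And>m. \<langle>v m, z\<rangle> = 0) \<Longrightarrow> \<langle>transfer u v x, z\<rangle> = 0"
  unfolding transfer_def by (simp add: cinner_suminf_left [OF transfer_summable] cinner_scaleC_left)

end

lemma transfer_adjoint:
  assumes u: "orthosystem u" and v: "orthosystem v"
  shows "\<langle>transfer u v x, y\<rangle> = \<langle>x, transfer v u y\<rangle>"
proof -
  have "\<langle>transfer u v x, y\<rangle> = (\<Sum>m. \<langle>x, u m\<rangle> * \<langle>v m, y\<rangle>)"
    unfolding transfer_def
    by (simp add: cinner_suminf_left [OF transfer_summable [OF u v]] cinner_scaleC_left)
  also have "\<dots> = (\<Sum>m. \<langle>x, \<langle>y, v m\<rangle> *\<^sub>C u m\<rangle>)"
    by (simp add: cinner_scaleC_right cinner_commute [symmetric] mult.commute)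
  also have "\<dots> = \<langle>x, transfer v u y\<rangle>"
    unfolding transfer_def by (rule cinner_suminf_right [OF transfer_summable [OF v u], symmetric])
  finally show ?thesis .
qed

lemma proj_self_adjoint:
  fixes e :: "nat \<Rightarrow> 'a::chilbert_space"
  shows "orthosystem e \<Longrightarrow> \<langle>proj e x, y\<rangle> = \<langle>x, proj e y\<rangle>"
  using transfer_adjoint [of e e x y] by (simp add: transfer_proj)

lemma proj_idem:
  fixes e :: "nat \<Rightarrow> 'a::chilbert_space"
  assumes "orthosystem e"
  shows "proj e (proj e x) = proj e x"
  unfolding proj_def [of e "proj e x"] cinner_proj_basis [OF assms] by (simp add: proj_def)

lemma orthosystem_comp_inj: "orthosystem e \<Longrightarrow> inj f \<Longrightarrow> orthosystem (\<lambda>n. e (f n))"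
  by (auto simp: orthosystem_def inj_eq)

text \<open>The range of the projection \<open>Q\<close> sits at the origin, and isometric copies of
  the whole space, carried by disjoint subsequences of \<open>r\<close>, sit at the other nodes. The
  last conjunct keeps both operators away from everything orthogonal to these spaces, where
  eigenvectors are placed later.\<close>

lemma commutator_large_kernel:
  fixes e r :: "nat \<Rightarrow> 'a::chilbert_space" and Q T :: "'a \<Rightarrow> 'a"
  assumes e: "orthosystem e" and basis: "\<And>x. proj e x = x"
    and r: "orthosystem r" and r_unit: "\<And>n. norm (r n) = 1"
    and Q: "op_bound Q 1" and Q_idem: "\<And>x. Q (Q x) = Q x" and Q_adj: "\<And>x y. \<langle>Q x, y\<rangle> = \<langle>x, Q y\<rangle>"
    and Qr: "\<And>n. Q (r n) = 0"
    and T: "compact_operator T" and T_bound: "op_bound T \<tau>" and "\<tau> > 0"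
    and QT: "\<And>x. Q (T x) = T x" and TQ: "\<And>x. T (Q x) = T x"
  shows "\<exists>A B. compact_operator A \<and> compact_operator B \<and>
    op_bound A (4 * sqrt \<tau>) \<and> op_bound B (4 * sqrt \<tau>) \<and> (\<forall>x. T x = A (B x) - B (A x)) \<and>
    (\<forall>M m y. norm ((A ^^ m) y) \<le> real (M + 1) ^ M * (4 * sqrt \<tau> / sqrt (real (M + 1))) ^ m * norm y) \<and>
    (\<forall>h. Q h = 0 \<longrightarrow> (\<forall>n. \<langle>h, r n\<rangle> = 0) \<longrightarrow>
       A h = 0 \<and> B h = 0 \<and> (\<forall>y. \<langle>A y, h\<rangle> = 0 \<and> \<langle>B y, h\<rangle> = 0))"
proof -
  obtain X' W' where "compact_operator X' \<and> compact_operator W' \<and>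
    op_bound X' (2 * sqrt \<tau>) \<and> op_bound W' (2 * sqrt \<tau>) \<and> (\<forall>x. T x = X' (W' x))"
    using compact_factorization [OF e basis T T_bound \<open>\<tau> > 0\<close>] by (elim exE) (rule that)
  then have XW': "compact_operator X'" "compact_operator W'"
    "op_bound X' (2 * sqrt \<tau>)" "op_bound W' (2 * sqrt \<tau>)" and TXW: "T x = X' (W' x)" for x
    by simp_all
  \<comment> \<open>Compressing the factors by \<open>Q\<close> does not change the product, since
    \<open>T\<close> agrees with \<open>Q T Q\<close>, and it moves the range of \<open>X\<close>
    into that of \<open>Q\<close>, as \<open>kj_X\<close> requires.\<close>
  define X where "X x = Q (X' x)" for x
  define W where "W x = W' (Q x)" for x
  define R where "R i l m = r (prod_encode (prod_encode (i, l), m))" for i l m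
  define j where "j i l = (if (i, l) = (0, 0) then Q else transfer e (R i l))" for i l
  define k where "k i l = (if (i, l) = (0, 0) then Q else transfer (R i l) e)" for i l
  have R: "orthosystem (R i l)" for i l
    unfolding R_def by (rule orthosystem_comp_inj [OF r]) (auto simp: inj_def)
  have R_unit: "\<langle>R i l m, R i l m\<rangle> = 1" for i l m
    by (simp add: R_def cinner_self r_unit)
  have R_orth: "\<langle>R i l m, R i' l' m'\<rangle> = 0" if "(i, l) \<noteq> (i', l')" for i l i' l' m m'
    unfolding R_def using that by (intro orthosystem_orth r) auto
  have QR: "Q (R i l m) = 0" for i l m
    by (simp add: R_def Qr)
  have j: "op_bound (j i l) 1" and k: "op_bound (k i l) 1" for i l
    by (simp_all add: j_def k_def Q op_bound_transfer e R)
  have adj: "\<langle>j i l x, y\<rangle> = \<langle>x, k i l y\<rangle>" for i l x y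
    by (simp add: j_def k_def Q_adj transfer_adjoint [OF e R])
  have kj: "k i l (j i l x) = x" if "(i, l) \<noteq> (0, 0)" for i l x
  proof -
    have "k i l (j i l x) = (\<Sum>m. \<langle>x, e m\<rangle> *\<^sub>C e m)"
      using that unfolding j_def k_def transfer_def [of "R i l" e]
      by (simp only: if_False cinner_transfer [OF e R] R_unit mult_1_right)
    then show ?thesis
      using basis [of x] by (simp add: proj_def)
  qed
  have kjk: "k i l (j i l (k i l x)) = k i l x" for i l x
    by (cases "(i, l) = (0, 0)") (simp_all add: kj, simp add: j_def k_def Q_idem)
  have orth: "\<langle>j i l x, j i' l' y\<rangle> = 0" if "(i, l) \<noteq> (i', l')" for i l i' l' x y
  proof -
    have QR': "\<langle>Q z, R a b m\<rangle> = 0" "\<langle>R a b m, Q z\<rangle> = 0" for a b m z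
      using Q_adj [of z "R a b m"] Q_adj [of "R a b m" z] by (simp_all add: QR)
    have Rj: "\<langle>R a b m, j a' b' z\<rangle> = 0" if "(a, b) \<noteq> (a', b')" for a b a' b' m z
    proof -
      have "\<langle>transfer e (R a' b') z, R a b m\<rangle> = 0"
        by (rule transfer_orth [OF e R]) (use R_orth that in metis)
      then show ?thesis
        using QR' by (auto simp: j_def cinner_eq_0_commute [of "R a b m"])
    qed
    show ?thesis
    proof (cases "(i, l) = (0, 0)")
      case False
      then show ?thesis
        using Rj [OF that] by (auto simp: j_def [of i l] intro!: transfer_orth [OF e R])
    next
      case True
      then have "(i', l') \<noteq> (0, 0)" "(i', l') \<noteq> (i, l)" using that by auto
      then have "\<langle>j i' l' y, j i l x\<rangle> = 0"
        using Rj [of i' l' i l] by (auto simp: j_def [of i' l'] intro!: transfer_orth [OF e R])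
      then show ?thesis
        using cinner_eq_0_commute by blast
    qed
  qed
  have kj_neq: "k i l (j i' l' x) = 0" if "(i, l) \<noteq> (i', l')" for i l i' l' x
  proof -
    have "\<langle>k i l (j i' l' x), k i l (j i' l' x)\<rangle> = \<langle>j i l (k i l (j i' l' x)), j i' l' x\<rangle>"
      by (simp add: adj)
    then show ?thesis
      using orth [OF that] by simp
  qed
  have bessel: "(\<Sum>(i, l)\<in>S. (norm (k i l y))\<^sup>2) \<le> (norm y)\<^sup>2" if "finite S" for S y
  proof -
    \<comment> \<open>The maps \<open>j i l\<close> after \<open>k i l\<close> are mutually
      orthogonal projections, so Bessel's inequality follows from pairing the sum of these
      components with \<open>y\<close>.\<close>
    define p where "p \<nu> = (case \<nu> of (i, l) \<Rightarrow> j i l (k i l y))" for \<nu>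
    define s where "s = (\<Sum>(i, l)\<in>S. (norm (k i l y))\<^sup>2)"
    have inner: "\<langle>p (i, l), y\<rangle> = complex_of_real ((norm (k i l y))\<^sup>2)" for i l
      by (simp add: p_def adj cinner_self)
    have "\<langle>p (i, l), p (i, l)\<rangle> = \<langle>k i l y, k i l y\<rangle>" for i l
      by (simp add: p_def adj kjk)
    then have pn: "(norm (p (i, l)))\<^sup>2 = (norm (k i l y))\<^sup>2" for i l
      unfolding cinner_self of_real_eq_iff .
    have "(norm (sum p S))\<^sup>2 = (\<Sum>\<nu>\<in>S. (norm (p \<nu>))\<^sup>2)"
    proof (rule norm_sum_orthogonal [OF that])
      show "\<langle>p \<mu>, p \<nu>\<rangle> = 0" if "\<mu> \<noteq> \<nu>" for \<mu> \<nu>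
        unfolding p_def case_prod_unfold using that by (intro orth) (simp add: prod_eq_iff)
    qed
    also have "\<dots> = s"
      unfolding s_def by (intro sum.cong) (auto simp: pn)
    finally have ns: "(norm (sum p S))\<^sup>2 = s" .
    have "\<langle>sum p S, y\<rangle> = complex_of_real s"
      unfolding s_def cinner_sum_left of_real_sum by (intro sum.cong) (auto simp: inner)
    then have "\<bar>s\<bar> \<le> norm (sum p S) * norm y"
      using cmod_cinner_le [of "sum p S" y] by simp
    then have "norm (sum p S) * norm (sum p S) \<le> norm (sum p S) * norm y"
      unfolding ns [symmetric] by (simp add: power2_eq_square)
    then have "norm (sum p S) \<le> norm y"
      by (cases "sum p S = 0") auto
    then show ?thesis
      unfolding s_def [symmetric] ns [symmetric] by (intro power_mono) auto
  qed
  have X_bound: "op_bound X (2 * sqrt \<tau>)" and W_bound: "op_bound W (2 * sqrt \<tau>)"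
    using op_bound_comp [OF Q XW'(3)] op_bound_comp [OF XW'(4) Q] \<open>\<tau> > 0\<close>
    by (simp_all add: X_def [abs_def] W_def [abs_def])
  have X_compact: "compact_operator X" and W_compact: "compact_operator W"
    unfolding X_def [abs_def] W_def [abs_def]
    by (rule compact_operator_comp_left [OF Q XW'(1)], rule compact_operator_comp_right [OF XW'(2) Q])
  interpret node_system j k X W "2 * sqrt \<tau>"
  proof
    show "k 0 0 (j 0 0 (X x)) = X x" for x
      by (simp add: j_def k_def X_def Q_idem)
    show "0 \<le> 2 * sqrt \<tau>"
      using \<open>\<tau> > 0\<close> by simp
  qed (fact j k orth kj_neq kj bessel X_compact W_compact X_bound W_bound)+
  have bounds: "op_bound A (4 * sqrt \<tau>)" "op_bound B (4 * sqrt \<tau>)"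
    using A_bound B_bound by simp_all
  have com: "\<forall>x. T x = A (B x) - B (A x)"
    unfolding commutator by (simp add: j_def k_def X_def W_def Q_idem QT TQ flip: TXW)
  have power: "\<forall>M m y. norm ((A ^^ m) y) \<le> real (M + 1) ^ M * (4 * sqrt \<tau> / sqrt (real (M + 1))) ^ m * norm y"
    using A_power_bound by simp
  have supp: "\<forall>h. Q h = 0 \<longrightarrow> (\<forall>n. \<langle>h, r n\<rangle> = 0) \<longrightarrow>
       A h = 0 \<and> B h = 0 \<and> (\<forall>y. \<langle>A y, h\<rangle> = 0 \<and> \<langle>B y, h\<rangle> = 0)"
  proof (intro allI impI)
    fix h
    assume h: "Q h = 0" "\<forall>n. \<langle>h, r n\<rangle> = 0"
    have k0: "k i l h = 0" for i l
      using h by (simp add: k_def transfer_def R_def)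
    then have "\<langle>j i l x, h\<rangle> = 0" for i l x
      by (simp add: adj)
    then show "A h = 0 \<and> B h = 0 \<and> (\<forall>y. \<langle>A y, h\<rangle> = 0 \<and> \<langle>B y, h\<rangle> = 0)"
      using k0 by (simp add: A_eq_0 B_eq_0 cinner_A_eq_0 cinner_B_eq_0)
  qed
  show ?thesis
    by (rule exI [of _ A], rule exI [of _ B], intro conjI) (fact A_compact B_compact bounds com power supp)+
qed

section \<open>Resolvents from power bounds\<close>

text \<open>The Neumann series of the inverse of \<mu> - \<open>A\<close>.\<close>

definition resolvent :: "('a::chilbert_space \<Rightarrow> 'a) \<Rightarrow> real \<Rightarrow> 'a \<Rightarrow> 'a" where
  "resolvent A \<mu> y = (\<Sum>m. complex_of_real ((1 / \<mu>) ^ Suc m) *\<^sub>C (A ^^ m) y)"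

text \<open>The powers, not \<open>A\<close> itself, are required to be small against \<mu>: with
  ratio at most \<open>1 / 2\<close> the series has norm at most \<open>2 * C / \<mu>\<close>, even
  when the norm bound \<open>K\<close> exceeds \<mu>.\<close>

context
  fixes A :: "'a::chilbert_space \<Rightarrow> 'a" and K C \<theta> \<mu> :: real
  assumes A: "op_bound A K" and pow: "\<And>m y. norm ((A ^^ m) y) \<le> C * \<theta> ^ m * norm y"
    and \<mu>: "\<mu> > 0" and \<theta>: "0 \<le> \<theta>" "\<theta> \<le> \<mu> / 2" and "C \<ge> 0"
begin

lemma op_bound_power: "op_bound (A ^^ m) (C * \<theta> ^ m)"
proof -
  have "(A ^^ m) (x + y) = (A ^^ m) x + (A ^^ m) y" "(A ^^ m) (a *\<^sub>C x) = a *\<^sub>C (A ^^ m) x" for x y a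
    by (induction m) (simp_all add: op_add [OF A] op_scaleC [OF A])
  then show ?thesis
    using pow by (intro op_boundI)
qed

lemma resolvent_term: "op_bound (\<lambda>y. complex_of_real ((1 / \<mu>) ^ Suc m) *\<^sub>C (A ^^ m) y) (C / \<mu> * (1 / 2) ^ m)"
proof (rule op_bound_mono [OF op_bound_real_scale [OF op_bound_power]])
  have "(1 / \<mu>) ^ Suc m * (C * \<theta> ^ m) = C / \<mu> * (\<theta> / \<mu>) ^ m"
    by (simp add: power_divide)
  also have "\<dots> \<le> C / \<mu> * (1 / 2) ^ m"
    using \<mu> \<theta> \<open>C \<ge> 0\<close> by (intro mult_left_mono power_mono) (auto simp: field_simps)
  finally show "(1 / \<mu>) ^ Suc m * (C * \<theta> ^ m) \<le> C / \<mu> * (1 / 2) ^ m" .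
qed (use \<mu> in simp)

lemma resolvent_term_summable: "summable (\<lambda>m. C / \<mu> * (1 / 2) ^ m)"
  by (intro summable_mult summable_geometric) simp

lemmas resolvent_summable = op_bound_suminf(1) [OF resolvent_term resolvent_term_summable]

lemma op_bound_resolvent: "op_bound (resolvent A \<mu>) (2 * C / \<mu>)"
proof -
  have "(\<Sum>m. C / \<mu> * (1 / 2) ^ m) = 2 * C / \<mu>"
    using suminf_mult [of "\<lambda>k. (1/2::real) ^ k" "C / \<mu>"] by (simp add: suminf_geometric)
  then show ?thesis
    using op_bound_suminf(2) [OF resolvent_term resolvent_term_summable] by (simp add: resolvent_def [abs_def])
qed

lemma resolvent_commute: "A (resolvent A \<mu> y) = resolvent A \<mu> (A y)"
proof -
  have "A (resolvent A \<mu> y) = (\<Sum>m. A (complex_of_real ((1 / \<mu>) ^ Suc m) *\<^sub>C (A ^^ m) y))"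
    unfolding resolvent_def by (rule op_suminf [OF A resolvent_summable])
  then show ?thesis
    by (simp only: op_scaleC [OF A] funpow_swap1 resolvent_def)
qed

lemma resolvent_eq: "complex_of_real \<mu> *\<^sub>C resolvent A \<mu> y - A (resolvent A \<mu> y) = y"
proof -
  have scale: "complex_of_real \<mu> *\<^sub>C complex_of_real ((1 / \<mu>) ^ Suc m) *\<^sub>C (A ^^ m) y =
      complex_of_real ((1 / \<mu>) ^ m) *\<^sub>C (A ^^ m) y" for m
  proof -
    have "\<mu> * (1 / \<mu>) ^ Suc m = (1 / \<mu>) ^ m"
      using \<mu> by simp
    then show ?thesis
      by (simp only: scaleC_scaleC of_real_mult [symmetric])
  qed
  have 1: "complex_of_real \<mu> *\<^sub>C resolvent A \<mu> y = (\<Sum>m. complex_of_real ((1 / \<mu>) ^ m) *\<^sub>C (A ^^ m) y)"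
    unfolding resolvent_def scaleC_suminf [OF resolvent_summable] scale by (rule refl)
  have s: "summable (\<lambda>m. complex_of_real ((1 / \<mu>) ^ m) *\<^sub>C (A ^^ m) y)"
    using summable_scaleC [OF resolvent_summable, of "complex_of_real \<mu>" y] unfolding scale .
  have "A (resolvent A \<mu> y) = (\<Sum>m. A (complex_of_real ((1 / \<mu>) ^ Suc m) *\<^sub>C (A ^^ m) y))"
    unfolding resolvent_def by (rule op_suminf [OF A resolvent_summable])
  also have "\<dots> = (\<Sum>m. complex_of_real ((1 / \<mu>) ^ Suc m) *\<^sub>C (A ^^ Suc m) y)"
    by (simp only: op_scaleC [OF A] funpow.simps comp_apply)
  also have "\<dots> = (\<Sum>m. complex_of_real ((1 / \<mu>) ^ m) *\<^sub>C (A ^^ m) y) - y"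
    using suminf_split_head [OF s] by simp
  finally show ?thesis
    unfolding 1 by simp
qed

lemma resolvent_kernel:
  assumes "A y = 0"
  shows "resolvent A \<mu> y = complex_of_real (1 / \<mu>) *\<^sub>C y"
proof -
  have "A (resolvent A \<mu> y) = 0"
    unfolding resolvent_commute assms by (rule op_zero [OF op_bound_resolvent])
  then have "complex_of_real (1 / \<mu>) *\<^sub>C (complex_of_real \<mu> *\<^sub>C resolvent A \<mu> y) = complex_of_real (1 / \<mu>) *\<^sub>C y"
    using resolvent_eq [of y] by simp
  then show ?thesis
    using \<mu> by (simp only: scaleC_scaleC of_real_mult [symmetric]) simp
qed

lemma cinner_resolvent:
  assumes "\<And>x. \<langle>A x, h\<rangle> = 0" "\<langle>y, h\<rangle> = 0"
  shows "\<langle>resolvent A \<mu> y, h\<rangle> = 0"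
proof -
  have "complex_of_real \<mu> * \<langle>resolvent A \<mu> y, h\<rangle> - \<langle>A (resolvent A \<mu> y), h\<rangle> = \<langle>y, h\<rangle>"
    using arg_cong [OF resolvent_eq, of "\<lambda>z. \<langle>z, h\<rangle>" y] by (simp add: cinner_simps)
  then show ?thesis
    using assms \<mu> by simp
qed

end

section \<open>Assembling a commutator\<close>

text \<open>The parameter \<open>M\<close> of the power bound for the \<open>i\<close>-th
  eigenvalue. It makes \<open>sqrt (M + 1) = 8 * 2 ^ i\<close>, so that
  \<open>4 * sqrt \<tau> / sqrt (M + 1)\<close> is half of the eigenvalue
  \<open>sqrt \<tau> * (1 / 2) ^ i\<close>, as the Neumann series needs.\<close>

definition coupling_scale :: "nat \<Rightarrow> nat" where
  "coupling_scale i = 64 * 4 ^ i - 1"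

definition coupling_const :: "nat \<Rightarrow> real" where
  "coupling_const i = real (coupling_scale i + 1) ^ coupling_scale i"

text \<open>
  How small the \<open>i\<close>-th row and column of an operator of norm \<open>\<tau>\<close> must be; the bound
  depends on nothing else, so it can be prescribed before the rows are chosen.
\<close>

definition coupling_bound :: "real \<Rightarrow> nat \<Rightarrow> real" where
  "coupling_bound \<tau> i = \<tau> / 8 * (1 / 4) ^ i / coupling_const i"

lemma coupling_const_ge_1: "coupling_const i \<ge> 1"
  unfolding coupling_const_def by (rule one_le_power) simp

lemma coupling_bound_pos: "\<tau> > 0 \<Longrightarrow> coupling_bound \<tau> i > 0"
  using coupling_const_ge_1 [of i] by (simp add: coupling_bound_def)

lemma sqrt_coupling_scale: "sqrt (real (coupling_scale i + 1)) = 8 * 2 ^ i"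
proof -
  have "coupling_scale i + 1 = 64 * 4 ^ i"
    by (simp add: coupling_scale_def)
  then have "real (coupling_scale i + 1) = (8 * 2 ^ i)\<^sup>2"
    by (simp add: power_mult_distrib power2_eq_square flip: power_mult_distrib)
  then show ?thesis
    by (simp add: real_sqrt_unique)
qed

lemma geometric_half: "summable (\<lambda>i. a * (1 / 2 :: real) ^ i)" "(\<Sum>i. a * (1 / 2 :: real) ^ i) = 2 * a"
  using suminf_mult [of "\<lambda>k. (1/2::real) ^ k" a] by (auto simp: suminf_geometric)

text \<open>The nearest other power is the next smaller one, so an eigenvalue is separated from the
  others by half its size.\<close>

lemma half_power_gap:
  assumes "i \<noteq> k"
  shows "(1 / 2 :: real) ^ Suc i \<le> \<bar>(1 / 2) ^ k - (1 / 2) ^ i\<bar>"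
proof (cases "k < i")
  case True
  then have "(1 / 2 :: real) ^ i \<le> (1 / 2) ^ Suc k"
    by (intro power_decreasing) auto
  moreover have "(1 / 2 :: real) ^ i > 0" by simp
  ultimately have "(1 / 2 :: real) ^ Suc i \<le> (1 / 2) ^ k - (1 / 2) ^ i"
    unfolding power_Suc by linarith
  also have "\<dots> \<le> \<bar>(1 / 2) ^ k - (1 / 2) ^ i\<bar>" by (rule abs_ge_self)
  finally show ?thesis .
next
  case False
  with assms have "(1 / 2 :: real) ^ k \<le> (1 / 2) ^ Suc i"
    by (intro power_decreasing) auto
  then have "(1 / 2 :: real) ^ Suc i \<le> (1 / 2) ^ i - (1 / 2) ^ k"
    unfolding power_Suc by linarith
  also have "\<dots> \<le> \<bar>(1 / 2) ^ k - (1 / 2) ^ i\<bar>"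
    by linarith
  finally show ?thesis .
qed

text \<open>
  The vectors \<open>h i\<close> become eigenvectors of \<open>A\<close> for distinct eigenvalues, so the
  rows and columns through them can be solved for; this needs the diagonal entries to vanish. What is
  left is annihilated by the \<open>r n\<close>, and the operator \<open>A\<close> constructed for it is
  quasinilpotent, with bounds on its resolvent that depend on the norm only.
\<close>

lemma commutator_assembly:
  fixes e r h :: "nat \<Rightarrow> 'a::chilbert_space" and T :: "'a \<Rightarrow> 'a"
  assumes e: "orthosystem e" and basis: "\<And>x. proj e x = x"
    and r: "orthosystem r" and r_unit: "\<And>n. norm (r n) = 1"
    and h: "orthosystem h" and h_unit: "\<And>n. norm (h n) = 1" and hr: "\<And>i n. \<langle>h i, r n\<rangle> = 0"
    and T: "compact_operator T" and T_bound: "op_bound T \<tau>" and "\<tau> > 0"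
    and Tr: "\<And>n y. (\<And>i. \<langle>y, h i\<rangle> = 0) \<Longrightarrow> \<langle>T (r n), y\<rangle> = 0"
    and rT: "\<And>n y. (\<And>i. \<langle>y, h i\<rangle> = 0) \<Longrightarrow> \<langle>T y, r n\<rangle> = 0"
    and diag: "\<And>i. \<langle>T (h i), h i\<rangle> = 0"
    and col: "\<And>i. norm (T (h i)) \<le> coupling_bound \<tau> i"
    and row: "\<And>i x. cmod \<langle>T x, h i\<rangle> \<le> coupling_bound \<tau> i * norm x"
  shows "\<exists>A B. compact_operator A \<and> compact_operator B \<and>
    op_bound A (6 * sqrt \<tau>) \<and> op_bound B (6 * sqrt \<tau>) \<and> (\<forall>x. T x = A (B x) - B (A x))"
proof -
  define P where "P x = x - proj h x" for x
  have P: "op_bound P 1"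
    unfolding P_def
    by (intro op_boundI) (simp_all add: norm_diff_proj_le [OF h] op_add [OF op_bound_proj [OF h]]
        op_scaleC [OF op_bound_proj [OF h]] scaleC_diff_right)
  have Ph: "P (h i) = 0" for i
    by (simp add: P_def proj_basis [OF h])
  have P_orth: "\<langle>P x, h i\<rangle> = 0" for x i
    by (simp add: P_def cinner_diff_left cinner_proj_basis [OF h])
  have P_fix: "P x = x" if "\<And>i. \<langle>x, h i\<rangle> = 0" for x
    using that by (simp add: P_def proj_eq_0)
  have P_adj: "\<langle>P x, y\<rangle> = \<langle>x, P y\<rangle>" for x y
    by (simp add: P_def cinner_diff_left cinner_diff_right proj_self_adjoint [OF h])
  have rh: "\<langle>r n, h i\<rangle> = 0" for n i
    using hr cinner_eq_0_commute by blast
  have Pr: "P (r n) = r n" for n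
    by (rule P_fix) (rule rh)
  \<comment> \<open>The block of \<open>T\<close> away from the \<open>h i\<close>. It vanishes on
    the \<open>r n\<close> and has range orthogonal to them, so it is a commutator by
    \<open>commutator_large_kernel\<close>.\<close>
  define T0 where "T0 x = P (T (P x))" for x
  have T0_compact: "compact_operator T0"
    unfolding T0_def [abs_def] by (intro compact_operator_comp_left [OF P] compact_operator_comp_right [OF T P])
  have T0_bound: "op_bound T0 \<tau>"
    using op_bound_comp [OF P op_bound_comp [OF T_bound P]] \<open>\<tau> > 0\<close> by (simp add: T0_def [abs_def])
  have T0r: "T0 (r n) = 0" for n
  proof -
    have "\<langle>P (T (r n)), P (T (r n))\<rangle> = \<langle>T (r n), P (P (T (r n)))\<rangle>"
      by (rule P_adj)
    also have "\<dots> = 0"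
      by (rule Tr) (rule P_orth)
    finally show ?thesis
      by (simp add: T0_def Pr)
  qed
  have rT0: "\<langle>T0 x, r n\<rangle> = 0" for x n
    unfolding T0_def P_adj Pr by (rule rT) (rule P_orth)
  define Q where "Q x = P x - proj r x" for x
  have proj_r_h: "\<langle>proj r x, h i\<rangle> = 0" for x i
    by (rule proj_cinner_orth [OF r rh])
  have proj_h_r: "\<langle>proj h x, r n\<rangle> = 0" for x n
    by (rule proj_cinner_orth [OF h hr])
  have proj_rP: "proj r (P x) = proj r x" for x
    by (simp add: P_def op_diff [OF op_bound_proj [OF r]] proj_eq_0 proj_h_r)
  have Q_eq: "Q x = P x - proj r (P x)" for x
    by (simp add: Q_def proj_rP)
  have Q: "op_bound Q 1"
  proof (rule op_boundI)
    show "norm (Q x) \<le> 1 * norm x" for x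
      unfolding Q_eq using order_trans [OF norm_diff_proj_le [OF r] op_norm [OF P]] by simp
  qed (simp_all add: Q_def op_add [OF P] op_scaleC [OF P] op_add [OF op_bound_proj [OF r]]
      op_scaleC [OF op_bound_proj [OF r]] scaleC_diff_right)
  have PQ: "P (Q x) = Q x" for x
    by (rule P_fix) (simp add: Q_def cinner_diff_left P_orth proj_r_h)
  have Q_idem: "Q (Q x) = Q x" for x
  proof -
    have "proj r (Q x) = 0"
      by (simp add: Q_eq op_diff [OF op_bound_proj [OF r]] proj_idem [OF r])
    then show ?thesis
      using Q_def [of "Q x"] PQ by simp
  qed
  have Q_adj: "\<langle>Q x, y\<rangle> = \<langle>x, Q y\<rangle>" for x y
    by (simp add: Q_def cinner_diff_left cinner_diff_right P_adj proj_self_adjoint [OF r])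
  have Qr: "Q (r n) = 0" for n
    by (simp add: Q_def Pr proj_basis [OF r])
  have QT0: "Q (T0 x) = T0 x" for x
  proof -
    have "P (T0 x) = T0 x"
      by (rule P_fix) (simp add: T0_def P_orth)
    then show ?thesis
      by (simp add: Q_def proj_eq_0 rT0)
  qed
  have T0Q: "T0 (Q x) = T0 x" for x
  proof -
    have "T0 (proj r x) = (\<Sum>n. T0 (\<langle>x, r n\<rangle> *\<^sub>C r n))"
      unfolding proj_def by (rule op_suminf [OF T0_bound proj_summable [OF r]])
    then have "T0 (proj r x) = 0"
      by (simp add: op_scaleC [OF T0_bound] T0r)
    moreover have "T0 (P x) = T0 x"
      unfolding T0_def using P_orth P_fix by metis
    ultimately show ?thesis
      by (simp add: Q_def op_diff [OF T0_bound])
  qed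
  obtain A0 B0 where A0_compact: "compact_operator A0" and B0_compact: "compact_operator B0"
    and A0: "op_bound A0 (4 * sqrt \<tau>)" and B0: "op_bound B0 (4 * sqrt \<tau>)"
    and T0_eq: "\<forall>x. T0 x = A0 (B0 x) - B0 (A0 x)"
    and A0_power: "\<forall>M m y. norm ((A0 ^^ m) y) \<le> real (M + 1) ^ M * (4 * sqrt \<tau> / sqrt (real (M + 1))) ^ m * norm y"
    and AB0: "\<forall>h. Q h = 0 \<longrightarrow> (\<forall>n. \<langle>h, r n\<rangle> = 0) \<longrightarrow>
       A0 h = 0 \<and> B0 h = 0 \<and> (\<forall>y. \<langle>A0 y, h\<rangle> = 0 \<and> \<langle>B0 y, h\<rangle> = 0)"
    using commutator_large_kernel [OF e basis r r_unit Q Q_idem Q_adj Qr T0_compact T0_bound \<open>\<tau> > 0\<close> QT0 T0Q]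
    by (elim exE conjE) (rule that, assumption+)
  have Qh: "Q (h i) = 0" for i
    by (simp add: Q_def Ph proj_eq_0 hr)
  have A0h: "A0 (h i) = 0" and B0h: "B0 (h i) = 0" and hA0: "\<langle>A0 y, h i\<rangle> = 0" and hB0: "\<langle>B0 y, h i\<rangle> = 0" for i y
    using AB0 Qh hr by blast+
  define s where "s = sqrt \<tau>"
  have s: "s > 0" "s * s = \<tau>"
    using \<open>\<tau> > 0\<close> by (simp_all add: s_def)
  \<comment> \<open>The eigenvalues sum to \<open>2 * s\<close>, which is what the diagonal operator
    \<open>D\<close> adds to the bound \<open>4 * s\<close> of \<open>A0\<close>.\<close>
  define \<mu> where "\<mu> i = s * (1 / 2) ^ i" for i :: nat
  have \<mu>: "\<mu> i > 0" for i
    using s by (simp add: \<mu>_def)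
  have pow: "norm ((A0 ^^ m) y) \<le> coupling_const i * (\<mu> i / 2) ^ m * norm y" for i m y
  proof -
    have eq: "4 * sqrt \<tau> / sqrt (real (coupling_scale i + 1)) = \<mu> i / 2"
      unfolding sqrt_coupling_scale by (simp add: \<mu>_def s_def power_divide)
    show ?thesis
      using A0_power [rule_format, of m y "coupling_scale i"] unfolding eq coupling_const_def [symmetric] .
  qed
  have C0: "0 \<le> coupling_const i" for i
    using coupling_const_ge_1 [of i] by linarith
  have \<mu>2: "0 \<le> \<mu> i / 2" "\<mu> i / 2 \<le> \<mu> i / 2" for i
    using \<mu> [of i] by simp_all
  define N where "N i = resolvent A0 (\<mu> i)" for i
  have N: "op_bound (N i) (2 * coupling_const i / \<mu> i)" for i
    unfolding N_def by (rule op_bound_resolvent [OF A0 pow \<mu> \<mu>2 C0])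
  have N_eq: "complex_of_real (\<mu> i) *\<^sub>C N i y - A0 (N i y) = y" for i y
    unfolding N_def by (rule resolvent_eq [OF A0 pow \<mu> \<mu>2 C0])
  have N_comm: "A0 (N i y) = N i (A0 y)" for i y
    unfolding N_def by (rule resolvent_commute [OF A0 pow \<mu> \<mu>2 C0])
  have Nh: "N i (h k) = complex_of_real (1 / \<mu> i) *\<^sub>C h k" for i k
    unfolding N_def by (rule resolvent_kernel [OF A0 pow \<mu> \<mu>2 C0 A0h])
  have N_orth: "\<langle>N i (P y), h k\<rangle> = 0" for i y k
    unfolding N_def by (rule cinner_resolvent [OF A0 pow \<mu> \<mu>2 C0 hA0 P_orth])
  define D where "D y = (\<Sum>i. (complex_of_real (\<mu> i) * \<langle>y, h i\<rangle>) *\<^sub>C h i)" for y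
  have D_form: "form_bound (\<lambda>y. complex_of_real (\<mu> i) * \<langle>y, h i\<rangle>) (\<mu> i)" for i
    using \<mu> [of i] mult_left_mono [OF cmod_cinner_le [of _ "h i"], of "\<mu> i"]
    by (auto simp: form_bound_def cinner_simps distrib_left norm_mult h_unit)
  have D_term: "op_bound (\<lambda>y. (complex_of_real (\<mu> i) * \<langle>y, h i\<rangle>) *\<^sub>C h i) (s * (1 / 2) ^ i)" for i
    using op_bound_rank_one [OF D_form, of i "h i"] by (simp add: h_unit \<mu>_def)
  have D: "op_bound D (2 * s)"
    using op_bound_suminf(2) [OF D_term geometric_half(1)] by (simp add: D_def [abs_def] geometric_half)
  have D_compact: "compact_operator D"
    unfolding D_def [abs_def]
    by (rule compact_operator_suminf [OF D_term geometric_half(1)]) (rule compact_operator_rank_one [OF D_form])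
  note D_summable = op_bound_suminf(1) [OF D_term geometric_half(1)]
  have D_orth: "D y = 0" if "\<And>i. \<langle>y, h i\<rangle> = 0" for y
    using that by (simp add: D_def)
  have hh: "\<langle>h i, h i\<rangle> = 1" for i
    by (simp add: cinner_self h_unit)
  have hD: "\<langle>D y, h i\<rangle> = complex_of_real (\<mu> i) * \<langle>y, h i\<rangle>" for y i
  proof -
    have "\<langle>D y, h i\<rangle> = (\<Sum>k. \<langle>(complex_of_real (\<mu> k) * \<langle>y, h k\<rangle>) *\<^sub>C h k, h i\<rangle>)"
      unfolding D_def by (rule cinner_suminf_left [OF D_summable])
    also have "\<dots> = (\<Sum>k\<in>{i}. \<langle>(complex_of_real (\<mu> k) * \<langle>y, h k\<rangle>) *\<^sub>C h k, h i\<rangle>)"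
      by (rule suminf_finite) (auto simp: cinner_scaleC_left orthosystem_orth [OF h])
    finally show ?thesis
      by (simp add: cinner_scaleC_left hh)
  qed
  have Dh: "D (h i) = complex_of_real (\<mu> i) *\<^sub>C h i" for i
  proof -
    have "D (h i) = (\<Sum>k\<in>{i}. (complex_of_real (\<mu> k) * \<langle>h i, h k\<rangle>) *\<^sub>C h k)"
      unfolding D_def by (rule suminf_finite) (auto simp: orthosystem_orth [OF h])
    then show ?thesis
      by (simp add: hh)
  qed
  have D_kill: "F (D y) = 0" if F: "op_bound F L" and "\<And>i. F (h i) = 0" for F L y
    unfolding D_def op_suminf [OF F D_summable] op_scaleC [OF F] by (simp add: that)
  define A where "A y = A0 y + D y" for y
  have A_bound: "op_bound A (6 * s)"
    using op_bound_plus [OF A0 D] by (simp add: A_def [abs_def] s_def)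
  have A_compact: "compact_operator A"
    unfolding A_def [abs_def] by (rule compact_operator_plus [OF A0_compact D_compact])
  have Ah: "A (h i) = complex_of_real (\<mu> i) *\<^sub>C h i" for i
    by (simp add: A_def A0h Dh)
  have hA: "\<langle>A y, h i\<rangle> = complex_of_real (\<mu> i) * \<langle>y, h i\<rangle>" for y i
    by (simp add: A_def cinner_add_left hA0 hD)
  \<comment> \<open>In the coordinate along \<open>h k\<close> the equation for column
    \<open>i\<close> is \<open>(\<mu> k - \<mu> i) * c i k = \<langle>T (h i), h k\<rangle>\<close>.
    For \<open>k = i\<close> it is solvable only because the diagonal entry vanishes.\<close>
  define c where "c i k = (if k = i then 0 else \<langle>T (h i), h k\<rangle> / complex_of_real (\<mu> k - \<mu> i))" for i k
  have c_le: "cmod (c i k) \<le> 2 ^ Suc i / s * cmod \<langle>T (h i), h k\<rangle>" for i k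
  proof (cases "k = i")
    case False
    have "\<bar>\<mu> k - \<mu> i\<bar> = s * \<bar>(1 / 2) ^ k - (1 / 2) ^ i\<bar>"
      using s(1) by (simp add: \<mu>_def abs_mult flip: right_diff_distrib)
    then have gap: "s * (1 / 2) ^ Suc i \<le> \<bar>\<mu> k - \<mu> i\<bar>"
      using half_power_gap [of i k] False s(1) by simp
    have "cmod (c i k) = cmod \<langle>T (h i), h k\<rangle> / \<bar>\<mu> k - \<mu> i\<bar>"
      using False by (simp add: c_def norm_divide del: of_real_diff)
    also have "\<dots> \<le> cmod \<langle>T (h i), h k\<rangle> / (s * (1 / 2) ^ Suc i)"
    proof (rule divide_left_mono [OF gap])
      have "0 < s * (1 / 2) ^ Suc i"
        using s(1) by simp
      then show "0 < \<bar>\<mu> k - \<mu> i\<bar> * (s * (1 / 2) ^ Suc i)"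
        using less_le_trans [OF _ gap] by (metis mult_pos_pos)
    qed simp
    also have "\<dots> = 2 ^ Suc i / s * cmod \<langle>T (h i), h k\<rangle>"
      by (simp add: power_divide mult_ac)
    finally show ?thesis .
  qed (use s(1) in \<open>simp add: c_def\<close>)
  have c_sq: "(cmod (c i k))\<^sup>2 \<le> (2 ^ Suc i / s)\<^sup>2 * (cmod \<langle>T (h i), h k\<rangle>)\<^sup>2" for i k
    using power_mono [OF c_le norm_ge_zero, of i k 2] unfolding power_mult_distrib .
  have bs: "summable (\<lambda>k. (2 ^ Suc i / s)\<^sup>2 * (cmod \<langle>T (h i), h k\<rangle>)\<^sup>2)" for i
    by (rule summable_mult [OF bessel_summable [OF h]])
  have c_summable: "summable (\<lambda>k. (cmod (c i k))\<^sup>2)" for i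
    by (rule summable_comparison_test' [OF bs [of i], of 0]) (use c_sq [of i] in simp)
  define xK where "xK i = (\<Sum>k. c i k *\<^sub>C h k)" for i
  note xK_summable = orthosystem_series(1) [OF h c_summable]
  have h_xK: "\<langle>xK i, h k\<rangle> = c i k" for i k
    unfolding xK_def by (simp add: orthosystem_series(3) [OF h c_summable] hh)
  define E where "E i = coupling_bound \<tau> i" for i
  have E: "E i > 0" "norm (T (h i)) \<le> E i" "cmod \<langle>T x, h i\<rangle> \<le> E i * norm x" for i x
    unfolding E_def by (rule coupling_bound_pos [OF \<open>\<tau> > 0\<close>], rule col, rule row)
  \<comment> \<open>\<open>coupling_bound\<close> is designed for this: the resolvent norm times the
    size of a row is \<open>s / 4 * (1 / 2) ^ i\<close>, whose sum is \<open>s / 2\<close>.\<close>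
  have E1: "2 * coupling_const i / \<mu> i * E i = s / 4 * (1 / 2) ^ i" for i
  proof -
    have "coupling_const i > 0" using coupling_const_ge_1 [of i] by linarith
    have "(2::real) ^ i * (1 / 4) ^ i = (1 / 2) ^ i"
      by (simp flip: power_mult_distrib)
    have "2 * coupling_const i / \<mu> i * E i = (2 * (1 / 8)) * (\<tau> / s) * (2 ^ i * (1 / 4) ^ i)"
      using \<open>coupling_const i > 0\<close> by (simp add: E_def coupling_bound_def \<mu>_def power_divide)
    also have "\<tau> / s = s"
      using s by (simp add: field_simps)
    finally show ?thesis
      using \<open>(2::real) ^ i * (1 / 4) ^ i = (1 / 2) ^ i\<close> by simp
  qed
  have E2: "2 ^ Suc i / s * E i \<le> s / 4 * (1 / 2) ^ i" for i
  proof -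
    have "2 ^ Suc i / s = 2 / \<mu> i"
      by (simp add: \<mu>_def power_divide)
    moreover have "2 / \<mu> i * E i \<le> 2 * coupling_const i / \<mu> i * E i"
      using coupling_const_ge_1 [of i] \<mu> [of i] E(1) [of i]
      by (intro mult_right_mono divide_right_mono) auto
    ultimately show ?thesis
      using E1 [of i] by simp
  qed
  have xK_norm: "norm (xK i) \<le> s / 4 * (1 / 2) ^ i" for i
  proof -
    have "(norm (xK i))\<^sup>2 \<le> (\<Sum>k. (cmod (c i k))\<^sup>2)"
      unfolding xK_def by (rule orthosystem_series(2) [OF h c_summable])
    also have "\<dots> \<le> (\<Sum>k. (2 ^ Suc i / s)\<^sup>2 * (cmod \<langle>T (h i), h k\<rangle>)\<^sup>2)"
      by (rule suminf_le [OF c_sq c_summable bs])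
    also have "\<dots> = (2 ^ Suc i / s)\<^sup>2 * (\<Sum>k. (cmod \<langle>T (h i), h k\<rangle>)\<^sup>2)"
      by (rule suminf_mult [OF bessel_summable [OF h]])
    also have "\<dots> \<le> (2 ^ Suc i / s)\<^sup>2 * (norm (T (h i)))\<^sup>2"
      using bessel_finite [OF h] by (intro mult_left_mono summable_of_bounded_partial_sums(2)) auto
    finally have "norm (xK i) \<le> 2 ^ Suc i / s * norm (T (h i))"
      using s(1) by (metis power_mult_distrib power2_le_imp_le mult_nonneg_nonneg norm_ge_zero
          divide_nonneg_pos zero_le_power zero_le_numeral)
    also have "\<dots> \<le> 2 ^ Suc i / s * E i"
      using s(1) E by (intro mult_left_mono) auto
    finally show ?thesis
      using E2 [of i] by linarith
  qed
  \<comment> \<open>The solution of \<open>A x - \<mu> x = T h\<close> for column \<open>i\<close>: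
    the part along the \<open>h k\<close> is found by division, the rest by the resolvent, with a
    minus sign because it inverts \<mu> - \<open>A0\<close>.\<close>
  define x where "x i = xK i - N i (P (T (h i)))" for i
  have x_norm: "norm (x i) \<le> s / 2 * (1 / 2) ^ i" for i
  proof -
    have "norm (N i (P (T (h i)))) \<le> 2 * coupling_const i / \<mu> i * norm (P (T (h i)))"
      by (rule op_norm [OF N])
    also have "\<dots> \<le> 2 * coupling_const i / \<mu> i * E i"
      using C0 [of i] \<mu> [of i] order_trans [OF op_norm [OF P, of "T (h i)"], of "E i"] E(2) [of i]
      by (intro mult_left_mono) auto
    finally have "norm (N i (P (T (h i)))) \<le> s / 4 * (1 / 2) ^ i"
      unfolding E1 .
    then show ?thesis
      unfolding x_def using xK_norm [of i] norm_triangle_ineq4 [of "xK i" "N i (P (T (h i)))"] by simp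
  qed
  have x_eq: "A (x i) - complex_of_real (\<mu> i) *\<^sub>C x i = T (h i)" for i
  proof -
    have "A0 (xK i) = 0"
      unfolding xK_def by (simp add: op_suminf [OF A0 xK_summable] op_scaleC [OF A0] A0h)
    have "D (N i (P (T (h i)))) = 0"
      by (rule D_orth) (rule N_orth)
    have "D (xK i) - complex_of_real (\<mu> i) *\<^sub>C xK i =
        (\<Sum>k. (complex_of_real (\<mu> k) * c i k) *\<^sub>C h k - complex_of_real (\<mu> i) *\<^sub>C c i k *\<^sub>C h k)"
      using suminf_diff [OF D_summable [of "xK i"] summable_scaleC [OF xK_summable, of "complex_of_real (\<mu> i)" i]]
        scaleC_suminf [OF xK_summable, of "complex_of_real (\<mu> i)" i]
      by (simp add: D_def h_xK flip: xK_def)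
    also have "\<dots> = (\<Sum>k. \<langle>T (h i), h k\<rangle> *\<^sub>C h k)"
    proof (rule suminf_cong)
      fix k
      have "complex_of_real (\<mu> k) * c i k - complex_of_real (\<mu> i) * c i k = \<langle>T (h i), h k\<rangle>"
      proof (cases "k = i")
        case False
        then have "\<bar>(1 / 2 :: real) ^ k - (1 / 2) ^ i\<bar> > 0"
          by (intro less_le_trans [OF _ half_power_gap]) auto
        then have "\<mu> k - \<mu> i \<noteq> 0"
          using s(1) by (simp add: \<mu>_def)
        then have "complex_of_real (\<mu> k - \<mu> i) \<noteq> 0"
          by (simp only: of_real_eq_0_iff) simp
        then have "complex_of_real (\<mu> k - \<mu> i) * c i k = \<langle>T (h i), h k\<rangle>"
          using False by (simp add: c_def del: of_real_diff)
        then show ?thesis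
          by (simp add: left_diff_distrib)
      qed (simp add: diag)
      then show "(complex_of_real (\<mu> k) * c i k) *\<^sub>C h k - complex_of_real (\<mu> i) *\<^sub>C c i k *\<^sub>C h k =
          \<langle>T (h i), h k\<rangle> *\<^sub>C h k"
        by (simp add: scaleC_scaleC flip: scaleC_diff_left)
    qed
    finally have K: "D (xK i) - complex_of_real (\<mu> i) *\<^sub>C xK i = proj h (T (h i))"
      by (simp add: proj_def)
    have "A (x i) - complex_of_real (\<mu> i) *\<^sub>C x i =
        (D (xK i) - complex_of_real (\<mu> i) *\<^sub>C xK i) +
        (complex_of_real (\<mu> i) *\<^sub>C N i (P (T (h i))) - A0 (N i (P (T (h i)))))"
      by (simp add: A_def x_def op_diff [OF A0] op_diff [OF D] scaleC_diff_right
          \<open>A0 (xK i) = 0\<close> \<open>D (N i (P (T (h i)))) = 0\<close>)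
    also have "\<dots> = T (h i)"
      unfolding K N_eq by (simp add: P_def)
    finally show ?thesis .
  qed
  \<comment> \<open>The dual equation: this functional satisfies
    \<open>\<mu> \<phi> - \<phi> A = \<langle>T (P _), h i\<rangle>\<close>, that is, it solves for
    row \<open>i\<close>. Composition with the resolvent on the right replaces applying it to a
    vector.\<close>
  define \<phi> where "\<phi> i y = \<langle>T (P (N i y)), h i\<rangle>" for i y
  have TPN: "op_bound (\<lambda>y. T (P (N i y))) (\<tau> * (1 * (2 * coupling_const i / \<mu> i)))" for i
    by (intro op_bound_comp T_bound P N) (use \<open>\<tau> > 0\<close> in auto)
  have \<phi>: "form_bound (\<phi> i) (s / 4 * (1 / 2) ^ i)" for i
  proof -
    have "cmod (\<phi> i y) \<le> s / 4 * (1 / 2) ^ i * norm y" for y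
    proof -
      have "cmod (\<phi> i y) \<le> E i * norm (P (N i y))"
        unfolding \<phi>_def by (rule E)
      also have "\<dots> \<le> E i * (2 * coupling_const i / \<mu> i * norm y)"
        using op_norm [OF P, of "N i y"] op_norm [OF N, of i y] E(1) [of i] by (intro mult_left_mono) auto
      also have "\<dots> = 2 * coupling_const i / \<mu> i * E i * norm y"
        by (simp only: mult_ac)
      finally show ?thesis unfolding E1 .
    qed
    then show ?thesis
      by (simp add: form_bound_def \<phi>_def op_add [OF TPN] op_scaleC [OF TPN] cinner_simps)
  qed
  have \<phi>_eq: "complex_of_real (\<mu> i) * \<phi> i y - \<phi> i (A y) = \<langle>T (P y), h i\<rangle>" for i y
  proof -
    have PND: "P (N i (D y)) = 0"
      by (rule D_kill [OF op_bound_comp [OF P N]]) (simp_all add: Nh op_scaleC [OF P] Ph)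
    have "P (N i (A y)) = P (A0 (N i y))"
      by (simp add: A_def op_add [OF N] op_add [OF P] PND N_comm)
    then have "complex_of_real (\<mu> i) * \<phi> i y - \<phi> i (A y) =
        \<langle>T (P (complex_of_real (\<mu> i) *\<^sub>C N i y - A0 (N i y))), h i\<rangle>"
      by (simp add: \<phi>_def op_diff [OF P] op_scaleC [OF P] op_diff [OF T_bound] op_scaleC [OF T_bound] cinner_simps)
    then show ?thesis
      unfolding N_eq .
  qed
  have S1: "op_bound (\<lambda>y. \<langle>y, h i\<rangle> *\<^sub>C x i) (s / 2 * (1 / 2) ^ i)" for i
    using op_bound_rank_one [OF form_bound_cinner, of "h i" "x i"] x_norm [of i]
    by (auto simp: h_unit intro: op_bound_mono)
  have S2: "op_bound (\<lambda>y. \<phi> i y *\<^sub>C h i) (s / 4 * (1 / 2) ^ i)" for i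
    using op_bound_rank_one [OF \<phi>, of i "h i"] by (simp add: h_unit)
  note S1_sum = op_bound_suminf(1) [OF S1 geometric_half(1)]
  note S2_sum = op_bound_suminf(1) [OF S2 geometric_half(1)]
  \<comment> \<open>\<open>B1\<close> accounts for the full columns, including the entries between
    two of the \<open>h i\<close>; so \<open>B2\<close> treats only the rows of \<open>T\<close>
    after \<open>P\<close>, and no entry is counted twice.\<close>
  define B1 where "B1 y = (\<Sum>i. \<langle>y, h i\<rangle> *\<^sub>C x i)" for y
  define B2 where "B2 y = (\<Sum>i. \<phi> i y *\<^sub>C h i)" for y
  have B1: "op_bound B1 s" and B2: "op_bound B2 (s / 2)"
    using op_bound_suminf(2) [OF S1 geometric_half(1)] op_bound_suminf(2) [OF S2 geometric_half(1)]
    unfolding geometric_half(2) by (simp_all add: B1_def [abs_def] B2_def [abs_def])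
  have B1_compact: "compact_operator B1" and B2_compact: "compact_operator B2"
    unfolding B1_def [abs_def] B2_def [abs_def]
    by (rule compact_operator_suminf [OF S1 geometric_half(1)], rule compact_operator_rank_one [OF form_bound_cinner],
        rule compact_operator_suminf [OF S2 geometric_half(1)], rule compact_operator_rank_one [OF \<phi>])
  define B where "B y = B0 y + B1 y + B2 y" for y
  have "op_bound B (4 * sqrt \<tau> + s + s / 2)"
    unfolding B_def [abs_def] by (intro op_bound_plus B0 B1 B2)
  then have B_bound: "op_bound B (6 * s)"
    by (rule op_bound_mono) (use s(1) in \<open>simp add: s_def\<close>)
  have B_compact: "compact_operator B"
    unfolding B_def [abs_def] by (intro compact_operator_plus B0_compact B1_compact B2_compact)
  have com0: "A (B0 y) - B0 (A y) = T0 y" for y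
  proof -
    have "D (B0 y) = 0"
      by (rule D_orth) (rule hB0)
    moreover have "B0 (D y) = 0"
      by (rule D_kill [OF B0 B0h])
    ultimately show ?thesis
      using T0_eq by (simp add: A_def op_add [OF B0])
  qed
  have com1: "A (B1 y) - B1 (A y) = T (proj h y)" for y
  proof -
    have AS1: "summable (\<lambda>i. \<langle>y, h i\<rangle> *\<^sub>C A (x i))"
      using op_summable [OF A_bound S1_sum] by (simp add: op_scaleC [OF A_bound])
    have "A (B1 y) = (\<Sum>i. \<langle>y, h i\<rangle> *\<^sub>C A (x i))"
      unfolding B1_def op_suminf [OF A_bound S1_sum] op_scaleC [OF A_bound] ..
    then have "A (B1 y) - B1 (A y) = (\<Sum>i. \<langle>y, h i\<rangle> *\<^sub>C A (x i) - \<langle>A y, h i\<rangle> *\<^sub>C x i)"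
      unfolding B1_def [of "A y"] by (simp add: suminf_diff [OF AS1 S1_sum])
    also have "\<dots> = (\<Sum>i. \<langle>y, h i\<rangle> *\<^sub>C T (h i))"
    proof (rule suminf_cong)
      fix i
      show "\<langle>y, h i\<rangle> *\<^sub>C A (x i) - \<langle>A y, h i\<rangle> *\<^sub>C x i = \<langle>y, h i\<rangle> *\<^sub>C T (h i)"
        unfolding x_eq [symmetric] by (simp add: hA scaleC_diff_right scaleC_scaleC mult.commute)
    qed
    also have "\<dots> = T (proj h y)"
      unfolding proj_def op_suminf [OF T_bound proj_summable [OF h]] op_scaleC [OF T_bound] ..
    finally show ?thesis .
  qed
  have com2: "A (B2 y) - B2 (A y) = proj h (T (P y))" for y
  proof -
    have AS2: "summable (\<lambda>i. \<phi> i y *\<^sub>C A (h i))"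
      using op_summable [OF A_bound S2_sum] by (simp add: op_scaleC [OF A_bound])
    have "A (B2 y) = (\<Sum>i. \<phi> i y *\<^sub>C A (h i))"
      unfolding B2_def op_suminf [OF A_bound S2_sum] op_scaleC [OF A_bound] ..
    then have "A (B2 y) - B2 (A y) = (\<Sum>i. \<phi> i y *\<^sub>C A (h i) - \<phi> i (A y) *\<^sub>C h i)"
      unfolding B2_def [of "A y"] by (simp add: suminf_diff [OF AS2 S2_sum])
    also have "\<dots> = (\<Sum>i. \<langle>T (P y), h i\<rangle> *\<^sub>C h i)"
    proof (rule suminf_cong)
      fix i
      show "\<phi> i y *\<^sub>C A (h i) - \<phi> i (A y) *\<^sub>C h i = \<langle>T (P y), h i\<rangle> *\<^sub>C h i"
        unfolding \<phi>_eq [symmetric] by (simp add: Ah scaleC_diff_left scaleC_scaleC mult.commute)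
    qed
    finally show ?thesis
      by (simp add: proj_def)
  qed
  have "T y = A (B y) - B (A y)" for y
  proof -
    have "A (B y) - B (A y) = (A (B0 y) - B0 (A y)) + (A (B1 y) - B1 (A y)) + (A (B2 y) - B2 (A y))"
      by (simp add: B_def op_add [OF A_bound])
    also have "\<dots> = T (P y) + T (proj h y)"
      unfolding com0 com1 com2 by (simp add: T0_def P_def [of "T _"])
    also have "\<dots> = T y"
      by (simp add: P_def op_diff [OF T_bound])
    finally show ?thesis by simp
  qed
  then show ?thesis
    using A_compact B_compact A_bound B_bound unfolding s_def
    by (intro exI [of _ A] exI [of _ B] conjI allI)
qed

section \<open>Vectors far out with respect to a compact operator\<close>

text \<open>Dependent choice in a form where each step sees just the finite set of earlier
  terms.\<close>

lemma ex_sequence: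
  assumes "\<And>n V. finite V \<Longrightarrow> \<exists>x. P n V x"
  obtains v :: "nat \<Rightarrow> 'a" where "\<And>n. P n (v ` {..<n}) (v n)"
proof -
  define ch where "ch n V = (SOME x. P n V x)" for n V
  have ch: "P n V (ch n V)" if "finite V" for n V
    unfolding ch_def by (rule someI_ex) (rule assms [OF that])
  define S where "S = rec_nat {} (\<lambda>n V. insert (ch n V) V)"
  define v where "v n = ch n (S n)" for n
  have S0: "S 0 = {}" and SS: "S (Suc n) = insert (v n) (S n)" for n
    by (simp_all add: S_def v_def)
  have S: "S n = v ` {..<n}" for n
    by (induction n) (simp_all add: S0 SS lessThan_Suc)
  have "P n (v ` {..<n}) (v n)" for n
    using ch [of "S n" n] unfolding v_def [of n] unfolding S by simp
  then show ?thesis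
    by (rule that)
qed

lemma ex_orthonormal_sequence:
  assumes "infinite_cdim TYPE('a::complex_inner)" "finite (Y :: 'a set)"
  obtains r :: "nat \<Rightarrow> 'a::complex_inner" where "orthosystem r" "\<And>n. norm (r n) = 1" "\<And>n y. y \<in> Y \<Longrightarrow> \<langle>r n, y\<rangle> = 0"
proof -
  have step: "\<exists>x. norm x = 1 \<and> (\<forall>y\<in>V \<union> Y. \<langle>x, y\<rangle> = 0)" if "finite V" for V :: "'a set"
    using that assms(2) by (intro unit_orthogonal_finite [OF assms(1)]) simp
  obtain r :: "nat \<Rightarrow> 'a" where r: "\<And>n. norm (r n) = 1 \<and> (\<forall>y\<in>r ` {..<n} \<union> Y. \<langle>r n, y\<rangle> = 0)"
    by (rule ex_sequence [of "\<lambda>n V x. norm x = 1 \<and> (\<forall>y\<in>V \<union> Y. \<langle>x, y\<rangle> = 0)", OF step], assumption) (rule that)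
  have "\<langle>r m, r n\<rangle> = 0" if "m \<noteq> n" for m n
    using r [of m] r [of n] that cinner_eq_0_commute [of "r m" "r n"]
    by (cases "m < n") auto
  then have "orthosystem r"
    using r by (simp add: orthosystem_def)
  then show ?thesis
    using r by (intro that) auto
qed

locale compact_pair =
  fixes T T' :: "'a::chilbert_space \<Rightarrow> 'a" and \<tau> :: real
  assumes T_compact: "compact_operator T" and T: "op_bound T \<tau>" and T': "op_bound T' \<tau>"
    and adj: "\<langle>T x, y\<rangle> = \<langle>x, T' y\<rangle>" and \<tau>_pos: "\<tau> > 0"
begin

lemma adj': "\<langle>T' x, y\<rangle> = \<langle>x, T y\<rangle>"
  by (metis adj cinner_commute)

fun reach :: "nat \<Rightarrow> 'a set \<Rightarrow> 'a set" where
  "reach 0 Y = Y"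
| "reach (Suc k) Y = reach k Y \<union> T ` reach k Y \<union> T' ` reach k Y"

text \<open>Orthogonality to everything obtained from \<open>Y\<close> by at most \<open>k\<close>
  applications of \<open>T\<close> and its adjoint. Applying either one to \<open>x\<close> costs
  one level.\<close>

definition far :: "nat \<Rightarrow> 'a set \<Rightarrow> 'a \<Rightarrow> bool" where
  "far k Y x \<longleftrightarrow> (\<forall>y\<in>reach k Y. \<langle>x, y\<rangle> = 0)"

lemma finite_reach: "finite Y \<Longrightarrow> finite (reach k Y)"
  by (induction k) auto

lemma reach_mono: "Y \<subseteq> Z \<Longrightarrow> reach k Y \<subseteq> reach k Z"
  by (induction k) auto

lemma reach_le: "k \<le> l \<Longrightarrow> reach k Y \<subseteq> reach l Y"
  by (induction l) (auto simp: le_Suc_eq)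

lemma far_subset: "far k Y x \<Longrightarrow> Z \<subseteq> Y \<Longrightarrow> far k Z x"
  unfolding far_def using reach_mono by blast

lemma far_le: "far l Y x \<Longrightarrow> k \<le> l \<Longrightarrow> far k Y x"
  unfolding far_def using reach_le by blast

lemma far_T: "far (Suc k) Y x \<Longrightarrow> far k Y (T x)"
  by (auto simp: far_def adj)

lemma far_T': "far (Suc k) Y x \<Longrightarrow> far k Y (T' x)"
  by (auto simp: far_def adj')

lemma far_add: "far k Y x \<Longrightarrow> far k Y y \<Longrightarrow> far k Y (x + y)"
  by (simp add: far_def cinner_add_left)

lemma far_scaleC: "far k Y x \<Longrightarrow> far k Y (c *\<^sub>C x)"
  by (simp add: far_def cinner_scaleC_left)

lemma far_zero: "far k Y 0"
  by (simp add: far_def)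

text \<open>The image of a unit vector \<open>x\<close> is within \<epsilon> of some net point
  \<open>y\<close>. If \<open>T x\<close> is orthogonal to the net, then
  \<open>\<langle>T x, T x\<rangle> = \<langle>T x - y, T x\<rangle>\<close> is small. For the
  adjoint, \<open>\<langle>T (T' x), x\<rangle>\<close> is used in the same way, with
  \<open>x\<close> itself orthogonal to the net.\<close>

lemma small_net:
  assumes "\<epsilon> > 0"
  shows "\<exists>F. finite F \<and> (\<forall>x. far 1 F x \<longrightarrow> norm (T x) \<le> \<epsilon> * norm x \<and> norm (T' x) \<le> \<epsilon> * norm x)"
proof -
  obtain F where F: "finite F" "\<And>x. norm x \<le> 1 \<Longrightarrow> \<exists>y\<in>F. norm (T x - y) < \<epsilon>"
    using compact_operator_net [OF T_compact assms] by blast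
  have key: "cmod \<langle>T x, z\<rangle> \<le> \<epsilon> * norm x * norm z" if z: "\<And>y. y \<in> F \<Longrightarrow> \<langle>z, y\<rangle> = 0" for x z
  proof (cases "x = 0")
    case True
    then show ?thesis by (simp add: op_zero [OF T])
  next
    case False
    define u where "u = complex_of_real (inverse (norm x)) *\<^sub>C x"
    have u: "norm u = 1" "x = complex_of_real (norm x) *\<^sub>C u"
      using False by (simp_all add: u_def scaleC_scaleC norm_inverse)
    obtain y where y: "y \<in> F" "norm (T u - y) < \<epsilon>"
      using F(2) [of u] u(1) by auto
    have "\<langle>y, z\<rangle> = 0"
      using z [OF y(1)] cinner_eq_0_commute by blast
    then have "cmod \<langle>T u, z\<rangle> = cmod \<langle>T u - y, z\<rangle>"
      by (simp add: cinner_diff_left)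
    also have "\<dots> \<le> norm (T u - y) * norm z"
      by (rule cmod_cinner_le)
    also have "\<dots> \<le> \<epsilon> * norm z"
      using y(2) by (intro mult_right_mono) auto
    finally have "norm x * cmod \<langle>T u, z\<rangle> \<le> norm x * (\<epsilon> * norm z)"
      by (rule mult_left_mono) simp
    moreover have "cmod \<langle>T x, z\<rangle> = norm x * cmod \<langle>T u, z\<rangle>"
      by (subst u(2)) (simp add: op_scaleC [OF T] cinner_scaleC_left norm_mult)
    ultimately show ?thesis by (simp add: mult_ac)
  qed
  have "norm (T x) \<le> \<epsilon> * norm x" if "far 1 F x" for x
  proof (cases "T x = 0")
    case False
    have "far 0 F (T x)"
      using far_T [of 0 F x] that by simp
    then have "cmod \<langle>T x, T x\<rangle> \<le> \<epsilon> * norm x * norm (T x)"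
      by (intro key) (simp add: far_def)
    then show ?thesis
      using False unfolding cinner_self norm_of_real by (simp add: power2_eq_square)
  qed (use assms in simp)
  moreover have "norm (T' x) \<le> \<epsilon> * norm x" if "far 1 F x" for x
  proof (cases "T' x = 0")
    case False
    have "far 0 F x"
      using far_le [OF that, of 0] by simp
    then have "cmod \<langle>T (T' x), x\<rangle> \<le> \<epsilon> * norm (T' x) * norm x"
      by (intro key) (simp add: far_def)
    then show ?thesis
      using False unfolding adj cinner_self norm_of_real by (simp add: power2_eq_square mult_ac)
  qed (use assms in simp)
  ultimately show ?thesis
    using F(1) by blast
qed

text \<open>For a unit vector these are the Rayleigh quotient and the component of the image
  orthogonal to the vector.\<close>

definition quot :: "'a \<Rightarrow> complex" where "quot v = \<langle>T v, v\<rangle>"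
definition perp :: "'a \<Rightarrow> 'a" where "perp v = T v - quot v *\<^sub>C v"

text \<open>
  The idea: add a small multiple of \<open>b\<close> to a vector further out, so that the image is dominated by
  the image of \<open>b\<close>, but not the vector itself.
\<close>

lemma ex_good_vector:
  assumes inf: "infinite_cdim TYPE('a)" and nd: "\<And>Y. finite Y \<Longrightarrow> \<exists>x. (\<forall>y\<in>Y. \<langle>x, y\<rangle> = 0) \<and> T x \<noteq> 0"
    and "finite Y" and "\<delta> > 0"
  obtains v where "norm v = 1" "far k Y v" "perp v \<noteq> 0" "cmod (quot v) \<le> \<delta> * norm (perp v)"
proof -
  obtain b0 where b0: "\<forall>y\<in>reach k Y. \<langle>b0, y\<rangle> = 0" "T b0 \<noteq> 0"
    using nd [OF finite_reach [OF \<open>finite Y\<close>]] by blast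
  have "b0 \<noteq> 0"
    using b0(2) op_zero [OF T] by auto
  define b where "b = complex_of_real (inverse (norm b0)) *\<^sub>C b0"
  have b: "norm b = 1" "far k Y b" "T b \<noteq> 0"
    using b0 \<open>b0 \<noteq> 0\<close> op_scaleC [OF T, of "complex_of_real (inverse (norm b0))" b0]
    by (auto simp: b_def far_def cinner_scaleC_left norm_inverse complex_vector.scale_eq_0_iff simp del: of_real_inverse)
  define t where "t = norm (T b)"
  have "t > 0" using b(3) by (simp add: t_def)
  \<comment> \<open>For \<open>v = d b + \<rho> b'\<close> the image has size about
    \<open>d * t\<close>, while the quotient is at most \<open>2 * d\<^sup>2 * t\<close>. The bound
    \<open>1 / 6\<close> leaves \<open>d * t / 2\<close> for \<open>perp v\<close>, and then
    \<delta> / 4 gives the required ratio.\<close>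
  define d where "d = min (\<delta> / 4) (1 / 6)"
  have d: "d > 0" "d \<le> \<delta> / 4" "d \<le> 1 / 6"
    using \<open>\<delta> > 0\<close> by (auto simp: d_def)
  have "d\<^sup>2 * t > 0" using d(1) \<open>t > 0\<close> by simp
  obtain F where F: "finite F" "\<forall>x. far 1 F x \<longrightarrow>
      norm (T x) \<le> d\<^sup>2 * t * norm x \<and> norm (T' x) \<le> d\<^sup>2 * t * norm x"
    using small_net [OF \<open>d\<^sup>2 * t > 0\<close>] by (elim exE conjE) (rule that)
  have fin: "finite (reach k Y \<union> {b, T b, T' b} \<union> reach 1 F)"
    using finite_reach [OF \<open>finite Y\<close>, of k] finite_reach [OF F(1), of 1]
    by (simp only: finite_Un finite_insert finite.emptyI)
  obtain b' where b': "norm b' = 1"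
    and b'_orth: "\<forall>y\<in>reach k Y \<union> {b, T b, T' b} \<union> reach 1 F. \<langle>b', y\<rangle> = 0"
    using unit_orthogonal_finite [OF inf fin] by (elim exE conjE) (rule that)
  have o: "\<langle>b', b\<rangle> = 0" "\<langle>b, b'\<rangle> = 0" "\<langle>T b', b\<rangle> = 0" "\<langle>T b, b'\<rangle> = 0"
    using b'_orth cinner_eq_0_commute [of b b'] cinner_eq_0_commute [of "T b" b'] by (auto simp: adj)
  have "far 1 F b'"
    unfolding far_def using b'_orth by blast
  then have Tb': "norm (T b') \<le> d\<^sup>2 * t"
    using F(2) b' by auto
  define \<rho> where "\<rho> = sqrt (1 - d\<^sup>2)"
  have d2: "d\<^sup>2 \<le> 1"
    using power_mono [of d 1 2] d by simp
  have \<rho>: "0 \<le> \<rho>" "\<rho> \<le> 1" "\<rho>\<^sup>2 = 1 - d\<^sup>2"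
    using d2 by (simp_all add: \<rho>_def)
  define v where "v = complex_of_real d *\<^sub>C b + complex_of_real \<rho> *\<^sub>C b'"
  have "(norm v)\<^sup>2 = 1"
    unfolding v_def using o d(1) \<rho> b(1) b'
    by (subst norm_add_orthogonal) (auto simp: cinner_simps)
  then have v1: "norm v = 1"
    by (intro power2_eq_imp_eq [of "norm v" 1]) simp_all
  have Tv: "T v = complex_of_real d *\<^sub>C T b + complex_of_real \<rho> *\<^sub>C T b'"
    by (simp add: v_def op_add [OF T] op_scaleC [OF T])
  have quot_eq: "quot v = complex_of_real (d\<^sup>2) * \<langle>T b, b\<rangle> + complex_of_real (\<rho>\<^sup>2) * \<langle>T b', b'\<rangle>"
    unfolding quot_def Tv unfolding v_def using o by (simp add: cinner_simps power2_eq_square mult_ac)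
  have quot_le: "cmod (quot v) \<le> 2 * (d\<^sup>2 * t)"
  proof -
    have "cmod \<langle>T b, b\<rangle> \<le> t"
      using cmod_cinner_le [of "T b" b] b(1) by (simp add: t_def)
    then have 1: "cmod (complex_of_real (d\<^sup>2) * \<langle>T b, b\<rangle>) \<le> d\<^sup>2 * t"
      unfolding norm_mult norm_of_real by (simp add: mult_left_mono)
    have "cmod \<langle>T b', b'\<rangle> \<le> d\<^sup>2 * t"
      using cmod_cinner_le [of "T b'" b'] b' Tb' by simp
    moreover have "\<rho>\<^sup>2 \<le> 1"
      using \<rho>(3) by simp
    ultimately have "\<rho>\<^sup>2 * cmod \<langle>T b', b'\<rangle> \<le> 1 * (d\<^sup>2 * t)"
      by (intro mult_mono) auto
    then have 2: "cmod (complex_of_real (\<rho>\<^sup>2) * \<langle>T b', b'\<rangle>) \<le> d\<^sup>2 * t"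
      unfolding norm_mult norm_of_real by simp
    from 1 2 show ?thesis
      unfolding quot_eq
      using norm_triangle_ineq [of "complex_of_real (d\<^sup>2) * \<langle>T b, b\<rangle>" "complex_of_real (\<rho>\<^sup>2) * \<langle>T b', b'\<rangle>"]
      by linarith
  qed
  have "norm (T v) \<ge> d * t - d\<^sup>2 * t"
  proof -
    have "norm (complex_of_real \<rho> *\<^sub>C T b') \<le> 1 * (d\<^sup>2 * t)"
      unfolding norm_scaleC using \<rho> Tb' by (intro mult_mono) auto
    moreover have "norm (complex_of_real d *\<^sub>C T b) = d * t"
      using d(1) by (simp add: t_def)
    ultimately show ?thesis
      unfolding Tv using norm_diff_ineq [of "complex_of_real d *\<^sub>C T b" "complex_of_real \<rho> *\<^sub>C T b'"] by linarith
  qed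
  moreover have "norm (perp v) \<ge> norm (T v) - cmod (quot v)"
    unfolding perp_def using norm_triangle_ineq2 [of "T v" "quot v *\<^sub>C v"] v1 by simp
  moreover have "d\<^sup>2 * t \<le> d * t / 6"
    using mult_right_mono [OF d(3), of "d * t"] d(1) \<open>t > 0\<close> by (simp add: power2_eq_square)
  ultimately have perp_ge: "norm (perp v) \<ge> d * t / 2"
    using quot_le by linarith
  have dt: "d * t > 0" using d(1) \<open>t > 0\<close> by simp
  have "cmod (quot v) \<le> 4 * d * (d * t / 2)"
    using quot_le by (simp add: power2_eq_square)
  also have "\<dots> \<le> \<delta> * (d * t / 2)"
    using d dt by (intro mult_right_mono) auto
  also have "\<dots> \<le> \<delta> * norm (perp v)"
    using perp_ge \<open>\<delta> > 0\<close> by (intro mult_left_mono) auto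
  finally have "cmod (quot v) \<le> \<delta> * norm (perp v)" .
  moreover have "perp v \<noteq> 0"
    using perp_ge dt by auto
  moreover have "far k Y b'"
    unfolding far_def using b'_orth by blast
  then have "far k Y v"
    unfolding v_def using b(2) by (intro far_add far_scaleC)
  ultimately show ?thesis
    using v1 that by blast
qed

text \<open>Each vector comes with a net and a threshold adapted to the earlier vectors. The
  threshold must be small against their \<open>perp\<close>, since the shear divides by the
  \<open>perp\<close> of an earlier vector. Eight levels cover all the applications of
  \<open>T\<close> and its adjoint made later.\<close>

lemma ex_far_sequence:
  fixes \<eta> :: "nat \<Rightarrow> real"
  assumes inf: "infinite_cdim TYPE('a)" and nd: "\<And>Y. finite Y \<Longrightarrow> \<exists>x. (\<forall>y\<in>Y. \<langle>x, y\<rangle> = 0) \<and> T x \<noteq> 0"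
    and \<eta>: "\<And>n. \<eta> n > 0"
  shows "\<exists>(v :: nat \<Rightarrow> 'a) F \<epsilon>. \<forall>n. norm (v n) = 1 \<and> perp (v n) \<noteq> 0 \<and> cmod (quot (v n)) \<le> \<eta> n * norm (perp (v n)) \<and>
    far 8 (v ` {..<n} \<union> F n) (v n) \<and> \<epsilon> n \<le> \<eta> n \<and> (\<forall>m<n. \<epsilon> n \<le> \<eta> n * norm (perp (v m))) \<and>
    (\<forall>x. far 1 (F n) x \<longrightarrow> norm (T x) \<le> \<epsilon> n * norm x \<and> norm (T' x) \<le> \<epsilon> n * norm x)"
proof -
  define good where "good n V x F \<epsilon> \<longleftrightarrow> norm x = 1 \<and> perp x \<noteq> 0 \<and> cmod (quot x) \<le> \<eta> n * norm (perp x) \<and>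
    far 8 (V \<union> F) x \<and> \<epsilon> \<le> \<eta> n \<and> (\<forall>w\<in>V. perp w \<noteq> 0 \<longrightarrow> \<epsilon> \<le> \<eta> n * norm (perp w)) \<and>
    (\<forall>x. far 1 F x \<longrightarrow> norm (T x) \<le> \<epsilon> * norm x \<and> norm (T' x) \<le> \<epsilon> * norm x)" for n V x F \<epsilon>
  have step: "\<exists>x F \<epsilon>. good n V x F \<epsilon>" if "finite V" for n V
  proof -
    \<comment> \<open>The element \<open>1\<close> keeps the set nonempty and yields
      \<open>\<epsilon> \<le> \<eta> n\<close>.\<close>
    define M where "M = insert 1 ((\<lambda>w. norm (perp w)) ` {w \<in> V. perp w \<noteq> 0})"
    define \<epsilon> where "\<epsilon> = \<eta> n * Min M"
    have M: "finite M" "M \<noteq> {}" "\<And>m. m \<in> M \<Longrightarrow> m > 0"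
      using that by (auto simp: M_def)
    then have "Min M > 0" by simp
    then have "\<epsilon> > 0" using \<eta> by (simp add: \<epsilon>_def)
    obtain F where F: "finite F" "\<forall>x. far 1 F x \<longrightarrow>
        norm (T x) \<le> \<epsilon> * norm x \<and> norm (T' x) \<le> \<epsilon> * norm x"
      using small_net [OF \<open>\<epsilon> > 0\<close>] by (elim exE conjE) (rule that)
    have fin: "finite (V \<union> F)" using that F(1) by simp
    obtain x where x: "norm x = 1" "far 8 (V \<union> F) x" "perp x \<noteq> 0" "cmod (quot x) \<le> \<eta> n * norm (perp x)"
      by (rule ex_good_vector [OF inf nd fin \<eta>])
    have le: "\<epsilon> \<le> \<eta> n * m" if "m \<in> M" for m
      unfolding \<epsilon>_def using \<eta> [of n] Min_le [OF M(1) that] by (intro mult_left_mono) auto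
    have "\<epsilon> \<le> \<eta> n"
      using le [of 1] by (simp add: M_def)
    moreover have "\<epsilon> \<le> \<eta> n * norm (perp w)" if "w \<in> V" "perp w \<noteq> 0" for w
      using that by (intro le) (auto simp: M_def)
    ultimately show ?thesis
      unfolding good_def using x F by blast
  qed
  obtain v where v: "\<And>n. \<exists>F \<epsilon>. good n (v ` {..<n}) (v n) F \<epsilon>"
    by (rule ex_sequence [of "\<lambda>n V x. \<exists>F \<epsilon>. good n V x F \<epsilon>", OF step], assumption) (rule that)
  then obtain F \<epsilon> where "\<And>n. good n (v ` {..<n}) (v n) (F n) (\<epsilon> n)"
    by metis
  then show ?thesis
    unfolding good_def by (intro exI [of _ v] exI [of _ F] exI [of _ \<epsilon>]) auto
qed

end

section \<open>A triangular change of coordinates\<close>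

text \<open>
  The \<open>j\<close>-th group consists of four consecutive vectors of the sequence: two partners
  \<open>G (2 * j)\<close> and \<open>G (2 * j + 1)\<close>, a spare vector, and \<open>a j\<close>. A shear \<open>1 - N\<close>
  turns \<open>T\<close> into an operator that maps \<open>a j\<close>, from either side, into the span of
  \<open>F (2 * j)\<close> and \<open>F (2 * j + 1)\<close>. It also moves the diagonal entry at \<open>F i\<close>, with the
  opposite sign, to \<open>G i\<close>, so that \<open>F i + G i\<close> and \<open>F i - G i\<close> have vanishing diagonal
  entries.
\<close>

locale far_family = compact_pair T T' \<tau> for T T' :: "'a::chilbert_space \<Rightarrow> 'a" and \<tau> :: real +
  fixes v :: "nat \<Rightarrow> 'a" and net :: "nat \<Rightarrow> 'a set" and \<epsilon> \<eta> :: "nat \<Rightarrow> real"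
  assumes v_norm: "norm (v n) = 1" and v_perp: "perp (v n) \<noteq> 0"
    and v_quot: "cmod (quot (v n)) \<le> \<eta> n * norm (perp (v n))"
    and v_far: "far 8 (v ` {..<n} \<union> net n) (v n)" and \<epsilon>_le: "\<epsilon> n \<le> \<eta> n"
    and \<epsilon>_perp: "m < n \<Longrightarrow> \<epsilon> n \<le> \<eta> n * norm (perp (v m))"
    and small: "far 1 (net n) x \<Longrightarrow> norm (T x) \<le> \<epsilon> n * norm x"
    and small': "far 1 (net n) x \<Longrightarrow> norm (T' x) \<le> \<epsilon> n * norm x"
    and \<eta>_pos: "\<eta> n > 0" and \<eta>_geo: "\<eta> n \<le> (1 / 2) ^ n / 16"
    and \<eta>_coupling: "m \<le> 2 * n + 1 \<Longrightarrow> 6 * \<eta> n \<le> coupling_bound (4 * \<tau>) m"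
begin

section \<open>Level spaces around the vectors of the sequence\<close>

definition lev :: "nat \<Rightarrow> nat \<Rightarrow> 'a set" where "lev n k = complex_vector.span (reach k {v n})"

lemma v_lev: "v n \<in> lev n k"
  unfolding lev_def using reach_le [of 0 k "{v n}"] by (intro complex_vector.span_base) auto

lemma lev_le: "x \<in> lev n k \<Longrightarrow> k \<le> l \<Longrightarrow> x \<in> lev n l"
  unfolding lev_def using complex_vector.span_mono [OF reach_le] by blast

lemma lev_add: "x \<in> lev n k \<Longrightarrow> y \<in> lev n k \<Longrightarrow> x + y \<in> lev n k"
  and lev_diff: "x \<in> lev n k \<Longrightarrow> y \<in> lev n k \<Longrightarrow> x - y \<in> lev n k"
  and lev_scaleC: "x \<in> lev n k \<Longrightarrow> c *\<^sub>C x \<in> lev n k"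
  unfolding lev_def
  by (auto intro: complex_vector.span_add complex_vector.span_diff complex_vector.span_scale)

lemma lev_image:
  assumes S: "op_bound S L" and sub: "S ` reach k {v n} \<subseteq> reach (Suc k) {v n}" and x: "x \<in> lev n k"
  shows "S x \<in> lev n (Suc k)"
  using x unfolding lev_def
proof (induction rule: complex_vector.span_induct_alt)
  case base
  show ?case
    by (simp add: op_zero [OF S] complex_vector.span_zero)
next
  case (step c x y)
  have "S x \<in> reach (Suc k) {v n}"
    using step(1) sub by blast
  then show ?case
    unfolding op_add [OF S] op_scaleC [OF S]
    by (intro complex_vector.span_add complex_vector.span_scale complex_vector.span_base step(2))
qed

lemma lev_T: "x \<in> lev n k \<Longrightarrow> T x \<in> lev n (Suc k)"
  by (rule lev_image [OF T]) auto

lemma lev_T': "x \<in> lev n k \<Longrightarrow> T' x \<in> lev n (Suc k)"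
  by (rule lev_image [OF T']) auto

lemma lev_far:
  assumes "x \<in> lev n k" "k \<le> 8"
  shows "far (8 - k) (v ` {..<n} \<union> net n) x"
proof -
  have gen: "far (8 - k) (v ` {..<n} \<union> net n) y" if "y \<in> reach k {v n}" "k \<le> 8" for y k
    using that
  proof (induction k arbitrary: y)
    case 0
    then show ?case using v_far by simp
  next
    case (Suc k)
    then have IH: "far (Suc (8 - Suc k)) (v ` {..<n} \<union> net n) z" if "z \<in> reach k {v n}" for z
    proof -
      have "Suc (8 - Suc k) = 8 - k"
        using Suc.prems(2) by simp
      then show ?thesis
        using Suc.IH [OF that] Suc.prems(2) by simp
    qed
    from Suc.prems(1) consider "y \<in> reach k {v n}" | z where "z \<in> reach k {v n}" "y = T z"
      | z where "z \<in> reach k {v n}" "y = T' z"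
      by auto
    then show ?case
    proof cases
      case 1
      then show ?thesis using far_le [OF IH] by simp
    next
      case 2
      then show ?thesis using far_T [OF IH] by simp
    next
      case 3
      then show ?thesis using far_T' [OF IH] by simp
    qed
  qed
  show ?thesis
    using assms(1) unfolding lev_def
  proof (induction rule: complex_vector.span_induct_alt)
    case base
    show ?case by (rule far_zero)
  next
    case (step c x y)
    then show ?case
      using gen [OF step(1) assms(2)] by (intro far_add far_scaleC)
  qed
qed

text \<open>All applications of \<open>T\<close> and its adjoint can be moved to the vector with the
  larger index, so only the sum of the levels counts.\<close>

lemma lev_orth:
  assumes "n \<noteq> m" "x \<in> lev n k" "y \<in> lev m l" "k + l \<le> 8"
  shows "\<langle>x, y\<rangle> = 0"
proof -
  have main: "\<langle>x, y\<rangle> = 0" if "m < n" "x \<in> lev n k" "y \<in> lev m l" "k + l \<le> 8" for n m x y k l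
  proof -
    have "far (8 - k) (v ` {..<n} \<union> net n) x"
      by (rule lev_far [OF that(2)]) (use that(4) in simp)
    then have "far (8 - k) {v m} x"
      by (rule far_subset) (use that(1) in blast)
    then have far: "far l {v m} x"
      by (rule far_le) (use that(4) in simp)
    show ?thesis
    proof (rule cinner_span_eq_0)
      show "y \<in> complex_vector.span (reach l {v m})"
        using that(3) by (simp add: lev_def)
      show "\<langle>x, y'\<rangle> = 0" if "y' \<in> reach l {v m}" for y'
        using far that by (simp add: far_def)
    qed
  qed
  show ?thesis
  proof (cases "m < n")
    case True
    then show ?thesis using main assms by blast
  next
    case False
    then have "\<langle>y, x\<rangle> = 0"
      using main [of n m y l x k] assms by (simp add: add.commute)
    then show ?thesis using cinner_eq_0_commute by blast
  qed
qed

text \<open>The third bound is what makes \<open>z i\<close> small: its definition divides by the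
  square of \<open>norm (perp (G i))\<close>.\<close>

lemma lev_small:
  assumes "x \<in> lev n k" "k \<le> 7"
  shows "norm (T x) \<le> \<eta> n * norm x" "norm (T' x) \<le> \<eta> n * norm x"
    "m < n \<Longrightarrow> norm (T x) \<le> \<eta> n * norm (perp (v m)) * norm x"
proof -
  have "far (8 - k) (v ` {..<n} \<union> net n) x"
    by (rule lev_far [OF assms(1)]) (use assms(2) in simp)
  then have "far (8 - k) (net n) x"
    by (rule far_subset) blast
  then have far: "far 1 (net n) x"
    by (rule far_le) (use assms(2) in simp)
  show "norm (T x) \<le> \<eta> n * norm x" "norm (T' x) \<le> \<eta> n * norm x"
    using small [OF far] small' [OF far] mult_right_mono [OF \<epsilon>_le [of n], of "norm x"] by auto
  show "norm (T x) \<le> \<eta> n * norm (perp (v m)) * norm x" if "m < n"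
    using small [OF far] mult_right_mono [OF \<epsilon>_perp [OF that] norm_ge_zero, of x] by linarith
qed

lemma cinner_v_self: "\<langle>v n, v n\<rangle> = 1"
  by (simp add: cinner_self v_norm)

lemma cinner_perp: "\<langle>perp (v n), v n\<rangle> = 0" "\<langle>v n, perp (v n)\<rangle> = 0"
proof -
  show "\<langle>perp (v n), v n\<rangle> = 0"
    by (simp add: perp_def quot_def cinner_simps cinner_v_self)
  then show "\<langle>v n, perp (v n)\<rangle> = 0"
    using cinner_eq_0_commute by blast
qed

lemma perp_lev: "perp (v n) \<in> lev n 1"
proof -
  have "T (v n) \<in> lev n 1"
    using lev_T [OF v_lev [of n 0]] by simp
  then show ?thesis
    unfolding perp_def by (intro lev_diff lev_scaleC v_lev)
qed

section \<open>The vectors of one group and their orthogonality relations\<close>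

definition a :: "nat \<Rightarrow> 'a" where "a j = v (4 * j + 3)"
definition pn :: "nat \<Rightarrow> real" where "pn j = norm (perp (a j))"
definition f1 :: "nat \<Rightarrow> 'a" where "f1 j = complex_of_real (1 / pn j) *\<^sub>C perp (a j)"
definition ratio :: "nat \<Rightarrow> complex" where "ratio j = quot (a j) / complex_of_real (pn j)"
text \<open>The multiple of \<open>f1 j\<close> that makes \<open>a j + w j\<close> orthogonal to
  \<open>T (a j)\<close>. Then \<open>T' (a j + w j)\<close> is orthogonal to \<open>a j\<close>,
  and its component \<open>u j\<close> off \<open>f1 j\<close> supplies the second
  direction.\<close>

definition w :: "nat \<Rightarrow> 'a" where "w j = (- cnj (ratio j)) *\<^sub>C f1 j"
definition u :: "nat \<Rightarrow> 'a" where "u j = T' (a j + w j) - \<langle>T' (a j + w j), f1 j\<rangle> *\<^sub>C f1 j"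
text \<open>If there is no second direction, the spare vector of the group takes its place, so that
  every \<open>F i\<close> is a unit vector.\<close>

definition f2 :: "nat \<Rightarrow> 'a" where
  "f2 j = (if u j = 0 then v (4 * j + 2) else complex_of_real (1 / norm (u j)) *\<^sub>C u j)"

definition F :: "nat \<Rightarrow> 'a" where "F i = (if even i then f1 (i div 2) else f2 (i div 2))"
text \<open>The index of the member of the sequence around which \<open>F i\<close> lives: offset
  \<open>3\<close> in its group, or \<open>2\<close> if the spare vector is used.\<close>

definition Fi :: "nat \<Rightarrow> nat" where
  "Fi i = (if odd i \<and> u (i div 2) = 0 then 4 * (i div 2) + 2 else 4 * (i div 2) + 3)"
definition Gi :: "nat \<Rightarrow> nat" where "Gi i = (if even i then 4 * (i div 2) else 4 * (i div 2) + 1)"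
definition G :: "nat \<Rightarrow> 'a" where "G i = v (Gi i)"

text \<open>This is \<open>F i - N (F i)\<close>, with \<open>N\<close> as defined below.\<close>

definition Fh :: "nat \<Rightarrow> 'a" where
  "Fh i = (if even i then f1 (i div 2) + ratio (i div 2) *\<^sub>C a (i div 2) else f2 (i div 2))"

text \<open>The multiple of \<open>perp (G i)\<close> with \<open>\<langle>T (G i), z i\<rangle> = -
  (quot (G i) + \<langle>T (Fh i), F i\<rangle>)\<close>. It removes the diagonal entry at
  \<open>G i\<close> and puts the negative of the one at \<open>F i\<close> there.\<close>

definition z :: "nat \<Rightarrow> 'a" where
  "z i = cnj (- (quot (G i) + \<langle>T (Fh i), F i\<rangle>) / complex_of_real ((norm (perp (G i)))\<^sup>2)) *\<^sub>C perp (G i)"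

lemma pn_pos: "pn j > 0"
  using v_perp by (simp add: pn_def a_def)

lemma a_lev: "a j \<in> lev (4 * j + 3) k"
  unfolding a_def by (rule v_lev)

lemma f1_lev: "f1 j \<in> lev (4 * j + 3) 1"
  unfolding f1_def a_def by (intro lev_scaleC perp_lev)

lemma w_lev: "w j \<in> lev (4 * j + 3) 1"
  unfolding w_def by (intro lev_scaleC f1_lev)

lemma u_lev: "u j \<in> lev (4 * j + 3) 2"
proof -
  have "T' (a j + w j) \<in> lev (4 * j + 3) (Suc 1)"
    by (intro lev_T' lev_add a_lev w_lev)
  then have "T' (a j + w j) \<in> lev (4 * j + 3) 2"
    by (simp add: numeral_2_eq_2)
  then show ?thesis
    unfolding u_def using lev_le [OF f1_lev] by (intro lev_diff lev_scaleC) auto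
qed

lemma norm_a: "norm (a j) = 1" and cinner_a: "\<langle>a j, a j\<rangle> = 1"
  by (simp_all add: a_def v_norm cinner_v_self)

lemma norm_f1: "norm (f1 j) = 1" and cinner_f1: "\<langle>f1 j, f1 j\<rangle> = 1"
proof -
  show "norm (f1 j) = 1"
    using pn_pos [of j] by (simp add: f1_def norm_divide) (simp add: pn_def)
  then show "\<langle>f1 j, f1 j\<rangle> = 1"
    by (simp add: cinner_self)
qed

lemma f1_a: "\<langle>f1 j, a j\<rangle> = 0" "\<langle>a j, f1 j\<rangle> = 0"
  by (simp_all add: f1_def cinner_simps a_def cinner_perp)

lemma T_a: "T (a j) = quot (a j) *\<^sub>C a j + complex_of_real (pn j) *\<^sub>C f1 j"
proof -
  have "complex_of_real (pn j) *\<^sub>C f1 j = perp (a j)"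
    using pn_pos [of j] by (simp add: f1_def scaleC_scaleC flip: of_real_mult)
  then show ?thesis
    by (simp add: perp_def)
qed

lemma f1_w: "\<langle>f1 j, w j\<rangle> = - ratio j"
  by (simp add: w_def cinner_simps cinner_f1)

lemma pn_ratio: "complex_of_real (pn j) * ratio j = quot (a j)"
  using pn_pos [of j] by (simp add: ratio_def)

lemma cmod_ratio: "cmod (ratio j) \<le> \<eta> (4 * j + 3)"
  using v_quot [of "4 * j + 3"] pn_pos [of j]
  by (simp add: ratio_def norm_divide a_def pn_def divide_le_eq)

lemma norm_w: "norm (w j) \<le> \<eta> (4 * j + 3)"
  using cmod_ratio by (simp add: w_def norm_f1)

lemma a_w: "\<langle>a j, w k\<rangle> = 0"
proof (cases "j = k")
  case True
  then show ?thesis by (simp add: w_def cinner_simps f1_a)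
next
  case False
  then show ?thesis by (intro lev_orth [OF _ a_lev w_lev]) auto
qed

lemma u_f1: "\<langle>u j, f1 j\<rangle> = 0"
  by (simp add: u_def cinner_diff_left cinner_scaleC_left cinner_f1)

lemma u_a: "\<langle>u j, a j\<rangle> = 0"
proof -
  have "\<langle>a j + w j, T (a j)\<rangle> = 0"
  proof -
    have "\<langle>T (a j), a j + w j\<rangle> = 0"
      by (simp add: T_a cinner_add_left cinner_add_right cinner_scaleC_left cinner_a a_w f1_a f1_w pn_ratio)
    then show ?thesis using cinner_eq_0_commute by blast
  qed
  then show ?thesis
    by (simp add: u_def cinner_diff_left cinner_scaleC_left adj' f1_a)
qed

lemma norm_f2: "norm (f2 j) = 1"
  by (simp add: f2_def v_norm norm_divide)

lemma f2_orth: "\<langle>f2 j, f1 j\<rangle> = 0" "\<langle>f2 j, a j\<rangle> = 0"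
proof -
  have "\<langle>v (4 * j + 2), f1 j\<rangle> = 0"
    by (rule lev_orth [OF _ v_lev f1_lev, of _ _ 0]) auto
  then show "\<langle>f2 j, f1 j\<rangle> = 0"
    by (simp add: f2_def cinner_scaleC_left u_f1)
  have "\<langle>v (4 * j + 2), a j\<rangle> = 0"
    by (rule lev_orth [OF _ v_lev a_lev, of _ _ 0 0]) auto
  then show "\<langle>f2 j, a j\<rangle> = 0"
    by (simp add: f2_def cinner_scaleC_left u_a)
qed

lemma T'_aw: "T' (a j + w j) = \<langle>T' (a j + w j), f1 j\<rangle> *\<^sub>C f1 j + complex_of_real (norm (u j)) *\<^sub>C f2 j"
proof -
  have "complex_of_real (norm (u j)) *\<^sub>C f2 j = u j"
    by (simp add: f2_def scaleC_scaleC flip: of_real_mult)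
  then show ?thesis
    by (simp add: u_def)
qed

lemma F_lev: "F i \<in> lev (Fi i) 2"
proof -
  have "f1 j \<in> lev (4 * j + 3) 2" for j
    using lev_le [OF f1_lev] by simp
  then show ?thesis
    unfolding F_def Fi_def f2_def using u_lev v_lev lev_scaleC by auto
qed

lemma Fh_lev: "Fh i \<in> lev (Fi i) 2"
proof (cases "even i")
  case True
  have "f1 j + ratio j *\<^sub>C a j \<in> lev (4 * j + 3) 2" for j
    using lev_le [OF f1_lev] by (intro lev_add lev_scaleC a_lev) simp
  with True show ?thesis by (simp add: Fh_def Fi_def)
next
  case False
  then show ?thesis using F_lev [of i] by (simp add: Fh_def F_def)
qed

lemma norm_F: "norm (F i) = 1" and norm_G: "norm (G i) = 1"
  by (simp_all add: F_def G_def norm_f1 norm_f2 v_norm)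

lemma G_lev: "G i \<in> lev (Gi i) k"
  unfolding G_def by (rule v_lev)

lemma z_lev: "z i \<in> lev (Gi i) 1"
  unfolding z_def G_def by (intro lev_scaleC perp_lev)

lemma Gi_eq: "Gi i + i mod 2 = 2 * i"
  unfolding Gi_def by (auto elim!: evenE oddE)

lemma Gi_inj: "Gi i = Gi k \<longleftrightarrow> i = k"
proof
  assume "Gi i = Gi k"
  moreover have "i mod 2 < 2" "k mod 2 < 2" by simp_all
  ultimately show "i = k"
    using Gi_eq [of i] Gi_eq [of k] by linarith
qed simp

lemma Gi_neq_Fi: "Gi i \<noteq> Fi k"
proof -
  have "4 * x \<noteq> 4 * y + 2" "4 * x \<noteq> 4 * y + 3" "4 * x + 1 \<noteq> 4 * y + 2" "4 * x + 1 \<noteq> 4 * y + 3"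
    for x y :: nat
    by presburger+
  then show ?thesis
    unfolding Gi_def Fi_def by (simp only: split: if_split) blast
qed

lemma Gi_neq_a: "Gi i \<noteq> 4 * j + 3"
  unfolding Gi_def by (cases "even i"; simp; presburger)

text \<open>The partners precede the other vectors of their group, so that the entry at
  \<open>F i\<close> is small compared with \<open>perp (G i)\<close>.\<close>

lemma Gi_less_Fi: "Gi i < Fi i"
  unfolding Gi_def Fi_def by (cases "even i"; cases "u (i div 2) = 0"; simp)

lemma Gi_ge: "i \<le> Gi i"
  using Gi_eq [of i] mod_less_eq_dividend [of i 2] by linarith

lemma Fi_ge: "i \<le> Fi i"
  using Gi_ge [of i] Gi_less_Fi [of i] by simp

lemma a_G: "\<langle>a j, G i\<rangle> = 0" and a_z: "\<langle>a j, z i\<rangle> = 0" and G_w: "\<langle>G i, w j\<rangle> = 0"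
proof -
  note ne = Gi_neq_a [of i j]
  show "\<langle>a j, G i\<rangle> = 0"
    by (rule lev_orth [OF ne [symmetric] a_lev G_lev, of 0 0]) simp
  show "\<langle>a j, z i\<rangle> = 0"
    by (rule lev_orth [OF ne [symmetric] a_lev z_lev, of 0]) simp
  show "\<langle>G i, w j\<rangle> = 0"
    by (rule lev_orth [OF ne G_lev w_lev, of 0]) simp
qed

lemma G_z: "\<langle>G i, z k\<rangle> = 0"
proof (cases "i = k")
  case True
  then show ?thesis by (simp add: z_def G_def cinner_scaleC_right cinner_perp)
next
  case False
  then have "Gi i \<noteq> Gi k" by (simp add: Gi_inj)
  then show ?thesis by (rule lev_orth [OF _ G_lev z_lev, of _ _ 0]) simp
qed

lemma G_F: "\<langle>G i, F k\<rangle> = 0"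
  by (rule lev_orth [OF Gi_neq_Fi G_lev F_lev, of 0]) simp

lemma F_z: "\<langle>F k, z i\<rangle> = 0"
  by (rule lev_orth [OF Gi_neq_Fi [symmetric] F_lev z_lev]) simp

lemma G_G: "i \<noteq> k \<Longrightarrow> \<langle>G i, G k\<rangle> = 0"
  by (rule lev_orth [OF _ G_lev G_lev, of _ _ 0 0]) (simp_all add: Gi_inj)

lemma a_a: "j \<noteq> k \<Longrightarrow> \<langle>a j, a k\<rangle> = 0"
  by (rule lev_orth [OF _ a_lev a_lev, of _ _ 0 0]) simp_all

lemma a_F: "\<langle>a j, F i\<rangle> = 0"
proof (cases "j = i div 2")
  case True
  then show ?thesis
    using f1_a(2) f2_orth(2) cinner_eq_0_commute by (auto simp: F_def)
next
  case False
  then have "4 * j + 3 \<noteq> Fi i"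
    unfolding Fi_def by (cases "odd i \<and> u (i div 2) = 0"; simp; presburger)
  then show ?thesis
    by (rule lev_orth [OF _ a_lev F_lev, of _ _ 0]) simp
qed

lemma F_F:
  assumes "i \<noteq> k"
  shows "\<langle>F i, F k\<rangle> = 0"
proof (cases "i div 2 = k div 2")
  case True
  then have "even i \<noteq> even k"
    using assms by presburger
  then show ?thesis
    using True f2_orth(1) cinner_eq_0_commute by (auto simp: F_def)
next
  case False
  then have "Fi i \<noteq> Fi k"
    unfolding Fi_def
    by (cases "odd i \<and> u (i div 2) = 0"; cases "odd k \<and> u (k div 2) = 0"; simp; presburger)
  then show ?thesis
    by (rule lev_orth [OF _ F_lev F_lev]) simp
qed

lemma F_w: "\<langle>F i, w j\<rangle> = (if i = 2 * j then - ratio j else 0)"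
proof (cases "j = i div 2")
  case True
  show ?thesis
  proof (cases "even i")
    case i: True
    then have "i = 2 * j" using True by simp
    then show ?thesis by (simp add: F_def f1_w)
  next
    case i: False
    then have "i \<noteq> 2 * j" by auto
    with i True show ?thesis by (simp add: F_def w_def cinner_scaleC_right f2_orth)
  qed
next
  case False
  then have "\<langle>F i, f1 j\<rangle> = 0"
    using F_F [of i "2 * j"] by (auto simp: F_def)
  then show ?thesis
    using False by (auto simp: w_def cinner_scaleC_right)
qed

lemma \<eta>_le: "i \<le> n \<Longrightarrow> \<eta> n \<le> (1 / 2) ^ i / 16"
proof -
  assume "i \<le> n"
  then have "(1 / 2 :: real) ^ n \<le> (1 / 2) ^ i"
    by (intro power_decreasing) auto
  with \<eta>_geo [of n] show ?thesis by linarith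
qed

lemma \<eta>_le_1: "\<eta> n \<le> 1"
  using \<eta>_le [of 0 n] by simp

lemma norm_Fh: "norm (Fh i) \<le> 2"
proof (cases "even i")
  case True
  then have "norm (Fh i) \<le> norm (f1 (i div 2)) + norm (ratio (i div 2) *\<^sub>C a (i div 2))"
    by (simp only: Fh_def if_True norm_triangle_ineq)
  also have "\<dots> \<le> 1 + 1"
    using cmod_ratio [of "i div 2"] \<eta>_le_1 [of "4 * (i div 2) + 3"] by (simp add: norm_f1 norm_a)
  finally show ?thesis by simp
qed (simp add: Fh_def norm_f2)

text \<open>The quotient at \<open>G i\<close> contributes one \<eta>, the entry at
  \<open>F i\<close> two because \<open>norm (Fh i) \<le> 2\<close>; each \<eta> is at most
  \<open>(1 / 2) ^ i / 16\<close>.\<close>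

lemma norm_z: "norm (z i) \<le> 3 / 16 * (1 / 2) ^ i"
proof -
  define p where "p = norm (perp (G i))"
  have "p > 0" using v_perp by (simp add: p_def G_def)
  have "cmod \<langle>T (Fh i), F i\<rangle> \<le> norm (T (Fh i))"
    using cmod_cinner_le [of "T (Fh i)" "F i"] by (simp add: norm_F)
  also have "\<dots> \<le> \<eta> (Fi i) * p * norm (Fh i)"
    unfolding p_def G_def by (rule lev_small(3) [OF Fh_lev _ Gi_less_Fi]) simp
  also have "\<dots> \<le> \<eta> (Fi i) * p * 2"
    using \<eta>_pos [of "Fi i"] \<open>p > 0\<close> by (intro mult_left_mono norm_Fh) auto
  finally have 1: "cmod \<langle>T (Fh i), F i\<rangle> \<le> \<eta> (Fi i) * 2 * p"
    by (simp add: mult_ac)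
  have 2: "cmod (quot (G i)) \<le> \<eta> (Gi i) * p"
    unfolding p_def G_def by (rule v_quot)
  have "cmod (quot (G i) + \<langle>T (Fh i), F i\<rangle>) \<le> (\<eta> (Gi i) + \<eta> (Fi i) * 2) * p"
    using norm_triangle_ineq [of "quot (G i)" "\<langle>T (Fh i), F i\<rangle>"] 1 2 by (simp add: distrib_right)
  also have "\<dots> \<le> (3 / 16 * (1 / 2) ^ i) * p"
    using \<eta>_le [OF Gi_ge [of i]] \<eta>_le [OF Fi_ge [of i]] \<open>p > 0\<close> by (intro mult_right_mono) auto
  finally have "cmod (quot (G i) + \<langle>T (Fh i), F i\<rangle>) / p \<le> 3 / 16 * (1 / 2) ^ i"
    using \<open>p > 0\<close> by (simp add: divide_le_eq)
  moreover have "norm (z i) = cmod (quot (G i) + \<langle>T (Fh i), F i\<rangle>) / p"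
  proof -
    have "norm (z i) = cmod (- (quot (G i) + \<langle>T (Fh i), F i\<rangle>)) / p\<^sup>2 * p"
      unfolding z_def norm_scaleC complex_mod_cnj norm_divide norm_of_real by (simp add: p_def)
    then show ?thesis
      using \<open>p > 0\<close> unfolding norm_minus_cancel by (simp add: power2_eq_square)
  qed
  ultimately show ?thesis by simp
qed

section \<open>The shear and the similar operator\<close>

definition N1 :: "'a \<Rightarrow> 'a" where "N1 x = (\<Sum>j. \<langle>x, w j\<rangle> *\<^sub>C a j)"
definition N2 :: "'a \<Rightarrow> 'a" where "N2 x = (\<Sum>i. \<langle>x, z i\<rangle> *\<^sub>C G i)"
definition N :: "'a \<Rightarrow> 'a" where "N x = N1 x + N2 x"

lemma N1_term: "op_bound (\<lambda>x. \<langle>x, w j\<rangle> *\<^sub>C a j) (1 / 16 * (1 / 2) ^ j)"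
proof (rule op_bound_mono)
  show "op_bound (\<lambda>x. \<langle>x, w j\<rangle> *\<^sub>C a j) (norm (w j) * norm (a j))"
    by (rule op_bound_rank_one [OF form_bound_cinner])
  show "norm (w j) * norm (a j) \<le> 1 / 16 * (1 / 2) ^ j"
    using norm_w [of j] \<eta>_le [of j "4 * j + 3"] by (simp add: norm_a)
qed

lemma N2_term: "op_bound (\<lambda>x. \<langle>x, z i\<rangle> *\<^sub>C G i) (3 / 16 * (1 / 2) ^ i)"
proof (rule op_bound_mono)
  show "op_bound (\<lambda>x. \<langle>x, z i\<rangle> *\<^sub>C G i) (norm (z i) * norm (G i))"
    by (rule op_bound_rank_one [OF form_bound_cinner])
  show "norm (z i) * norm (G i) \<le> 3 / 16 * (1 / 2) ^ i"
    using norm_z [of i] by (simp add: norm_G)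
qed

lemmas N1_summable = op_bound_suminf(1) [OF N1_term geometric_half(1)]
lemmas N2_summable = op_bound_suminf(1) [OF N2_term geometric_half(1)]

lemma N1_bound: "op_bound N1 (1 / 8)" and N2_bound: "op_bound N2 (3 / 8)"
  using op_bound_suminf(2) [OF N1_term geometric_half(1)] op_bound_suminf(2) [OF N2_term geometric_half(1)]
  unfolding geometric_half(2) by (simp_all add: N1_def [abs_def] N2_def [abs_def])

lemma N_bound: "op_bound N 1"
  unfolding N_def [abs_def] using op_bound_plus [OF N1_bound N2_bound] by (rule op_bound_mono) simp

lemma N1_eq:
  assumes "\<And>k. k \<noteq> j \<Longrightarrow> \<langle>x, w k\<rangle> = 0"
  shows "N1 x = \<langle>x, w j\<rangle> *\<^sub>C a j"
proof -
  have "N1 x = (\<Sum>k\<in>{j}. \<langle>x, w k\<rangle> *\<^sub>C a k)"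
    unfolding N1_def by (rule suminf_finite) (auto simp: assms)
  then show ?thesis by simp
qed

lemma N1_eq_0: "(\<And>k. \<langle>x, w k\<rangle> = 0) \<Longrightarrow> N1 x = 0" and N2_eq_0: "(\<And>k. \<langle>x, z k\<rangle> = 0) \<Longrightarrow> N2 x = 0"
  by (simp_all add: N1_def N2_def)

lemma N_a: "N (a j) = 0" and N_G: "N (G i) = 0"
  by (simp_all add: N_def N1_eq_0 N2_eq_0 a_w a_z G_w G_z)

lemma N_F: "F i - N (F i) = Fh i"
proof (cases "even i")
  case True
  then obtain j where i: "i = 2 * j" by blast
  have "N1 (F i) = - (ratio j *\<^sub>C a j)"
    using N1_eq [of j "F i"] by (simp add: F_w i)
  then show ?thesis
    by (simp add: N_def N2_eq_0 F_z) (simp add: i F_def Fh_def)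
next
  case False
  then have "N1 (F i) = 0"
    by (intro N1_eq_0) (auto simp: F_w)
  then have "N (F i) = 0"
    by (simp add: N_def N2_eq_0 F_z)
  then show ?thesis
    using False by (simp add: F_def Fh_def)
qed

text \<open>The range of \<open>N\<close> lies in the closed span of the \<open>a j\<close> and
  \<open>G i\<close>, which are orthogonal to all \<open>w j\<close> and \<open>z i\<close>.
  Consequently \<open>1 + N\<close> inverts \<open>1 - N\<close>.\<close>

lemma N_N: "N (N x) = 0"
proof -
  have "N (N1 x) = 0"
    unfolding N1_def op_suminf [OF N_bound N1_summable] op_scaleC [OF N_bound] N_a by simp
  moreover have "N (N2 x) = 0"
    unfolding N2_def op_suminf [OF N_bound N2_summable] op_scaleC [OF N_bound] N_G by simp
  ultimately show ?thesis
    unfolding N_def [of x] op_add [OF N_bound] by simp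
qed

lemma cinner_N1: "\<langle>N1 x, t\<rangle> = (\<Sum>j. \<langle>x, w j\<rangle> * \<langle>a j, t\<rangle>)"
  and cinner_N2: "\<langle>N2 x, t\<rangle> = (\<Sum>i. \<langle>x, z i\<rangle> * \<langle>G i, t\<rangle>)"
  unfolding N1_def N2_def cinner_suminf_left [OF N1_summable] cinner_suminf_left [OF N2_summable]
    cinner_scaleC_left by (rule refl)+

lemma cinner_N_a: "\<langle>N x, a j\<rangle> = \<langle>x, w j\<rangle>"
proof -
  have "\<langle>N1 x, a j\<rangle> = (\<Sum>k\<in>{j}. \<langle>x, w k\<rangle> * \<langle>a k, a j\<rangle>)"
    unfolding cinner_N1 by (rule suminf_finite) (auto simp: a_a)
  moreover have "\<langle>G i, a j\<rangle> = 0" for i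
    using a_G cinner_eq_0_commute by blast
  then have "\<langle>N2 x, a j\<rangle> = 0"
    unfolding cinner_N2 by simp
  ultimately show ?thesis
    by (simp add: N_def cinner_add_left cinner_a)
qed

lemma cinner_N_G: "\<langle>N x, G i\<rangle> = \<langle>x, z i\<rangle>"
proof -
  have "\<langle>N2 x, G i\<rangle> = (\<Sum>k\<in>{i}. \<langle>x, z k\<rangle> * \<langle>G k, G i\<rangle>)"
    unfolding cinner_N2 by (rule suminf_finite) (auto simp: G_G)
  moreover have "\<langle>N1 x, G i\<rangle> = 0"
    unfolding cinner_N1 by (simp add: a_G)
  ultimately show ?thesis
    by (simp add: N_def cinner_add_left cinner_self norm_G)
qed

lemma cinner_N_F: "\<langle>N x, F i\<rangle> = 0"
  by (simp add: N_def cinner_add_left cinner_N1 cinner_N2 a_F G_F)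

definition T2 :: "'a \<Rightarrow> 'a" where "T2 x = T (x - N x) + N (T (x - N x))"

lemma shear_bound: "op_bound (\<lambda>x. x - N x) 2" "op_bound (\<lambda>x. x + N x) 2"
  using op_bound_minus [OF op_bound_id N_bound] op_bound_plus [OF op_bound_id N_bound] by simp_all

lemma T2_bound: "op_bound T2 (4 * \<tau>)"
proof (rule op_bound_mono)
  have "0 \<le> \<tau>" using \<tau>_pos by simp
  then show "op_bound T2 (2 * (\<tau> * 2))"
    using op_bound_comp [OF shear_bound(2) op_bound_comp [OF T shear_bound(1)]] by (simp add: T2_def [abs_def])
qed simp

lemma T2_compact: "compact_operator T2"
  using compact_operator_comp_left [OF shear_bound(2) compact_operator_comp_right [OF T_compact shear_bound(1)]]
  by (simp add: T2_def [abs_def])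

text \<open>The adjoint of \<open>1 + N\<close> takes \<open>a j\<close> to \<open>a j + w j\<close>
  and \<open>G i\<close> to \<open>G i + z i\<close>, and it fixes \<open>F i\<close>.\<close>

lemma cinner_T2_a: "\<langle>T2 x, a j\<rangle> = \<langle>x - N x, T' (a j + w j)\<rangle>"
  and cinner_T2_G: "\<langle>T2 x, G i\<rangle> = \<langle>x - N x, T' (G i + z i)\<rangle>"
  and cinner_T2_F: "\<langle>T2 x, F i\<rangle> = \<langle>x - N x, T' (F i)\<rangle>"
  unfolding adj [symmetric]
  by (simp_all add: T2_def cinner_add_left cinner_add_right cinner_N_a cinner_N_G cinner_N_F)

text \<open>\<open>N\<close> maps the \<open>f1 j\<close> part of \<open>T (a j)\<close> to the
  negative of its \<open>a j\<close> part; this cancellation fixes the size of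
  \<open>ratio j\<close>.\<close>

lemma T2_a: "T2 (a j) = complex_of_real (pn j) *\<^sub>C F (2 * j)"
proof -
  have "N (T (a j)) = complex_of_real (pn j) *\<^sub>C N (F (2 * j))"
    by (simp add: T_a op_add [OF N_bound] op_scaleC [OF N_bound] N_a F_def)
  also have "N (F (2 * j)) = - (ratio j *\<^sub>C a j)"
  proof -
    have "- N (F (2 * j)) = ratio j *\<^sub>C a j"
      using N_F [of "2 * j"] by (simp add: F_def Fh_def)
    then show ?thesis by (metis minus_minus)
  qed
  finally have "N (T (a j)) = - (quot (a j) *\<^sub>C a j)"
    by (simp add: scaleC_scaleC pn_ratio)
  then show ?thesis
    by (simp add: T2_def N_a T_a F_def)
qed

text \<open>By \<open>T'_aw\<close> the vector \<open>T' (a j + w j)\<close> lies in the span of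
  \<open>f1 j\<close> and \<open>f2 j\<close>. Both are orthogonal to \<open>y\<close>, and also to
  \<open>N y\<close>: its \<open>a\<close> part vanishes and its \<open>G\<close> part is orthogonal
  to every \<open>F i\<close>.\<close>

lemma cinner_T2_a_eq_0:
  assumes F: "\<And>i. \<langle>y, F i\<rangle> = 0"
  shows "\<langle>T2 y, a j\<rangle> = 0"
proof -
  have f: "\<langle>y, f1 k\<rangle> = 0" "\<langle>y, f2 k\<rangle> = 0" for k
    using F [of "2 * k"] F [of "2 * k + 1"] by (simp_all add: F_def)
  have "N1 y = 0"
    by (rule N1_eq_0) (simp add: w_def cinner_scaleC_right f)
  moreover have "\<langle>G i, f1 k\<rangle> = 0" "\<langle>G i, f2 k\<rangle> = 0" for i k
    using G_F [of i "2 * k"] G_F [of i "2 * k + 1"] by (simp_all add: F_def)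
  then have "\<langle>N2 y, f1 k\<rangle> = 0" "\<langle>N2 y, f2 k\<rangle> = 0" for k
    unfolding cinner_N2 by simp_all
  ultimately have "\<langle>y - N y, f1 k\<rangle> = 0" "\<langle>y - N y, f2 k\<rangle> = 0" for k
    by (simp_all add: N_def cinner_diff_left f)
  then show ?thesis
    unfolding cinner_T2_a by (subst T'_aw) (simp add: cinner_add_right cinner_scaleC_right)
qed

lemma T2_F_F: "\<langle>T2 (F i), F i\<rangle> = \<langle>T (Fh i), F i\<rangle>"
  unfolding cinner_T2_F N_F adj ..

lemma T2_G_F: "\<langle>T2 (G i), F i\<rangle> = 0"
proof -
  have "\<langle>G i, T' (F i)\<rangle> = 0"
    by (rule lev_orth [OF Gi_neq_Fi G_lev lev_T' [OF F_lev], of 0]) simp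
  then show ?thesis
    by (simp add: cinner_T2_F N_G)
qed

lemma T2_F_G: "\<langle>T2 (F i), G i\<rangle> = 0"
proof -
  have "T' (G i + z i) \<in> lev (Gi i) (Suc 1)"
    by (intro lev_T' lev_add G_lev z_lev)
  from lev_orth [OF Gi_neq_Fi [symmetric] Fh_lev this]
  have "\<langle>Fh i, T' (G i + z i)\<rangle> = 0" by simp
  then show ?thesis
    by (simp add: cinner_T2_G N_F)
qed

lemma T2_G_G: "\<langle>T2 (G i), G i\<rangle> = - \<langle>T (Fh i), F i\<rangle>"
proof -
  define p where "p = perp (G i)"
  have "p \<noteq> 0" using v_perp by (simp add: p_def G_def)
  have TG: "T (G i) = quot (G i) *\<^sub>C G i + p"
    by (simp add: p_def perp_def)
  have Gp: "\<langle>G i, p\<rangle> = 0"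
    by (simp add: p_def G_def cinner_perp)
  have pG: "\<langle>p, G i\<rangle> = 0"
    using Gp cinner_eq_0_commute by blast
  have "\<langle>T2 (G i), G i\<rangle> = \<langle>T (G i), G i\<rangle> + \<langle>T (G i), z i\<rangle>"
    by (simp add: cinner_T2_G N_G cinner_add_right flip: adj)
  also have "\<langle>T (G i), G i\<rangle> = quot (G i)"
    by (simp add: quot_def)
  also have "\<langle>T (G i), z i\<rangle> = - (quot (G i) + \<langle>T (Fh i), F i\<rangle>)"
    using \<open>p \<noteq> 0\<close> unfolding TG z_def p_def [symmetric]
    by (simp add: cinner_add_left cinner_scaleC_left cinner_scaleC_right Gp cinner_self del: of_real_power)
  finally show ?thesis by simp
qed

definition h :: "nat \<Rightarrow> 'a" where
  "h n = complex_of_real (1 / sqrt 2) *\<^sub>C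
     (if even n then F (n div 2) + G (n div 2) else F (n div 2) - G (n div 2))"

lemma F_G: "\<langle>F i, G k\<rangle> = 0"
  using G_F cinner_eq_0_commute by blast

lemma cinner_F_self: "\<langle>F i, F i\<rangle> = 1" and cinner_G_self: "\<langle>G i, G i\<rangle> = 1"
  by (simp_all add: cinner_self norm_F norm_G)

lemma half_mult: "complex_of_real (1 / sqrt 2) * complex_of_real (1 / sqrt 2) = 1 / 2"
proof -
  have "(1 / sqrt 2) * (1 / sqrt 2) = (1 / 2 :: real)"
    by simp
  then have "complex_of_real ((1 / sqrt 2) * (1 / sqrt 2)) = complex_of_real (1 / 2)"
    by (rule arg_cong)
  then show ?thesis
    by (simp only: of_real_mult) simp
qed

lemma h_orthosystem: "orthosystem h" and h_norm: "norm (h n) = 1"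
proof -
  have "\<langle>h n, h n\<rangle> = 1" for n
  proof -
    have "\<langle>h n, h n\<rangle> = complex_of_real (1 / sqrt 2) * complex_of_real (1 / sqrt 2) * 2"
      by (simp add: h_def cinner_simps F_G G_F cinner_F_self cinner_G_self)
    then show ?thesis by (simp only: half_mult) simp
  qed
  then have n: "norm (h n) = 1" for n
    by (metis cinner_self of_real_eq_1_iff norm_ge_zero power2_eq_imp_eq one_power2 zero_le_one)
  then show "norm (h n) = 1" .
  have "\<langle>h m, h n\<rangle> = 0" if "m \<noteq> n" for m n
  proof (cases "m div 2 = n div 2")
    case True
    then have "even m \<noteq> even n" using that by presburger
    then show ?thesis
      using True by (auto simp: h_def cinner_simps F_G G_F cinner_F_self cinner_G_self)
  next
    case False
    then show ?thesis
      by (simp add: h_def cinner_simps F_G G_F F_F G_G)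
  qed
  then show "orthosystem h"
    using n by (simp add: orthosystem_def)
qed

lemma orth_h:
  assumes "\<And>n. \<langle>y, h n\<rangle> = 0"
  shows "\<langle>y, F i\<rangle> = 0" "\<langle>y, G i\<rangle> = 0"
proof -
  have "\<langle>y, F i\<rangle> + \<langle>y, G i\<rangle> = 0" "\<langle>y, F i\<rangle> - \<langle>y, G i\<rangle> = 0"
    using assms [of "2 * i"] assms [of "2 * i + 1"] by (simp_all add: h_def cinner_simps)
  then show "\<langle>y, F i\<rangle> = 0" "\<langle>y, G i\<rangle> = 0"
    by simp_all
qed

lemma h_a: "\<langle>h n, a j\<rangle> = 0"
proof -
  have "\<langle>F i, a j\<rangle> = 0" "\<langle>G i, a j\<rangle> = 0" for i
    using a_F a_G cinner_eq_0_commute by blast+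
  then show ?thesis
    by (simp add: h_def cinner_simps)
qed

text \<open>The entries between \<open>F i\<close> and \<open>G i\<close> vanish because their
  levels are separate, and the diagonal entries there are opposite, so each of
  \<open>F i + G i\<close> and \<open>F i - G i\<close> averages them to \<open>0\<close>.\<close>

lemma T2_h_diag: "\<langle>T2 (h n), h n\<rangle> = 0"
  by (simp add: h_def op_scaleC [OF T2_bound] op_add [OF T2_bound] op_diff [OF T2_bound] cinner_simps
      T2_F_F T2_G_F T2_F_G T2_G_G)

lemma T2_h_col: "norm (T2 (h n)) \<le> coupling_bound (4 * \<tau>) n"
proof -
  define i where "i = n div 2"
  have n: "n \<le> 2 * i + 1" by (simp add: i_def)
  \<comment> \<open>The \<open>6\<close> is needed for \<open>4 * \<eta>\<close> from
    \<open>F i\<close>, whose shear has norm at most \<open>2\<close> and whose image passes through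
    \<open>1 + N\<close>, plus \<open>2 * \<eta>\<close> from \<open>G i\<close>.\<close>
  have cb: "6 * \<eta> m \<le> coupling_bound (4 * \<tau>) n" if "i \<le> m" for m
    using n that by (intro \<eta>_coupling) simp
  have T2_le: "norm (T2 x) \<le> 2 * norm (T (x - N x))" for x
    using op_norm [OF shear_bound(2), of "T (x - N x)"] by (simp add: T2_def)
  have "norm (T (Fh i)) \<le> \<eta> (Fi i) * norm (Fh i)"
    by (rule lev_small(1) [OF Fh_lev]) simp
  also have "\<dots> \<le> \<eta> (Fi i) * 2"
    using \<eta>_pos [of "Fi i"] by (intro mult_left_mono norm_Fh) auto
  finally have F: "norm (T2 (F i)) \<le> 4 * \<eta> (Fi i)"
    using T2_le [of "F i"] by (simp add: N_F)
  have "norm (T (G i)) \<le> \<eta> (Gi i) * norm (G i)"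
    by (rule lev_small(1) [OF G_lev, of 0]) simp
  then have G: "norm (T2 (G i)) \<le> 2 * \<eta> (Gi i)"
    using T2_le [of "G i"] by (simp add: N_G norm_G)
  have "norm (T2 (h n)) \<le> norm (T2 (F i)) + norm (T2 (G i))"
  proof -
    have "norm (complex_of_real (1 / sqrt 2) *\<^sub>C x) \<le> norm x" for x :: 'a
      using mult_left_mono [of 1 "sqrt 2" "norm x"] by (simp add: norm_divide divide_le_eq)
    moreover have "T2 (h n) = complex_of_real (1 / sqrt 2) *\<^sub>C
        (if even n then T2 (F i) + T2 (G i) else T2 (F i) - T2 (G i))"
      by (simp only: h_def i_def op_scaleC [OF T2_bound] op_add [OF T2_bound] op_diff [OF T2_bound] if_distrib [of T2])
    ultimately show ?thesis
      using norm_triangle_ineq [of "T2 (F i)" "T2 (G i)"] norm_triangle_ineq4 [of "T2 (F i)" "T2 (G i)"]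
      by (smt (verit))
  qed
  also have "\<dots> \<le> coupling_bound (4 * \<tau>) n"
    using F G cb [OF Fi_ge] cb [OF Gi_ge] by simp
  finally show ?thesis .
qed

lemma T2_h_row: "cmod \<langle>T2 x, h n\<rangle> \<le> coupling_bound (4 * \<tau>) n * norm x"
proof -
  define i where "i = n div 2"
  have n: "n \<le> 2 * i + 1" by (simp add: i_def)
  have cb: "6 * \<eta> m \<le> coupling_bound (4 * \<tau>) n" if "i \<le> m" for m
    using n that by (intro \<eta>_coupling) simp
  have le: "cmod \<langle>x - N x, t\<rangle> \<le> 2 * norm x * norm t" for t
    using cmod_cinner_le [of "x - N x" t] mult_right_mono [OF op_norm [OF shear_bound(1), of x] norm_ge_zero [of t]]
    by linarith
  have "norm (T' (F i)) \<le> \<eta> (Fi i)"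
    using lev_small(2) [OF F_lev [of i]] by (simp add: norm_F)
  then have F: "cmod \<langle>T2 x, F i\<rangle> \<le> 2 * norm x * \<eta> (Fi i)"
    unfolding cinner_T2_F using le [of "T' (F i)"] mult_left_mono [of "norm (T' (F i))" "\<eta> (Fi i)" "2 * norm x"] by simp
  have "norm (G i + z i) \<le> 2"
  proof -
    have "norm (z i) \<le> 1"
      using norm_z [of i] power_le_one [of "1 / 2 :: real" i] by simp
    then show ?thesis
      using norm_triangle_ineq [of "G i" "z i"] by (simp add: norm_G)
  qed
  then have "\<eta> (Gi i) * norm (G i + z i) \<le> \<eta> (Gi i) * 2"
    using \<eta>_pos [of "Gi i"] by (intro mult_left_mono) auto
  moreover have "norm (T' (G i + z i)) \<le> \<eta> (Gi i) * norm (G i + z i)"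
    by (rule lev_small(2) [OF lev_add [OF G_lev z_lev]]) simp
  ultimately have "norm (T' (G i + z i)) \<le> \<eta> (Gi i) * 2"
    by linarith
  then have G: "cmod \<langle>T2 x, G i\<rangle> \<le> 2 * norm x * (\<eta> (Gi i) * 2)"
    unfolding cinner_T2_G using le [of "T' (G i + z i)"]
      mult_left_mono [of "norm (T' (G i + z i))" "\<eta> (Gi i) * 2" "2 * norm x"] by simp
  have "cmod \<langle>T2 x, h n\<rangle> \<le> cmod \<langle>T2 x, F i\<rangle> + cmod \<langle>T2 x, G i\<rangle>"
  proof -
    have "cmod (complex_of_real (1 / sqrt 2) * c) \<le> cmod c" for c
      using mult_left_mono [of 1 "sqrt 2" "cmod c"] by (simp add: norm_mult norm_divide divide_le_eq)
    moreover have "\<langle>T2 x, h n\<rangle> = complex_of_real (1 / sqrt 2) *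
        (if even n then \<langle>T2 x, F i\<rangle> + \<langle>T2 x, G i\<rangle> else \<langle>T2 x, F i\<rangle> - \<langle>T2 x, G i\<rangle>)"
      by (simp add: h_def i_def cinner_simps)
    ultimately show ?thesis
      using norm_triangle_ineq [of "\<langle>T2 x, F i\<rangle>" "\<langle>T2 x, G i\<rangle>"] norm_triangle_ineq4 [of "\<langle>T2 x, F i\<rangle>" "\<langle>T2 x, G i\<rangle>"]
      by (smt (verit))
  qed
  also have "\<dots> \<le> (2 * \<eta> (Fi i) + 4 * \<eta> (Gi i)) * norm x"
    using F G by (simp add: algebra_simps)
  also have "\<dots> \<le> coupling_bound (4 * \<tau>) n * norm x"
    using cb [OF Fi_ge] cb [OF Gi_ge] by (intro mult_right_mono) auto
  finally show ?thesis .
qed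

text \<open>In \<open>commutator_assembly\<close> the \<open>a j\<close> take the role of the
  infinite-dimensional subspace, and the rotated pairs \<open>h n\<close> that of the
  eigenvectors.\<close>

lemma sheared_commutator:
  fixes e :: "nat \<Rightarrow> 'a"
  assumes e: "orthosystem e" and basis: "\<And>x. proj e x = x"
  shows "\<exists>A B. compact_operator A \<and> compact_operator B \<and> op_bound A (48 * sqrt \<tau>) \<and> op_bound B (48 * sqrt \<tau>) \<and>
    (\<forall>x. T x = A (B x) - B (A x))"
proof -
  have a_os: "orthosystem a"
    by (simp add: orthosystem_def norm_a a_a)
  have Ta0: "\<langle>T2 (a n), y\<rangle> = 0" if "\<And>i. \<langle>y, h i\<rangle> = 0" for n y
  proof -
    have "\<langle>F i, y\<rangle> = 0" for i
      using orth_h(1) [OF that] cinner_eq_0_commute by blast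
    then show ?thesis
      by (simp add: T2_a cinner_scaleC_left)
  qed
  have aT0: "\<langle>T2 y, a n\<rangle> = 0" if "\<And>i. \<langle>y, h i\<rangle> = 0" for n y
    using orth_h(1) [OF that] by (rule cinner_T2_a_eq_0)
  have "4 * \<tau> > 0" using \<tau>_pos by simp
  have "\<exists>A B. compact_operator A \<and> compact_operator B \<and>
    op_bound A (6 * sqrt (4 * \<tau>)) \<and> op_bound B (6 * sqrt (4 * \<tau>)) \<and> (\<forall>x. T2 x = A (B x) - B (A x))"
  proof (rule commutator_assembly [OF e basis a_os norm_a h_orthosystem h_norm h_a T2_compact T2_bound \<open>4 * \<tau> > 0\<close>])
    show "\<langle>T2 (a n), y\<rangle> = 0" if "\<And>i. \<langle>y, h i\<rangle> = 0" for n y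
      using that by (rule Ta0)
    show "\<langle>T2 y, a n\<rangle> = 0" if "\<And>i. \<langle>y, h i\<rangle> = 0" for n y
      using that by (rule aT0)
  qed (fact T2_h_diag T2_h_col T2_h_row)+
  then obtain A B where AB: "compact_operator A" "compact_operator B"
    "op_bound A (6 * sqrt (4 * \<tau>))" "op_bound B (6 * sqrt (4 * \<tau>))" and com: "\<forall>x. T2 x = A (B x) - B (A x)"
    by (elim exE conjE) (rule that)
  \<comment> \<open>The similarity is undone by conjugating with \<open>1 - N\<close> on the left
    and its inverse on the right.\<close>
  define A' where "A' x = A (x + N x) - N (A (x + N x))" for x
  define B' where "B' x = B (x + N x) - N (B (x + N x))" for x
  have bound: "op_bound (\<lambda>x. S (x + N x) - N (S (x + N x))) (48 * sqrt \<tau>)"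
    if "op_bound S (6 * sqrt (4 * \<tau>))" for S
  proof (rule op_bound_mono)
    show "op_bound (\<lambda>x. S (x + N x) - N (S (x + N x))) (2 * (6 * sqrt (4 * \<tau>) * 2))"
      by (rule op_bound_comp [OF shear_bound(1) op_bound_comp [OF that shear_bound(2)]]) (use \<tau>_pos in auto)
  qed (simp add: real_sqrt_mult)
  have compact: "compact_operator (\<lambda>x. S (x + N x) - N (S (x + N x)))" if "compact_operator S" for S
    by (rule compact_operator_comp_left [OF shear_bound(1) compact_operator_comp_right [OF that shear_bound(2)]])
  have inverse: "x - N x + N (x - N x) = x" "x + N x - N (x + N x) = x" for x
    by (simp_all add: op_add [OF N_bound] op_diff [OF N_bound] N_N)
  have "T x = A' (B' x) - B' (A' x)" for x
  proof -
    define y where "y = x + N x"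
    have "A' (B' x) = A (B y) - N (A (B y))" "B' (A' x) = B (A y) - N (B (A y))"
      unfolding A'_def B'_def inverse y_def by (rule refl)+
    then have "A' (B' x) - B' (A' x) = T2 y - N (T2 y)"
      using com by (simp add: op_diff [OF N_bound])
    also have "\<dots> = T x"
      unfolding T2_def y_def inverse by (rule refl)
    finally show ?thesis by simp
  qed
  then show ?thesis
    using bound [OF AB(3)] bound [OF AB(4)] compact [OF AB(1)] compact [OF AB(2)]
    by (intro exI [of _ A'] exI [of _ B']) (simp add: A'_def [abs_def] B'_def [abs_def])
qed

end

text \<open>Either \<open>T\<close> is nonzero on the complement of every finite set, and far
  families exist, or it has finite rank and a large reducing kernel is found directly.\<close>

lemma compact_operator_is_commutator:
  fixes T :: "'a::chilbert_space \<Rightarrow> 'a" and e :: "nat \<Rightarrow> 'a"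
  assumes inf: "infinite_cdim TYPE('a)" and e: "orthosystem e" and basis: "\<And>x. proj e x = x"
    and T: "compact_operator T" and T_bound: "op_bound T \<tau>" and "\<tau> > 0"
  shows "\<exists>A B. compact_operator A \<and> compact_operator B \<and> op_bound A (48 * sqrt \<tau>) \<and> op_bound B (48 * sqrt \<tau>) \<and>
    (\<forall>x. T x = A (B x) - B (A x))"
proof -
  obtain T' where T': "op_bound T' \<tau>" and adj: "\<And>x y. \<langle>T x, y\<rangle> = \<langle>x, T' y\<rangle>"
    by (rule ex_adjoint [OF e basis T_bound less_imp_le [OF \<open>\<tau> > 0\<close>]]) (rule that)
  interpret compact_pair T T' \<tau>
    by unfold_locales (fact T T_bound T' adj \<open>\<tau> > 0\<close>)+
  show ?thesis
  proof (cases "\<forall>Y. finite Y \<longrightarrow> (\<exists>x. (\<forall>y\<in>Y. \<langle>x, y\<rangle> = 0) \<and> T x \<noteq> 0)")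
    case True
    \<comment> \<open>A vector of index \<open>n\<close> may enter any \<open>h m\<close> with
      \<open>m \<le> 2 * n + 1\<close>, so it has to obey all these coupling bounds at once.\<close>
    define M where "M n = Min (coupling_bound (4 * \<tau>) ` {..2 * n + 1})" for n
    define \<eta> where "\<eta> n = min ((1 / 2) ^ n / 16) (M n / 6)" for n
    have M_pos: "M n > 0" for n
      unfolding M_def using coupling_bound_pos [of "4 * \<tau>"] \<open>\<tau> > 0\<close> by (subst Min_gr_iff) auto
    have M_le: "M n \<le> coupling_bound (4 * \<tau>) m" if "m \<le> 2 * n + 1" for m n
      unfolding M_def using that by (intro Min_le) auto
    have \<eta>_pos: "\<eta> n > 0" and \<eta>_geo: "\<eta> n \<le> (1 / 2) ^ n / 16" for n
      using M_pos [of n] by (simp_all add: \<eta>_def)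
    have \<eta>_coupling: "6 * \<eta> n \<le> coupling_bound (4 * \<tau>) m" if "m \<le> 2 * n + 1" for m n
    proof -
      have "6 * \<eta> n \<le> M n" by (simp add: \<eta>_def min_def)
      with M_le [OF that] show ?thesis by linarith
    qed
    have "\<exists>(v :: nat \<Rightarrow> 'a) F \<epsilon>. \<forall>n. norm (v n) = 1 \<and> perp (v n) \<noteq> 0 \<and>
      cmod (quot (v n)) \<le> \<eta> n * norm (perp (v n)) \<and>
      far 8 (v ` {..<n} \<union> F n) (v n) \<and> \<epsilon> n \<le> \<eta> n \<and> (\<forall>m<n. \<epsilon> n \<le> \<eta> n * norm (perp (v m))) \<and>
      (\<forall>x. far 1 (F n) x \<longrightarrow> norm (T x) \<le> \<epsilon> n * norm x \<and> norm (T' x) \<le> \<epsilon> n * norm x)"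
    proof (rule ex_far_sequence [OF inf])
      show "\<exists>x. (\<forall>y\<in>Y. \<langle>x, y\<rangle> = 0) \<and> T x \<noteq> 0" if "finite Y" for Y
        using True that by blast
    qed (rule \<eta>_pos)
    then obtain v :: "nat \<Rightarrow> 'a" and F \<epsilon> where v: "\<forall>n. norm (v n) = 1 \<and> perp (v n) \<noteq> 0 \<and>
      cmod (quot (v n)) \<le> \<eta> n * norm (perp (v n)) \<and>
      far 8 (v ` {..<n} \<union> F n) (v n) \<and> \<epsilon> n \<le> \<eta> n \<and> (\<forall>m<n. \<epsilon> n \<le> \<eta> n * norm (perp (v m))) \<and>
      (\<forall>x. far 1 (F n) x \<longrightarrow> norm (T x) \<le> \<epsilon> n * norm x \<and> norm (T' x) \<le> \<epsilon> n * norm x)"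
      by (elim exE) (rule that)
    interpret far_family T T' \<tau> v F \<epsilon> \<eta>
    proof unfold_locales
      show "\<eta> n > 0" "\<eta> n \<le> (1 / 2) ^ n / 16" for n
        by (fact \<eta>_pos \<eta>_geo)+
      show "6 * \<eta> n \<le> coupling_bound (4 * \<tau>) m" if "m \<le> 2 * n + 1" for m n
        using that by (rule \<eta>_coupling)
    qed (use v in simp_all)
    show ?thesis
      by (rule sheared_commutator [OF e basis])
  next
    case False
    then obtain Y where "finite Y" and Y: "\<And>x. (\<And>y. y \<in> Y \<Longrightarrow> \<langle>x, y\<rangle> = 0) \<Longrightarrow> T x = 0"
      by blast
    \<comment> \<open>Orthogonality to \<open>Y\<close> puts the \<open>r n\<close> into the kernel.
      The range of \<open>T\<close> is spanned by the image of \<open>Y\<close>, so orthogonality to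
      that image makes the kernel reducing.\<close>
    have "finite (Y \<union> T ` Y)" using \<open>finite Y\<close> by simp
    then obtain r :: "nat \<Rightarrow> 'a" where r: "orthosystem r" and r_unit: "\<And>n. norm (r n) = 1"
      and rY: "\<And>n y. y \<in> Y \<union> T ` Y \<Longrightarrow> \<langle>r n, y\<rangle> = 0"
      using ex_orthonormal_sequence [OF inf] by metis
    note P = op_bound_proj [OF r]
    have Tr: "T (r n) = 0" for n
      by (rule Y) (simp add: rY)
    have rT: "\<langle>T x, r n\<rangle> = 0" for x n
    proof -
      obtain p where p: "p \<in> complex_vector.span Y" "\<forall>y\<in>Y. \<langle>x - p, y\<rangle> = 0"
        using finite_span_projection [OF \<open>finite Y\<close>] by blast
      have "T (x - p) = 0"
        by (rule Y) (use p(2) in blast)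
      then have "T x = T p"
        by (simp add: op_diff [OF T_bound])
      moreover have "\<langle>T' (r n), p\<rangle> = 0"
        by (rule cinner_span_eq_0 [OF p(1)]) (simp add: adj' rY)
      then have "\<langle>r n, T p\<rangle> = 0"
        by (simp add: adj')
      ultimately show ?thesis
        using cinner_eq_0_commute by metis
    qed
    define Q where "Q x = x - proj r x" for x
    have Q: "op_bound Q 1"
      unfolding Q_def
      by (intro op_boundI) (simp_all add: norm_diff_proj_le [OF r] op_add [OF P] op_scaleC [OF P] scaleC_diff_right)
    have T_proj: "T (proj r x) = 0" for x
      unfolding proj_def op_suminf [OF T_bound proj_summable [OF r]] op_scaleC [OF T_bound] Tr by simp
    have "\<exists>A B. compact_operator A \<and> compact_operator B \<and>
      op_bound A (4 * sqrt \<tau>) \<and> op_bound B (4 * sqrt \<tau>) \<and> (\<forall>x. T x = A (B x) - B (A x)) \<and>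
      (\<forall>M m y. norm ((A ^^ m) y) \<le> real (M + 1) ^ M * (4 * sqrt \<tau> / sqrt (real (M + 1))) ^ m * norm y) \<and>
      (\<forall>h. Q h = 0 \<longrightarrow> (\<forall>n. \<langle>h, r n\<rangle> = 0) \<longrightarrow>
         A h = 0 \<and> B h = 0 \<and> (\<forall>y. \<langle>A y, h\<rangle> = 0 \<and> \<langle>B y, h\<rangle> = 0))"
    proof (rule commutator_large_kernel [OF e basis r r_unit Q _ _ _ T_compact T_bound \<open>\<tau> > 0\<close>])
      show "Q (Q x) = Q x" "\<langle>Q x, y\<rangle> = \<langle>x, Q y\<rangle>" "Q (r n) = 0" "Q (T x) = T x" "T (Q x) = T x" for x y n
        by (simp_all add: Q_def op_diff [OF P] op_diff [OF T_bound] proj_idem [OF r] proj_basis [OF r] T_proj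
            proj_eq_0 rT cinner_diff_left cinner_diff_right proj_self_adjoint [OF r])
    qed
    then obtain A B where AB: "compact_operator A" "compact_operator B"
      "op_bound A (4 * sqrt \<tau>)" "op_bound B (4 * sqrt \<tau>)" "\<forall>x. T x = A (B x) - B (A x)"
      by (elim exE conjE) (rule that)
    have "4 * sqrt \<tau> \<le> 48 * sqrt \<tau>" using \<open>\<tau> > 0\<close> by simp
    with AB show ?thesis
      by (intro exI [of _ A] exI [of _ B] conjI) (auto intro: op_bound_mono)
  qed
qed

theorem theorem1p1:
  fixes \<kappa> :: real
  assumes separable: "separable_space (euclidean :: 'a::chilbert_space topology)"
    and infinite_dim: "infinite_cdim TYPE('a)"
    and kappa_ge: "\<kappa> \<ge> 4"
    and kappa: "\<And>(d::nat) H. d \<ge> 1 \<Longrightarrow> H \<in> carrier_mat d d \<Longrightarrow> trace_mat H = 0 \<Longrightarrow>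
      \<exists>U \<in> carrier_mat d d. \<exists>V \<in> carrier_mat d d.
        H = U * V - V * U \<and> max (opnorm_mat U) (opnorm_mat V) \<le> sqrt (\<kappa> * opnorm_mat H)"
  shows "\<forall>T :: 'a \<Rightarrow> 'a. compact_operator T \<longrightarrow>
    (\<exists>A B :: 'a \<Rightarrow> 'a. compact_operator A \<and> compact_operator B \<and>
      T = (\<lambda>x. A (B x) - B (A x)) \<and>
      max (onorm A) (onorm B) \<le> 50 * sqrt (\<kappa> * onorm T))"
proof (intro allI impI)
  fix T :: "'a \<Rightarrow> 'a"
  assume T: "compact_operator T"
  note T_bound = compact_op_bound [OF T]
  have nonneg: "onorm T \<ge> 0"
    by (intro onorm_pos_le compact_operator_imp_bounded_linear T)
  show "\<exists>A B :: 'a \<Rightarrow> 'a. compact_operator A \<and> compact_operator B \<and>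
      T = (\<lambda>x. A (B x) - B (A x)) \<and> max (onorm A) (onorm B) \<le> 50 * sqrt (\<kappa> * onorm T)"
  proof (cases "onorm T = 0")
    \<comment> \<open>Norm zero is separate because the factorization divides by
      \<open>sqrt \<tau>\<close>.\<close>
    case True
    have "T x = 0" for x
      using op_norm [OF T_bound, of x] True by simp
    then have "T = (\<lambda>x. 0 - 0)" by auto
    then show ?thesis
      using compact_operator_zero True by (intro exI [of _ "\<lambda>x. 0"]) (simp add: onorm_zero)
  next
    case False
    with nonneg have pos: "onorm T > 0" by simp
    obtain e :: "nat \<Rightarrow> 'a" where e: "orthosystem e" "\<And>x. proj e x = x"
      using ex_orthonormal_basis [OF separable] by metis
    obtain A B where AB: "compact_operator A" "compact_operator B" "op_bound A (48 * sqrt (onorm T))"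
      "op_bound B (48 * sqrt (onorm T))" and com: "\<forall>x. T x = A (B x) - B (A x)"
      using compact_operator_is_commutator [OF infinite_dim e T T_bound pos] by (elim exE conjE) (rule that)
    have "onorm A \<le> 48 * sqrt (onorm T)" "onorm B \<le> 48 * sqrt (onorm T)"
      using AB(3,4) nonneg by (auto intro: op_bound_onorm)
    moreover have "48 * sqrt (onorm T) \<le> 50 * sqrt (\<kappa> * onorm T)"
    proof -
      have "1 * onorm T \<le> \<kappa> * onorm T"
        using kappa_ge nonneg by (intro mult_right_mono) auto
      then have "sqrt (onorm T) \<le> sqrt (\<kappa> * onorm T)"
        by simp
      then show ?thesis
        using nonneg kappa_ge by (intro mult_mono) auto
    qed
    ultimately show ?thesis
      using AB com by (intro exI [of _ A] exI [of _ B]) auto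
  qed
qed

end
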